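(* For all objects $X$, $Y$ in a semi-abelian category $\mathcal X$, the bilinear product $X\otimes_{\mathcal X}Y$ is an abelian object of $\mathcal X$. This makes the bilinear product on $\mathcal X$ into a functor $\otimes_{\mathcal X}\colon\mathcal X\times\mathcal X\to\mathsf{Ab}(\mathcal X)\colon(X,Y)\mapsto X\otimes_{\mathcal X}Y$.
   Context: A semi-abelian category is a pointed, Barr-exact, Bourn-protomodular category with finite coproducts. An object is abelian if it admits an internal abelian group structure; $\mathsf{Ab}(\mathcal X)$ is the full subcategory of abelian objects. The cosmash product $X\diamond Y$ is the kernel of the canonical morphism $X+Y\to X\times Y$; the ternary cosmash product $X\diamond Y\diamond Z$ is the kernel of the canonical morphism $X+Y+Z\to(X+Y)\times(X+Z)\times(Y+Z)$ whose components kill $Z$, $Y$, $X$ respectively. The commutator $[X,X,X]$ is the image of $X\diamond X\diamond X\to X+X+X\to X$ (the last arrow being the codiagonal). $X$ is two-nilpotent if $[X,X,X]=0$; the two-nilpotent objects form a full reflective subcategory $\mathsf{Nil}_2(\mathcal X)$, itself semi-abelian, with reflector $\mathrm{nil}_2(X)=X/[X,X,X]$. The bilinear product $X\otimes_{\mathcal X}Y$ is the cosmash product of $\mathrm{nil}_2(X)$ and $\mathrm{nil}_2(Y)$ computed in $\mathsf{Nil}_2(\mathcal X)$. *)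

theory Defs
  imports Main
begin

section \<open>Categories and functors\<close>

record ('o, 'm) cat =
  Obj :: "'o set"
  Arr :: "'m set"
  Dom :: "'m \<Rightarrow> 'o"
  Cod :: "'m \<Rightarrow> 'o"
  Ident :: "'o \<Rightarrow> 'm"
  Comp :: "'m \<Rightarrow> 'm \<Rightarrow> 'm" (infixl "\<cdot>\<index>" 70)

definition hom :: "('o, 'm) cat \<Rightarrow> 'o \<Rightarrow> 'o \<Rightarrow> 'm set" where
  "hom C X Y = {f \<in> Arr C. Dom C f = X \<and> Cod C f = Y}"

locale category =
  fixes C :: "('o, 'm) cat" (structure)
  assumes Dom_in_Obj: "f \<in> Arr C \<Longrightarrow> Dom C f \<in> Obj C"
    and Cod_in_Obj: "f \<in> Arr C \<Longrightarrow> Cod C f \<in> Obj C"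
    and Ident_in_hom: "X \<in> Obj C \<Longrightarrow> Ident C X \<in> hom C X X"
    and Comp_in_hom: "\<lbrakk>f \<in> hom C X Y; g \<in> hom C Y Z\<rbrakk> \<Longrightarrow> g \<cdot> f \<in> hom C X Z"
    and Comp_Ident: "f \<in> hom C X Y \<Longrightarrow> f \<cdot> Ident C X = f"
    and Ident_Comp: "f \<in> hom C X Y \<Longrightarrow> Ident C Y \<cdot> f = f"
    and Comp_assoc:
      "\<lbrakk>f \<in> hom C X Y; g \<in> hom C Y Z; h \<in> hom C Z W\<rbrakk> \<Longrightarrow> (h \<cdot> g) \<cdot> f = h \<cdot> (g \<cdot> f)"

definition full_subcat :: "('o, 'm) cat \<Rightarrow> ('o \<Rightarrow> bool) \<Rightarrow> ('o, 'm) cat" where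
  "full_subcat C P =
     C\<lparr>Obj := {X \<in> Obj C. P X}, Arr := {f \<in> Arr C. P (Dom C f) \<and> P (Cod C f)}\<rparr>"

definition prod_cat :: "('o, 'm) cat \<Rightarrow> ('p, 'n) cat \<Rightarrow> ('o \<times> 'p, 'm \<times> 'n) cat" where
  "prod_cat C D =
     \<lparr>Obj = Obj C \<times> Obj D,
      Arr = Arr C \<times> Arr D,
      Dom = (\<lambda>(f, g). (Dom C f, Dom D g)),
      Cod = (\<lambda>(f, g). (Cod C f, Cod D g)),
      Ident = (\<lambda>(X, Y). (Ident C X, Ident D Y)),
      Comp = (\<lambda>(f', g') (f, g). (f' \<cdot>\<^bsub>C\<^esub> f, g' \<cdot>\<^bsub>D\<^esub> g))\<rparr>"

locale is_functor = source: category C + target: category D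
  for C :: "('o, 'm) cat" and D :: "('p, 'n) cat" +
  fixes Fo :: "'o \<Rightarrow> 'p" and Fm :: "'m \<Rightarrow> 'n"
  assumes functor_Obj: "X \<in> Obj C \<Longrightarrow> Fo X \<in> Obj D"
    and functor_hom: "f \<in> hom C X Y \<Longrightarrow> Fm f \<in> hom D (Fo X) (Fo Y)"
    and functor_Ident: "X \<in> Obj C \<Longrightarrow> Fm (Ident C X) = Ident D (Fo X)"
    and functor_Comp:
      "\<lbrakk>f \<in> hom C X Y; g \<in> hom C Y Z\<rbrakk> \<Longrightarrow> Fm (g \<cdot>\<^bsub>C\<^esub> f) = Fm g \<cdot>\<^bsub>D\<^esub> Fm f"


section \<open>Special arrows, limits and colimits\<close>

definition is_iso :: "('o, 'm) cat \<Rightarrow> 'm \<Rightarrow> bool" where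
  "is_iso C f \<longleftrightarrow> f \<in> Arr C \<and>
     (\<exists>g \<in> hom C (Cod C f) (Dom C f).
        g \<cdot>\<^bsub>C\<^esub> f = Ident C (Dom C f) \<and> f \<cdot>\<^bsub>C\<^esub> g = Ident C (Cod C f))"

definition is_mono :: "('o, 'm) cat \<Rightarrow> 'm \<Rightarrow> bool" where
  "is_mono C f \<longleftrightarrow> f \<in> Arr C \<and>
     (\<forall>T. \<forall>g \<in> hom C T (Dom C f). \<forall>h \<in> hom C T (Dom C f).
        f \<cdot>\<^bsub>C\<^esub> g = f \<cdot>\<^bsub>C\<^esub> h \<longrightarrow> g = h)"

definition is_terminal :: "('o, 'm) cat \<Rightarrow> 'o \<Rightarrow> bool" where
  "is_terminal C T \<longleftrightarrow> T \<in> Obj C \<and> (\<forall>X \<in> Obj C. \<exists>!f. f \<in> hom C X T)"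

definition is_initial :: "('o, 'm) cat \<Rightarrow> 'o \<Rightarrow> bool" where
  "is_initial C I \<longleftrightarrow> I \<in> Obj C \<and> (\<forall>X \<in> Obj C. \<exists>!f. f \<in> hom C I X)"

definition is_zero :: "('o, 'm) cat \<Rightarrow> 'o \<Rightarrow> bool" where
  "is_zero C Z \<longleftrightarrow> is_initial C Z \<and> is_terminal C Z"

definition is_zero_arr :: "('o, 'm) cat \<Rightarrow> 'm \<Rightarrow> bool" where
  "is_zero_arr C f \<longleftrightarrow> f \<in> Arr C \<and>
     (\<exists>Z. is_zero C Z \<and>
        (\<exists>g \<in> hom C (Dom C f) Z. \<exists>h \<in> hom C Z (Cod C f). f = h \<cdot>\<^bsub>C\<^esub> g))"

definition is_product :: "('o, 'm) cat \<Rightarrow> 'o \<Rightarrow> 'o \<Rightarrow> 'o \<Rightarrow> 'm \<Rightarrow> 'm \<Rightarrow> bool" where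
  "is_product C X Y P p q \<longleftrightarrow>
     p \<in> hom C P X \<and> q \<in> hom C P Y \<and>
     (\<forall>T. \<forall>f \<in> hom C T X. \<forall>g \<in> hom C T Y.
        \<exists>!h. h \<in> hom C T P \<and> p \<cdot>\<^bsub>C\<^esub> h = f \<and> q \<cdot>\<^bsub>C\<^esub> h = g)"

definition is_coproduct :: "('o, 'm) cat \<Rightarrow> 'o \<Rightarrow> 'o \<Rightarrow> 'o \<Rightarrow> 'm \<Rightarrow> 'm \<Rightarrow> bool" where
  "is_coproduct C X Y S i j \<longleftrightarrow>
     i \<in> hom C X S \<and> j \<in> hom C Y S \<and>
     (\<forall>T. \<forall>f \<in> hom C X T. \<forall>g \<in> hom C Y T.
        \<exists>!h. h \<in> hom C S T \<and> h \<cdot>\<^bsub>C\<^esub> i = f \<and> h \<cdot>\<^bsub>C\<^esub> j = g)"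

definition is_pullback :: "('o, 'm) cat \<Rightarrow> 'm \<Rightarrow> 'm \<Rightarrow> 'o \<Rightarrow> 'm \<Rightarrow> 'm \<Rightarrow> bool" where
  "is_pullback C f g P p q \<longleftrightarrow>
     f \<in> Arr C \<and> g \<in> Arr C \<and> Cod C f = Cod C g \<and>
     p \<in> hom C P (Dom C f) \<and> q \<in> hom C P (Dom C g) \<and> f \<cdot>\<^bsub>C\<^esub> p = g \<cdot>\<^bsub>C\<^esub> q \<and>
     (\<forall>T. \<forall>u \<in> hom C T (Dom C f). \<forall>v \<in> hom C T (Dom C g).
        f \<cdot>\<^bsub>C\<^esub> u = g \<cdot>\<^bsub>C\<^esub> v \<longrightarrow>
        (\<exists>!h. h \<in> hom C T P \<and> p \<cdot>\<^bsub>C\<^esub> h = u \<and> q \<cdot>\<^bsub>C\<^esub> h = v))"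

definition is_coequalizer :: "('o, 'm) cat \<Rightarrow> 'm \<Rightarrow> 'm \<Rightarrow> 'm \<Rightarrow> bool" where
  "is_coequalizer C f g q \<longleftrightarrow>
     f \<in> Arr C \<and> g \<in> hom C (Dom C f) (Cod C f) \<and>
     q \<in> Arr C \<and> Dom C q = Cod C f \<and> q \<cdot>\<^bsub>C\<^esub> f = q \<cdot>\<^bsub>C\<^esub> g \<and>
     (\<forall>T. \<forall>u \<in> hom C (Cod C f) T. u \<cdot>\<^bsub>C\<^esub> f = u \<cdot>\<^bsub>C\<^esub> g \<longrightarrow>
        (\<exists>!h. h \<in> hom C (Cod C q) T \<and> h \<cdot>\<^bsub>C\<^esub> q = u))"

definition is_regular_epi :: "('o, 'm) cat \<Rightarrow> 'm \<Rightarrow> bool" where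
  "is_regular_epi C q \<longleftrightarrow> (\<exists>f g. is_coequalizer C f g q)"

definition is_kernel :: "('o, 'm) cat \<Rightarrow> 'm \<Rightarrow> 'm \<Rightarrow> bool" where
  "is_kernel C f k \<longleftrightarrow>
     f \<in> Arr C \<and> k \<in> Arr C \<and> Cod C k = Dom C f \<and> is_zero_arr C (f \<cdot>\<^bsub>C\<^esub> k) \<and>
     (\<forall>T. \<forall>u \<in> hom C T (Dom C f). is_zero_arr C (f \<cdot>\<^bsub>C\<^esub> u) \<longrightarrow>
        (\<exists>!h. h \<in> hom C T (Dom C k) \<and> k \<cdot>\<^bsub>C\<^esub> h = u))"

definition is_cokernel :: "('o, 'm) cat \<Rightarrow> 'm \<Rightarrow> 'm \<Rightarrow> bool" where
  "is_cokernel C f q \<longleftrightarrow>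
     f \<in> Arr C \<and> q \<in> Arr C \<and> Dom C q = Cod C f \<and> is_zero_arr C (q \<cdot>\<^bsub>C\<^esub> f) \<and>
     (\<forall>T. \<forall>u \<in> hom C (Cod C f) T. is_zero_arr C (u \<cdot>\<^bsub>C\<^esub> f) \<longrightarrow>
        (\<exists>!h. h \<in> hom C (Cod C q) T \<and> h \<cdot>\<^bsub>C\<^esub> q = u))"

text \<open>The image of an arrow is the monic part of its factorisation as a regular epimorphism
  followed by a monomorphism.\<close>

definition is_image :: "('o, 'm) cat \<Rightarrow> 'm \<Rightarrow> 'm \<Rightarrow> bool" where
  "is_image C f m \<longleftrightarrow> is_mono C m \<and>
     (\<exists>e \<in> hom C (Dom C f) (Dom C m). is_regular_epi C e \<and> f = m \<cdot>\<^bsub>C\<^esub> e)"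


section \<open>Semi-abelian categories\<close>

definition pointed :: "('o, 'm) cat \<Rightarrow> bool" where
  "pointed C \<longleftrightarrow> (\<exists>Z. is_zero C Z)"

definition has_finite_coproducts :: "('o, 'm) cat \<Rightarrow> bool" where
  "has_finite_coproducts C \<longleftrightarrow> (\<exists>I. is_initial C I) \<and>
     (\<forall>X \<in> Obj C. \<forall>Y \<in> Obj C. \<exists>S i j. is_coproduct C X Y S i j)"

definition finitely_complete :: "('o, 'm) cat \<Rightarrow> bool" where
  "finitely_complete C \<longleftrightarrow> (\<exists>T. is_terminal C T) \<and>
     (\<forall>f \<in> Arr C. \<forall>g \<in> Arr C. Cod C f = Cod C g \<longrightarrow> (\<exists>P p q. is_pullback C f g P p q))"

definition regular_category :: "('o, 'm) cat \<Rightarrow> bool" where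
  "regular_category C \<longleftrightarrow> finitely_complete C \<and>
     (\<forall>f P p q. is_pullback C f f P p q \<longrightarrow> (\<exists>c. is_coequalizer C p q c)) \<and>
     (\<forall>f g P p q. is_pullback C f g P p q \<and> is_regular_epi C g \<longrightarrow> is_regular_epi C p)"

text \<open>An internal equivalence relation on \<open>X\<close>: a jointly monic pair \<open>r, s : R \<rightarrow> X\<close> that is
  reflexive, symmetric and transitive, transitivity being witnessed on the pullback of
  \<open>s\<close> along \<open>r\<close>.\<close>

definition is_equivalence_relation :: "('o, 'm) cat \<Rightarrow> 'o \<Rightarrow> 'o \<Rightarrow> 'm \<Rightarrow> 'm \<Rightarrow> bool" where
  "is_equivalence_relation C X R r s \<longleftrightarrow>
     r \<in> hom C R X \<and> s \<in> hom C R X \<and>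
     (\<forall>T. \<forall>u \<in> hom C T R. \<forall>v \<in> hom C T R.
        r \<cdot>\<^bsub>C\<^esub> u = r \<cdot>\<^bsub>C\<^esub> v \<and> s \<cdot>\<^bsub>C\<^esub> u = s \<cdot>\<^bsub>C\<^esub> v \<longrightarrow> u = v) \<and>
     (\<exists>d \<in> hom C X R. r \<cdot>\<^bsub>C\<^esub> d = Ident C X \<and> s \<cdot>\<^bsub>C\<^esub> d = Ident C X) \<and>
     (\<exists>t \<in> hom C R R. r \<cdot>\<^bsub>C\<^esub> t = s \<and> s \<cdot>\<^bsub>C\<^esub> t = r) \<and>
     (\<forall>P p q. is_pullback C s r P p q \<longrightarrow>
        (\<exists>t \<in> hom C P R. r \<cdot>\<^bsub>C\<^esub> t = r \<cdot>\<^bsub>C\<^esub> p \<and> s \<cdot>\<^bsub>C\<^esub> t = s \<cdot>\<^bsub>C\<^esub> q))"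

definition Barr_exact :: "('o, 'm) cat \<Rightarrow> bool" where
  "Barr_exact C \<longleftrightarrow> regular_category C \<and>
     (\<forall>X R r s. is_equivalence_relation C X R r s \<longrightarrow> (\<exists>f. is_pullback C f f R r s))"

text \<open>A point over \<open>B\<close> is a split epimorphism \<open>a : A \<rightarrow> B\<close> with a chosen section \<open>s\<close>.\<close>

definition is_point :: "('o, 'm) cat \<Rightarrow> 'o \<Rightarrow> 'o \<Rightarrow> 'm \<Rightarrow> 'm \<Rightarrow> bool" where
  "is_point C B A a s \<longleftrightarrow> a \<in> hom C A B \<and> s \<in> hom C B A \<and> a \<cdot>\<^bsub>C\<^esub> s = Ident C B"

definition is_point_mor ::
    "('o, 'm) cat \<Rightarrow> 'o \<Rightarrow> 'm \<Rightarrow> 'm \<Rightarrow> 'o \<Rightarrow> 'm \<Rightarrow> 'm \<Rightarrow> 'm \<Rightarrow> bool" where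
  "is_point_mor C A a s A' a' s' h \<longleftrightarrow>
     h \<in> hom C A A' \<and> a' \<cdot>\<^bsub>C\<^esub> h = a \<and> h \<cdot>\<^bsub>C\<^esub> s = s'"

text \<open>Bourn-protomodularity: for each \<open>p : E \<rightarrow> B\<close>, the pullback functor from points over \<open>B\<close>
  to points over \<open>E\<close> reflects isomorphisms.  Here \<open>k\<close> is the image of \<open>h\<close> under that functor,
  computed with arbitrary pullbacks \<open>Q\<close> and \<open>Q'\<close> of the two points along \<open>p\<close>.\<close>

definition Bourn_protomodular :: "('o, 'm) cat \<Rightarrow> bool" where
  "Bourn_protomodular C \<longleftrightarrow>
     (\<forall>E B p A a s A' a' s' h Q e u Q' e' u' k.
        p \<in> hom C E B \<and>
        is_point C B A a s \<and> is_point C B A' a' s' \<and> is_point_mor C A a s A' a' s' h \<and>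
        is_pullback C p a Q e u \<and> is_pullback C p a' Q' e' u' \<and>
        k \<in> hom C Q Q' \<and> e' \<cdot>\<^bsub>C\<^esub> k = e \<and> u' \<cdot>\<^bsub>C\<^esub> k = h \<cdot>\<^bsub>C\<^esub> u \<and>
        is_iso C k \<longrightarrow> is_iso C h)"

locale semi_abelian_category = category C
  for C :: "('o, 'm) cat" (structure) +
  assumes pointed: "pointed C"
    and Barr_exact: "Barr_exact C"
    and Bourn_protomodular: "Bourn_protomodular C"
    and has_finite_coproducts: "has_finite_coproducts C"


section \<open>Chosen (co)limits\<close>

text \<open>(Co)limits are only determined up to isomorphism; the operations below use an arbitrary
  choice of representatives.\<close>

definition zero_arr :: "('o, 'm) cat \<Rightarrow> 'o \<Rightarrow> 'o \<Rightarrow> 'm" where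
  "zero_arr C X Y = (THE f. f \<in> hom C X Y \<and> is_zero_arr C f)"

definition terminal :: "('o, 'm) cat \<Rightarrow> 'o" where
  "terminal C = (SOME T. is_terminal C T)"

definition to_terminal :: "('o, 'm) cat \<Rightarrow> 'o \<Rightarrow> 'm" where
  "to_terminal C X = (THE f. f \<in> hom C X (terminal C))"

definition chosen_product :: "('o, 'm) cat \<Rightarrow> 'o \<Rightarrow> 'o \<Rightarrow> 'o \<times> 'm \<times> 'm" where
  "chosen_product C X Y = (SOME (P, p, q). is_product C X Y P p q)"

definition prd :: "('o, 'm) cat \<Rightarrow> 'o \<Rightarrow> 'o \<Rightarrow> 'o" where
  "prd C X Y = fst (chosen_product C X Y)"

definition pr1 :: "('o, 'm) cat \<Rightarrow> 'o \<Rightarrow> 'o \<Rightarrow> 'm" where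
  "pr1 C X Y = fst (snd (chosen_product C X Y))"

definition pr2 :: "('o, 'm) cat \<Rightarrow> 'o \<Rightarrow> 'o \<Rightarrow> 'm" where
  "pr2 C X Y = snd (snd (chosen_product C X Y))"

definition pair :: "('o, 'm) cat \<Rightarrow> 'm \<Rightarrow> 'm \<Rightarrow> 'm" where
  "pair C f g =
     (THE h. h \<in> hom C (Dom C f) (prd C (Cod C f) (Cod C g)) \<and>
        pr1 C (Cod C f) (Cod C g) \<cdot>\<^bsub>C\<^esub> h = f \<and> pr2 C (Cod C f) (Cod C g) \<cdot>\<^bsub>C\<^esub> h = g)"

definition chosen_coproduct :: "('o, 'm) cat \<Rightarrow> 'o \<Rightarrow> 'o \<Rightarrow> 'o \<times> 'm \<times> 'm" where
  "chosen_coproduct C X Y = (SOME (S, i, j). is_coproduct C X Y S i j)"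

definition coprd :: "('o, 'm) cat \<Rightarrow> 'o \<Rightarrow> 'o \<Rightarrow> 'o" where
  "coprd C X Y = fst (chosen_coproduct C X Y)"

definition in1 :: "('o, 'm) cat \<Rightarrow> 'o \<Rightarrow> 'o \<Rightarrow> 'm" where
  "in1 C X Y = fst (snd (chosen_coproduct C X Y))"

definition in2 :: "('o, 'm) cat \<Rightarrow> 'o \<Rightarrow> 'o \<Rightarrow> 'm" where
  "in2 C X Y = snd (snd (chosen_coproduct C X Y))"

definition copair :: "('o, 'm) cat \<Rightarrow> 'm \<Rightarrow> 'm \<Rightarrow> 'm" where
  "copair C f g =
     (THE h. h \<in> hom C (coprd C (Dom C f) (Dom C g)) (Cod C f) \<and>
        h \<cdot>\<^bsub>C\<^esub> in1 C (Dom C f) (Dom C g) = f \<and> h \<cdot>\<^bsub>C\<^esub> in2 C (Dom C f) (Dom C g) = g)"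

definition coprd_map :: "('o, 'm) cat \<Rightarrow> 'm \<Rightarrow> 'm \<Rightarrow> 'm" where
  "coprd_map C f g =
     copair C (in1 C (Cod C f) (Cod C g) \<cdot>\<^bsub>C\<^esub> f) (in2 C (Cod C f) (Cod C g) \<cdot>\<^bsub>C\<^esub> g)"

definition ker :: "('o, 'm) cat \<Rightarrow> 'm \<Rightarrow> 'm" where
  "ker C f = (SOME k. is_kernel C f k)"

definition coker :: "('o, 'm) cat \<Rightarrow> 'm \<Rightarrow> 'm" where
  "coker C f = (SOME q. is_cokernel C f q)"

definition img :: "('o, 'm) cat \<Rightarrow> 'm \<Rightarrow> 'm" where
  "img C f = (SOME m. is_image C f m)"


section \<open>Abelian objects\<close>

definition is_internal_abelian_group ::
    "('o, 'm) cat \<Rightarrow> 'o \<Rightarrow> 'm \<Rightarrow> 'm \<Rightarrow> 'm \<Rightarrow> bool" where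
  "is_internal_abelian_group C A m e i \<longleftrightarrow>
     A \<in> Obj C \<and>
     m \<in> hom C (prd C A A) A \<and> e \<in> hom C (terminal C) A \<and> i \<in> hom C A A \<and>
     (let one = Ident C A;
          zero = e \<cdot>\<^bsub>C\<^esub> to_terminal C A;
          x = pr1 C A A \<cdot>\<^bsub>C\<^esub> pr1 C (prd C A A) A;
          y = pr2 C A A \<cdot>\<^bsub>C\<^esub> pr1 C (prd C A A) A;
          z = pr2 C (prd C A A) A
      in
        m \<cdot>\<^bsub>C\<^esub> pair C (m \<cdot>\<^bsub>C\<^esub> pair C x y) z = m \<cdot>\<^bsub>C\<^esub> pair C x (m \<cdot>\<^bsub>C\<^esub> pair C y z) \<and>
        m \<cdot>\<^bsub>C\<^esub> pair C zero one = one \<and> m \<cdot>\<^bsub>C\<^esub> pair C one zero = one \<and>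
        m \<cdot>\<^bsub>C\<^esub> pair C i one = zero \<and> m \<cdot>\<^bsub>C\<^esub> pair C one i = zero \<and>
        m \<cdot>\<^bsub>C\<^esub> pair C (pr2 C A A) (pr1 C A A) = m)"

definition abelian_object :: "('o, 'm) cat \<Rightarrow> 'o \<Rightarrow> bool" where
  "abelian_object C A \<longleftrightarrow> (\<exists>m e i. is_internal_abelian_group C A m e i)"

definition Ab :: "('o, 'm) cat \<Rightarrow> ('o, 'm) cat" where
  "Ab C = full_subcat C (abelian_object C)"


section \<open>Cosmash products and two-nilpotent objects\<close>

definition cosmash_arr :: "('o, 'm) cat \<Rightarrow> 'o \<Rightarrow> 'o \<Rightarrow> 'm" where
  "cosmash_arr C X Y =
     ker C (copair C (pair C (Ident C X) (zero_arr C X Y)) (pair C (zero_arr C Y X) (Ident C Y)))"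

definition cosmash :: "('o, 'm) cat \<Rightarrow> 'o \<Rightarrow> 'o \<Rightarrow> 'o" where
  "cosmash C X Y = Dom C (cosmash_arr C X Y)"

definition cosmash_map :: "('o, 'm) cat \<Rightarrow> 'm \<Rightarrow> 'm \<Rightarrow> 'm" where
  "cosmash_map C f g =
     (THE h. h \<in> hom C (cosmash C (Dom C f) (Dom C g)) (cosmash C (Cod C f) (Cod C g)) \<and>
        cosmash_arr C (Cod C f) (Cod C g) \<cdot>\<^bsub>C\<^esub> h =
        coprd_map C f g \<cdot>\<^bsub>C\<^esub> cosmash_arr C (Dom C f) (Dom C g))"

text \<open>The ternary coproduct is \<open>(X + Y) + Z\<close>, with \<open>copair3 C f g h = [[f, g], h]\<close>, and the
  ternary product is \<open>(X \<times> Y) \<times> Z\<close>.\<close>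

definition copair3 :: "('o, 'm) cat \<Rightarrow> 'm \<Rightarrow> 'm \<Rightarrow> 'm \<Rightarrow> 'm" where
  "copair3 C f g h = copair C (copair C f g) h"

definition cosmash3_arr :: "('o, 'm) cat \<Rightarrow> 'o \<Rightarrow> 'o \<Rightarrow> 'o \<Rightarrow> 'm" where
  "cosmash3_arr C X Y Z =
     ker C (pair C
       (pair C
         (copair3 C (in1 C X Y) (in2 C X Y) (zero_arr C Z (coprd C X Y)))
         (copair3 C (in1 C X Z) (zero_arr C Y (coprd C X Z)) (in2 C X Z)))
       (copair3 C (zero_arr C X (coprd C Y Z)) (in1 C Y Z) (in2 C Y Z)))"

text \<open>The commutator \<open>[X, X, X]\<close>, as a subobject of \<open>X\<close>.\<close>

definition commutator3 :: "('o, 'm) cat \<Rightarrow> 'o \<Rightarrow> 'm" where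
  "commutator3 C X =
     img C (copair3 C (Ident C X) (Ident C X) (Ident C X) \<cdot>\<^bsub>C\<^esub> cosmash3_arr C X X X)"

definition two_nilpotent :: "('o, 'm) cat \<Rightarrow> 'o \<Rightarrow> bool" where
  "two_nilpotent C X \<longleftrightarrow> X \<in> Obj C \<and> is_zero C (Dom C (commutator3 C X))"

definition Nil2 :: "('o, 'm) cat \<Rightarrow> ('o, 'm) cat" where
  "Nil2 C = full_subcat C (two_nilpotent C)"

definition nil2_unit :: "('o, 'm) cat \<Rightarrow> 'o \<Rightarrow> 'm" where
  "nil2_unit C X = coker C (commutator3 C X)"

definition nil2 :: "('o, 'm) cat \<Rightarrow> 'o \<Rightarrow> 'o" where
  "nil2 C X = Cod C (nil2_unit C X)"

definition nil2_map :: "('o, 'm) cat \<Rightarrow> 'm \<Rightarrow> 'm" where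
  "nil2_map C f =
     (THE h. h \<in> hom C (nil2 C (Dom C f)) (nil2 C (Cod C f)) \<and>
        h \<cdot>\<^bsub>C\<^esub> nil2_unit C (Dom C f) = nil2_unit C (Cod C f) \<cdot>\<^bsub>C\<^esub> f)"


section \<open>The bilinear product\<close>

definition bilinear_product :: "('o, 'm) cat \<Rightarrow> 'o \<Rightarrow> 'o \<Rightarrow> 'o" where
  "bilinear_product C X Y = cosmash (Nil2 C) (nil2 C X) (nil2 C Y)"

definition bilinear_product_map :: "('o, 'm) cat \<Rightarrow> 'm \<Rightarrow> 'm \<Rightarrow> 'm" where
  "bilinear_product_map C f g = cosmash_map (Nil2 C) (nil2_map C f) (nil2_map C g)"

end

theory Submission
  imports Defs
begin

text \<open>Let \<open>N\<close> be the coproduct of \<open>A = nil2 X\<close> and \<open>B = nil2 Y\<close> among two-nilpotent objects and \<open>K\<close>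
  the kernel of \<open>N \<rightarrow> A \<times> B\<close>.  The quotient \<open>A + B \<rightarrow> N\<close> restricts to a regular epimorphism from
  the cosmash product \<open>D\<close> of \<open>A\<close> and \<open>B\<close> in \<open>C\<close> onto \<open>K\<close>.  The cosmash product of \<open>D\<close> and \<open>K\<close>
  lies inside the ternary cosmash product of \<open>A\<close>, \<open>B\<close>, \<open>K\<close>, which two-nilpotency of \<open>N\<close> kills; hence
  the codiagonal \<open>K + K \<rightarrow> K\<close> kills the cosmash product of \<open>K\<close> with itself and so factors through
  \<open>K \<times> K\<close>, which gives the addition of \<open>K\<close>.

  That \<open>nil2 X\<close> is two-nilpotent at all rests on cosmash products preserving regular epimorphisms:
  they are joint kernels of commuting idempotents, and a regular epimorphism of split epimorphisms
  restricts to a regular epimorphism of kernels.\<close>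

text \<open>The ternary commutator has three slots, so the vanishing of \<open>[N, N, N]\<close>
  speaks about two copies of \<open>K\<close> only if one copy can be spread over two slots.
  \<open>K\<close> itself does not lie in \<open>A + B\<close>, but its cover \<open>D\<close> does
  and dies there under both retractions. Returning from \<open>D\<close> to \<open>K\<close> needs
  the cosmash product of \<open>D\<close> and \<open>K\<close> to cover that of \<open>K\<close>
  with itself, so preservation of regular epimorphisms is used twice: with three idempotents for the
  reflection, with two here.

  Protomodularity enters chiefly through jointly extremal pairs, such as the kernel and the section
  of a split epimorphism. They provide equality tests and factorisations, and from these follow the
  Mal'tsev property, hence cokernels, and the fact that a regular epimorphism is the cokernel of its
  kernel.

  A second obstacle is that sums and kernels among two-nilpotent objects are tested only against
  two-nilpotent objects. An arrow from an arbitrary object into a two-nilpotent one factors through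
  its image, which is again two-nilpotent; this carries monomorphisms and kernels over to
  \<open>C\<close>.\<close>

context category
begin

section \<open>Composition, monomorphisms and pullbacks\<close>

lemma arr_comp [simp]: "\<lbrakk>f \<in> Arr C; g \<in> Arr C; Cod C f = Dom C g\<rbrakk> \<Longrightarrow> g \<cdot> f \<in> Arr C"
  and dom_comp [simp]: "\<lbrakk>f \<in> Arr C; g \<in> Arr C; Cod C f = Dom C g\<rbrakk> \<Longrightarrow> Dom C (g \<cdot> f) = Dom C f"
  and cod_comp [simp]: "\<lbrakk>f \<in> Arr C; g \<in> Arr C; Cod C f = Dom C g\<rbrakk> \<Longrightarrow> Cod C (g \<cdot> f) = Cod C g"
  using Comp_in_hom[of f "Dom C f" "Cod C f" g "Cod C g"] by (auto simp: hom_def)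

lemma comp_assoc [simp]:
  "\<lbrakk>f \<in> Arr C; g \<in> Arr C; h \<in> Arr C; Cod C f = Dom C g; Cod C g = Dom C h\<rbrakk>
    \<Longrightarrow> (h \<cdot> g) \<cdot> f = h \<cdot> (g \<cdot> f)"
  using Comp_assoc[of f "Dom C f" "Cod C f" g "Cod C g" h "Cod C h"] by (auto simp: hom_def)

lemma dom_obj [simp]: "f \<in> Arr C \<Longrightarrow> Dom C f \<in> Obj C"
  and cod_obj [simp]: "f \<in> Arr C \<Longrightarrow> Cod C f \<in> Obj C"
  by (simp_all add: Dom_in_Obj Cod_in_Obj)

lemma ident_arr [simp]:
  "X \<in> Obj C \<Longrightarrow> Ident C X \<in> Arr C"
  "X \<in> Obj C \<Longrightarrow> Dom C (Ident C X) = X"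
  "X \<in> Obj C \<Longrightarrow> Cod C (Ident C X) = X"
  using Ident_in_hom by (auto simp: hom_def)

lemma comp_ident [simp]: "\<lbrakk>f \<in> Arr C; Dom C f = X\<rbrakk> \<Longrightarrow> f \<cdot> Ident C X = f"
  and ident_comp [simp]: "\<lbrakk>f \<in> Arr C; Cod C f = X\<rbrakk> \<Longrightarrow> Ident C X \<cdot> f = f"
  using Comp_Ident Ident_Comp by (auto simp: hom_def)

text \<open>Composites are normalised to the right, where the left-hand side
  \<open>g \<cdot> f\<close> of an equation no longer occurs once an arrow follows it. This turns
  the equation into a rewrite rule for the longer composite; the typing conditions use
  \<open>Dom\<close> and \<open>Cod\<close> so that simp can discharge them.\<close>

lemma comp_reassoc:
  "\<lbrakk>g \<cdot> f = h; f \<in> Arr C; g \<in> Arr C; x \<in> Arr C; Cod C f = Dom C g; Cod C x = Dom C f\<rbrakk>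
    \<Longrightarrow> g \<cdot> (f \<cdot> x) = h \<cdot> x"
  by (metis comp_assoc)

lemma hom_obj: "f \<in> hom C X Y \<Longrightarrow> X \<in> Obj C" "f \<in> hom C X Y \<Longrightarrow> Y \<in> Obj C"
  by (auto simp: hom_def)

lemma mono_cancel:
  "\<lbrakk>is_mono C m; m \<cdot> u = m \<cdot> v; u \<in> Arr C; v \<in> Arr C; Dom C u = Dom C v;
    Cod C u = Dom C m; Cod C v = Dom C m\<rbrakk> \<Longrightarrow> u = v"
  unfolding is_mono_def hom_def by blast

lemma is_monoI:
  assumes "m \<in> hom C X Y"
    and "\<And>T u v. \<lbrakk>u \<in> hom C T X; v \<in> hom C T X; m \<cdot> u = m \<cdot> v\<rbrakk> \<Longrightarrow> u = v"
  shows "is_mono C m"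
  using assms unfolding is_mono_def hom_def by blast

lemma is_mono_arr: "is_mono C m \<Longrightarrow> m \<in> Arr C"
  by (simp add: is_mono_def)

lemma is_mono_comp:
  assumes "is_mono C m" "is_mono C n" "Cod C n = Dom C m"
  shows "is_mono C (m \<cdot> n)"
proof (rule is_monoI)
  have a: "m \<in> Arr C" "n \<in> Arr C" using assms by (simp_all add: is_mono_def)
  show "m \<cdot> n \<in> hom C (Dom C n) (Cod C m)" using a assms by (simp add: hom_def)
  fix T u v
  assume uv: "u \<in> hom C T (Dom C n)" "v \<in> hom C T (Dom C n)" "(m \<cdot> n) \<cdot> u = (m \<cdot> n) \<cdot> v"
  then have "m \<cdot> (n \<cdot> u) = m \<cdot> (n \<cdot> v)" using a assms by (simp add: hom_def)
  then have "n \<cdot> u = n \<cdot> v"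
    by (rule mono_cancel[OF assms(1)]) (use uv a assms in \<open>simp_all add: hom_def\<close>)
  then show "u = v"
    by (rule mono_cancel[OF assms(2)]) (use uv a assms in \<open>simp_all add: hom_def\<close>)
qed

lemma split_mono_is_mono:
  assumes "m \<in> hom C X Y" "l \<in> hom C Y X" "l \<cdot> m = Ident C X"
  shows "is_mono C m"
proof (rule is_monoI[OF assms(1)])
  fix T u v
  assume uv: "u \<in> hom C T X" "v \<in> hom C T X" "m \<cdot> u = m \<cdot> v"
  have "l \<cdot> (m \<cdot> u) = u" "l \<cdot> (m \<cdot> v) = v"
    using uv(1,2) assms(1,2) by (simp_all add: hom_def comp_reassoc[OF assms(3)])
  then show "u = v" using uv(3) by metis
qed

lemma is_isoI:
  "\<lbrakk>f \<in> hom C X Y; g \<in> hom C Y X; g \<cdot> f = Ident C X; f \<cdot> g = Ident C Y\<rbrakk> \<Longrightarrow> is_iso C f"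
  unfolding is_iso_def hom_def by auto

lemma is_isoE:
  assumes "is_iso C f" "f \<in> hom C X Y"
  obtains g where "g \<in> hom C Y X" "g \<cdot> f = Ident C X" "f \<cdot> g = Ident C Y"
  using assms unfolding is_iso_def hom_def by auto

lemma is_iso_ident: "X \<in> Obj C \<Longrightarrow> is_iso C (Ident C X)"
  by (rule is_isoI[of _ X X "Ident C X"]) (auto simp: hom_def)

lemma split_epi_mono_is_iso:
  assumes "is_mono C m" "m \<in> hom C X Y" "l \<in> hom C Y X" "m \<cdot> l = Ident C Y"
  shows "is_iso C m"
proof (rule is_isoI[OF assms(2,3) _ assms(4)])
  have "m \<cdot> (l \<cdot> m) = m \<cdot> Ident C X"
    using assms(2,3) by (simp add: hom_def comp_reassoc[OF assms(4)])
  then show "l \<cdot> m = Ident C X"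
    by (rule mono_cancel[OF assms(1)]) (use assms(2,3) in \<open>auto simp: hom_def\<close>)
qed

lemma is_pullbackI:
  assumes "f \<in> hom C X Z" "g \<in> hom C Y Z" "p \<in> hom C P X" "q \<in> hom C P Y" "f \<cdot> p = g \<cdot> q"
    and "\<And>T u v. \<lbrakk>u \<in> hom C T X; v \<in> hom C T Y; f \<cdot> u = g \<cdot> v\<rbrakk>
           \<Longrightarrow> \<exists>h \<in> hom C T P. p \<cdot> h = u \<and> q \<cdot> h = v"
    and "\<And>T x y. \<lbrakk>x \<in> hom C T P; y \<in> hom C T P; p \<cdot> x = p \<cdot> y; q \<cdot> x = q \<cdot> y\<rbrakk> \<Longrightarrow> x = y"
  shows "is_pullback C f g P p q"
proof -
  have a: "f \<in> Arr C" "g \<in> Arr C" "Cod C f = Cod C g" "Dom C f = X" "Dom C g = Y"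
    using assms by (auto simp: hom_def)
  show ?thesis unfolding is_pullback_def a(4,5)
  proof (intro conjI allI ballI impI ex_ex1I)
    fix T u v h h'
    assume "h \<in> hom C T P \<and> p \<cdot> h = u \<and> q \<cdot> h = v" "h' \<in> hom C T P \<and> p \<cdot> h' = u \<and> q \<cdot> h' = v"
    then show "h = h'" using assms(7)[of h T h'] by simp
  qed (use a assms(3-6) in \<open>auto simp: Bex_def\<close>)
qed

lemma is_pullbackD:
  assumes "is_pullback C f g P p q"
  shows "f \<in> Arr C" "g \<in> Arr C" "Cod C f = Cod C g"
    "p \<in> Arr C" "Dom C p = P" "Cod C p = Dom C f" "q \<in> Arr C" "Dom C q = P" "Cod C q = Dom C g"
    "f \<cdot> p = g \<cdot> q"
  using assms unfolding is_pullback_def hom_def by auto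

lemma pullback_lift:
  assumes "is_pullback C f g P p q" "f \<cdot> u = g \<cdot> v" "u \<in> hom C T (Dom C f)" "v \<in> hom C T (Dom C g)"
  obtains h where "h \<in> hom C T P" "p \<cdot> h = u" "q \<cdot> h = v"
  using assms unfolding is_pullback_def by blast

lemma pullback_ext:
  assumes "is_pullback C f g P p q" "p \<cdot> x = p \<cdot> y" "q \<cdot> x = q \<cdot> y"
    "x \<in> hom C T P" "y \<in> hom C T P"
  shows "x = y"
proof -
  note d = is_pullbackD[OF assms(1)]
  have "f \<cdot> (p \<cdot> x) = g \<cdot> (q \<cdot> x)"
    using d(1-9) assms(4) by (simp add: hom_def comp_reassoc[OF d(10)])
  moreover have "p \<cdot> x \<in> hom C T (Dom C f)" "q \<cdot> x \<in> hom C T (Dom C g)"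
    using d(1-9) assms(4) by (simp_all add: hom_def)
  ultimately have "\<exists>!h. h \<in> hom C T P \<and> p \<cdot> h = p \<cdot> x \<and> q \<cdot> h = q \<cdot> x"
    using assms(1) unfolding is_pullback_def by blast
  then show ?thesis using assms by metis
qed

lemma pullback_mono:
  assumes "is_pullback C f g P p q" "is_mono C g"
  shows "is_mono C p"
proof -
  note d = is_pullbackD[OF assms(1)]
  show ?thesis
  proof (rule is_monoI)
    show "p \<in> hom C P (Dom C f)" using d by (simp add: hom_def)
    fix T u v assume uv: "u \<in> hom C T P" "v \<in> hom C T P" "p \<cdot> u = p \<cdot> v"
    have "g \<cdot> (q \<cdot> u) = f \<cdot> (p \<cdot> u)" "g \<cdot> (q \<cdot> v) = f \<cdot> (p \<cdot> v)"
      using d(1-9) uv(1,2) by (simp_all add: hom_def comp_reassoc[OF d(10)])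
    then have "g \<cdot> (q \<cdot> u) = g \<cdot> (q \<cdot> v)" using uv by simp
    then have "q \<cdot> u = q \<cdot> v"
      by (rule mono_cancel[OF assms(2)]) (use uv d in \<open>simp_all add: hom_def\<close>)
    with uv show "u = v" using pullback_ext[OF assms(1)] by blast
  qed
qed

end

section \<open>Epimorphisms, coequalizers and jointly extremal pairs\<close>

definition is_epi :: "('o, 'm) cat \<Rightarrow> 'm \<Rightarrow> bool" where
  "is_epi C e \<longleftrightarrow> e \<in> Arr C \<and>
     (\<forall>T. \<forall>g \<in> hom C (Cod C e) T. \<forall>h \<in> hom C (Cod C e) T.
        g \<cdot>\<^bsub>C\<^esub> e = h \<cdot>\<^bsub>C\<^esub> e \<longrightarrow> g = h)"

text \<open>The categorical form of "the images of \<open>u\<close> and \<open>v\<close> generate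
  the codomain": no proper subobject contains both.\<close>

definition jointly_extremal :: "('o, 'm) cat \<Rightarrow> 'm \<Rightarrow> 'm \<Rightarrow> bool" where
  "jointly_extremal C u v \<longleftrightarrow> u \<in> Arr C \<and> v \<in> Arr C \<and> Cod C u = Cod C v \<and>
     (\<forall>m. is_mono C m \<and> Cod C m = Cod C u \<and>
        (\<exists>u' \<in> hom C (Dom C u) (Dom C m). m \<cdot>\<^bsub>C\<^esub> u' = u) \<and>
        (\<exists>v' \<in> hom C (Dom C v) (Dom C m). m \<cdot>\<^bsub>C\<^esub> v' = v) \<longrightarrow> is_iso C m)"

context category
begin

lemma epi_cancel:
  "\<lbrakk>is_epi C e; u \<cdot> e = v \<cdot> e; u \<in> Arr C; v \<in> Arr C; Cod C u = Cod C v;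
    Dom C u = Cod C e; Dom C v = Cod C e\<rbrakk> \<Longrightarrow> u = v"
  unfolding is_epi_def hom_def by blast

lemma coequalizerD:
  assumes "is_coequalizer C f g q"
  shows "f \<in> Arr C" "g \<in> Arr C" "q \<in> Arr C" "Dom C g = Dom C f" "Cod C g = Cod C f"
    "Dom C q = Cod C f" "q \<cdot> f = q \<cdot> g"
  using assms unfolding is_coequalizer_def hom_def by auto

lemma coequalizer_desc:
  assumes "is_coequalizer C f g q" "u \<cdot> f = u \<cdot> g" "u \<in> hom C (Dom C q) T"
  obtains h where "h \<in> hom C (Cod C q) T" "h \<cdot> q = u"
  using assms unfolding is_coequalizer_def by metis

lemma coequalizer_epi:
  assumes "is_coequalizer C f g q"
  shows "is_epi C q"
  unfolding is_epi_def
proof (intro conjI allI ballI impI)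
  note d = coequalizerD[OF assms]
  show "q \<in> Arr C" using d by simp
  fix T u v
  assume uv: "u \<in> hom C (Cod C q) T" "v \<in> hom C (Cod C q) T" "u \<cdot> q = v \<cdot> q"
  have "(u \<cdot> q) \<cdot> f = (u \<cdot> q) \<cdot> g" "u \<cdot> q \<in> hom C (Cod C f) T"
    using d uv(1) by (simp_all add: hom_def)
  then have "\<exists>!h. h \<in> hom C (Cod C q) T \<and> h \<cdot> q = u \<cdot> q"
    using assms unfolding is_coequalizer_def by blast
  then show "u = v" using uv by metis
qed

lemma regular_epi_is_epi: "is_regular_epi C q \<Longrightarrow> is_epi C q"
  using coequalizer_epi by (auto simp: is_regular_epi_def)

lemma regular_epi_arr: "is_regular_epi C q \<Longrightarrow> q \<in> Arr C"
  by (auto simp: is_regular_epi_def is_coequalizer_def)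

text \<open>Cancelling \<open>m\<close> shows that \<open>u\<close> identifies the pair of which
  \<open>q\<close> is the coequalizer, so \<open>u\<close> descends along \<open>q\<close>; since
  \<open>q\<close> is epic, the descended arrow also fits the other triangle.\<close>

lemma regular_epi_lift:
  assumes "is_regular_epi C q" "is_mono C m" "q \<in> hom C X Y" "m \<in> hom C A B"
    "u \<in> hom C X A" "v \<in> hom C Y B" "m \<cdot> u = v \<cdot> q"
  obtains d where "d \<in> hom C Y A" "d \<cdot> q = u" "m \<cdot> d = v"
proof -
  obtain f g where q: "is_coequalizer C f g q" using assms(1) by (auto simp: is_regular_epi_def)
  note d = coequalizerD[OF q]
  have "m \<cdot> (u \<cdot> f) = m \<cdot> (u \<cdot> g)"
    using d assms(3-6) by (simp add: hom_def comp_reassoc[OF assms(7)])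
  then have "u \<cdot> f = u \<cdot> g"
    by (rule mono_cancel[OF assms(2)]) (use d assms(3-6) in \<open>auto simp: hom_def\<close>)
  then obtain h where h: "h \<in> hom C (Cod C q) A" "h \<cdot> q = u"
    using coequalizer_desc[OF q, of u A] assms(3,5) by (auto simp: hom_def)
  have "(m \<cdot> h) \<cdot> q = v \<cdot> q"
    using h assms(3-7) by (simp add: hom_def)
  then have "m \<cdot> h = v"
    by (rule epi_cancel[OF regular_epi_is_epi[OF assms(1)]]) (use h assms(3-6) in \<open>auto simp: hom_def\<close>)
  with h that assms(3) show thesis by (auto simp: hom_def)
qed

lemma regular_epi_mono_is_iso:
  assumes "is_regular_epi C q" "is_mono C m" "m \<in> hom C A B" "u \<in> hom C (Dom C q) A"
    "m \<cdot> u = q"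
  shows "is_iso C m"
proof -
  have q: "q \<in> Arr C" using assms(1) by (rule regular_epi_arr)
  have B: "Cod C q = B" using assms(3-5) by (auto simp: hom_def)
  have e: "m \<cdot> u = Ident C B \<cdot> q" using assms q B by simp
  have i: "Ident C B \<in> hom C B B" "q \<in> hom C (Dom C q) B" using q B by (auto simp: hom_def)
  show ?thesis
    using regular_epi_lift[OF assms(1,2) i(2) assms(3,4) i(1) e] split_epi_mono_is_iso[OF assms(2,3)]
    by metis
qed

lemma is_regular_epi_iso_comp:
  assumes "is_regular_epi C e" "is_iso C i" "Cod C e = Dom C i"
  shows "is_regular_epi C (i \<cdot> e)"
proof -
  obtain f g where q: "is_coequalizer C f g e" using assms(1) by (auto simp: is_regular_epi_def)
  note d = coequalizerD[OF q]
  have i: "i \<in> Arr C" using assms(2) by (simp add: is_iso_def)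
  obtain j where j: "j \<in> hom C (Cod C i) (Dom C i)" "j \<cdot> i = Ident C (Dom C i)" "i \<cdot> j = Ident C (Cod C i)"
    using assms(2) by (auto simp: is_iso_def)
  have "is_coequalizer C f g (i \<cdot> e)"
    unfolding is_coequalizer_def
  proof (intro conjI allI ballI impI ex_ex1I)
    show "(i \<cdot> e) \<cdot> f = (i \<cdot> e) \<cdot> g" using d i assms(3) by simp
    fix T u
    assume u: "u \<in> hom C (Cod C f) T" "u \<cdot> f = u \<cdot> g"
    obtain h where h: "h \<in> hom C (Cod C e) T" "h \<cdot> e = u"
      using coequalizer_desc[OF q u(2), of T] u(1) d by (auto simp: hom_def)
    have "h \<cdot> j \<in> hom C (Cod C (i \<cdot> e)) T \<and> (h \<cdot> j) \<cdot> (i \<cdot> e) = u"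
      using d h i j(1) assms(3) by (simp add: hom_def comp_reassoc[OF j(2)])
    then show "\<exists>h. h \<in> hom C (Cod C (i \<cdot> e)) T \<and> h \<cdot> (i \<cdot> e) = u" ..
    fix x y
    assume xy: "x \<in> hom C (Cod C (i \<cdot> e)) T \<and> x \<cdot> (i \<cdot> e) = u"
      "y \<in> hom C (Cod C (i \<cdot> e)) T \<and> y \<cdot> (i \<cdot> e) = u"
    have "(x \<cdot> i) \<cdot> e = (y \<cdot> i) \<cdot> e" using xy i d assms(3) by (simp add: hom_def)
    then have "x \<cdot> i = y \<cdot> i"
      by (rule epi_cancel[OF coequalizer_epi[OF q]]) (use xy i d assms(3) in \<open>simp_all add: hom_def\<close>)
    then have "(x \<cdot> i) \<cdot> j = (y \<cdot> i) \<cdot> j" by simp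
    then show "x = y" using xy i j(1,3) d assms(3) by (simp add: hom_def)
  qed (use d i assms(3) in \<open>auto simp: hom_def\<close>)
  then show ?thesis by (auto simp: is_regular_epi_def)
qed

end

section \<open>Zero arrows and kernels\<close>

locale pointed_category = category C
  for C :: "('o, 'm) cat" (structure) +
  assumes is_pointed: "pointed C"
begin

lemma zero_object:
  obtains Z where "is_zero C Z" "Z \<in> Obj C"
  using is_pointed unfolding pointed_def is_zero_def is_initial_def by blast

lemma is_zero_arrI:
  assumes "is_zero C Z" "a \<in> hom C X Z" "b \<in> hom C Z Y"
  shows "is_zero_arr C (b \<cdot> a)"
proof -
  have "b \<cdot> a \<in> Arr C" "a \<in> hom C (Dom C (b \<cdot> a)) Z" "b \<in> hom C Z (Cod C (b \<cdot> a))"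
    using assms(2,3) by (auto simp: hom_def)
  then show ?thesis using assms(1) unfolding is_zero_arr_def by blast
qed

text \<open>The two arrows may factor through different zero objects; the unique arrow between these
  compares the factorisations.\<close>

lemma is_zero_arr_unique:
  assumes "is_zero_arr C f" "is_zero_arr C g" "f \<in> hom C X Y" "g \<in> hom C X Y"
  shows "f = g"
proof -
  obtain Z a b where Z: "is_zero C Z" "a \<in> hom C X Z" "b \<in> hom C Z Y" "f = b \<cdot> a"
    using assms(1,3) unfolding is_zero_arr_def hom_def by auto
  obtain W c d where W: "is_zero C W" "c \<in> hom C X W" "d \<in> hom C W Y" "g = d \<cdot> c"
    using assms(2,4) unfolding is_zero_arr_def hom_def by auto
  have o: "X \<in> Obj C" "Y \<in> Obj C" "W \<in> Obj C" "Z \<in> Obj C"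
    using hom_obj[OF assms(3)] hom_obj[OF W(2)] hom_obj[OF Z(2)] by auto
  obtain t where t: "t \<in> hom C Z W" using Z(1) o unfolding is_zero_def is_initial_def by blast
  have "t \<cdot> a = c"
    using W(1,2) t Z(2) Comp_in_hom o unfolding is_zero_def is_terminal_def by metis
  moreover have "d \<cdot> t = b"
    using Z(1,3) t W(3) Comp_in_hom o unfolding is_zero_def is_initial_def by metis
  ultimately show ?thesis using Z W t Comp_assoc by metis
qed

lemma zero_arr_exists:
  assumes "X \<in> Obj C" "Y \<in> Obj C"
  obtains f where "f \<in> hom C X Y" "is_zero_arr C f"
proof -
  obtain Z where Z: "is_zero C Z" "Z \<in> Obj C" by (rule zero_object)
  obtain a b where ab: "a \<in> hom C X Z" "b \<in> hom C Z Y"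
    using Z assms unfolding is_zero_def is_initial_def is_terminal_def by blast
  show thesis using that[OF Comp_in_hom[OF ab] is_zero_arrI[OF Z(1) ab]] .
qed

lemma zero_arr_props:
  assumes "X \<in> Obj C" "Y \<in> Obj C"
  shows "zero_arr C X Y \<in> hom C X Y \<and> is_zero_arr C (zero_arr C X Y)"
  unfolding zero_arr_def
proof (rule theI')
  obtain f where "f \<in> hom C X Y" "is_zero_arr C f" using zero_arr_exists[OF assms] .
  then show "\<exists>!f. f \<in> hom C X Y \<and> is_zero_arr C f" using is_zero_arr_unique by blast
qed

lemma zero_arr_simps [simp]:
  assumes "X \<in> Obj C" "Y \<in> Obj C"
  shows "zero_arr C X Y \<in> Arr C" "Dom C (zero_arr C X Y) = X" "Cod C (zero_arr C X Y) = Y"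
  using zero_arr_props[OF assms] by (auto simp: hom_def)

lemma is_zero_arr_iff:
  assumes "f \<in> hom C X Y"
  shows "is_zero_arr C f \<longleftrightarrow> f = zero_arr C X Y"
  using zero_arr_props[OF hom_obj[OF assms]] is_zero_arr_unique assms by metis

lemma is_zero_arr_comp:
  assumes "is_zero_arr C f" "f \<in> hom C X Y"
  shows "g \<in> hom C Y Z \<Longrightarrow> is_zero_arr C (g \<cdot> f)"
    and "h \<in> hom C W X \<Longrightarrow> is_zero_arr C (f \<cdot> h)"
proof -
  obtain Z' a b where Z: "is_zero C Z'" "a \<in> hom C X Z'" "b \<in> hom C Z' Y" "f = b \<cdot> a"
    using assms unfolding is_zero_arr_def hom_def by auto
  show "is_zero_arr C (g \<cdot> f)" if g: "g \<in> hom C Y Z"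
    using is_zero_arrI[OF Z(1,2) Comp_in_hom[OF Z(3) g]] Comp_assoc[OF Z(2,3) g] Z(4) by simp
  show "is_zero_arr C (f \<cdot> h)" if h: "h \<in> hom C W X"
    using is_zero_arrI[OF Z(1) Comp_in_hom[OF h Z(2)] Z(3)] Comp_assoc[OF h Z(2,3)] Z(4) by simp
qed

lemma comp_zero [simp]:
  assumes "f \<in> Arr C" "Dom C f = Y" "X \<in> Obj C"
  shows "f \<cdot> zero_arr C X Y = zero_arr C X (Cod C f)"
proof -
  have f: "f \<in> hom C Y (Cod C f)" and Y: "Y \<in> Obj C" using assms by (auto simp: hom_def)
  note z = zero_arr_props[OF assms(3) Y]
  show ?thesis
    using is_zero_arr_comp(1)[OF conjunct2[OF z] conjunct1[OF z] f]
      is_zero_arr_iff[OF Comp_in_hom[OF conjunct1[OF z] f]] by simp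
qed

lemma zero_comp [simp]:
  assumes "f \<in> Arr C" "Cod C f = Y" "Z \<in> Obj C"
  shows "zero_arr C Y Z \<cdot> f = zero_arr C (Dom C f) Z"
proof -
  have f: "f \<in> hom C (Dom C f) Y" and Y: "Y \<in> Obj C" using assms by (auto simp: hom_def)
  note z = zero_arr_props[OF Y assms(3)]
  show ?thesis
    using is_zero_arr_comp(2)[OF conjunct2[OF z] conjunct1[OF z] f]
      is_zero_arr_iff[OF Comp_in_hom[OF f conjunct1[OF z]]] by simp
qed

lemma hom_zero_object:
  assumes "is_zero C Z"
  shows "f \<in> hom C X Z \<Longrightarrow> f = zero_arr C X Z" and "g \<in> hom C Z X \<Longrightarrow> g = zero_arr C Z X"
  using assms zero_arr_props hom_obj unfolding is_zero_def is_initial_def is_terminal_def by metis+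

text \<open>Makes being a zero object an equation between arrows, which can be tested after
  composing with an epimorphism.\<close>

lemma is_zero_iff_ident:
  assumes "Z \<in> Obj C"
  shows "is_zero C Z \<longleftrightarrow> Ident C Z = zero_arr C Z Z"
proof
  assume "is_zero C Z"
  then show "Ident C Z = zero_arr C Z Z" using hom_zero_object Ident_in_hom[OF assms] by metis
next
  assume i: "Ident C Z = zero_arr C Z Z"
  have "\<exists>!f. f \<in> hom C Z X" if X: "X \<in> Obj C" for X
  proof
    show "zero_arr C Z X \<in> hom C Z X" using assms X by (simp add: hom_def)
    fix f assume f: "f \<in> hom C Z X"
    then have "f = f \<cdot> Ident C Z" by (simp add: hom_def)
    then show "f = zero_arr C Z X" using f assms X unfolding i by (simp add: hom_def)
  qed
  moreover have "\<exists>!f. f \<in> hom C X Z" if X: "X \<in> Obj C" for X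
  proof
    show "zero_arr C X Z \<in> hom C X Z" using assms X by (simp add: hom_def)
    fix f assume f: "f \<in> hom C X Z"
    then have "f = Ident C Z \<cdot> f" by (simp add: hom_def)
    then show "f = zero_arr C X Z" using f assms X unfolding i by (simp add: hom_def)
  qed
  ultimately show "is_zero C Z"
    using assms unfolding is_zero_def is_initial_def is_terminal_def by blast
qed

lemma is_kernelI:
  assumes "f \<in> hom C X Y" "k \<in> hom C K X" "f \<cdot> k = zero_arr C K Y" "is_mono C k"
    and "\<And>T u. \<lbrakk>u \<in> hom C T X; f \<cdot> u = zero_arr C T Y\<rbrakk> \<Longrightarrow> \<exists>h \<in> hom C T K. k \<cdot> h = u"
  shows "is_kernel C f k"
  unfolding is_kernel_def
proof (intro conjI allI ballI impI ex_ex1I)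
  have "f \<cdot> k \<in> hom C K Y" using Comp_in_hom[OF assms(2,1)] .
  then show "is_zero_arr C (f \<cdot> k)" using is_zero_arr_iff assms(3) by blast
  fix T u
  assume u: "u \<in> hom C T (Dom C f)" "is_zero_arr C (f \<cdot> u)"
  then have uX: "u \<in> hom C T X" "f \<cdot> u \<in> hom C T Y" using assms(1) by (auto simp: hom_def)
  then show "\<exists>h. h \<in> hom C T (Dom C k) \<and> k \<cdot> h = u"
    using assms(5)[of u T] is_zero_arr_iff u assms(2) by (auto simp: hom_def)
  fix x y
  assume "x \<in> hom C T (Dom C k) \<and> k \<cdot> x = u" "y \<in> hom C T (Dom C k) \<and> k \<cdot> y = u"
  then show "x = y" using mono_cancel[OF assms(4)] by (auto simp: hom_def)
qed (use assms in \<open>auto simp: hom_def\<close>)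

lemma kernelD:
  assumes "is_kernel C f k"
  shows "f \<in> Arr C" "k \<in> Arr C" "Cod C k = Dom C f" "f \<cdot> k = zero_arr C (Dom C k) (Cod C f)"
    "is_mono C k"
proof -
  show a: "f \<in> Arr C" "k \<in> Arr C" "Cod C k = Dom C f" using assms by (auto simp: is_kernel_def)
  have h: "f \<cdot> k \<in> hom C (Dom C k) (Cod C f)" using a by (simp add: hom_def)
  then show z: "f \<cdot> k = zero_arr C (Dom C k) (Cod C f)"
    using assms is_zero_arr_iff by (auto simp: is_kernel_def)
  show "is_mono C k"
  proof (rule is_monoI)
    show "k \<in> hom C (Dom C k) (Dom C f)" using a by (simp add: hom_def)
    fix T u v
    assume uv: "u \<in> hom C T (Dom C k)" "v \<in> hom C T (Dom C k)" "k \<cdot> u = k \<cdot> v"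
    have "f \<cdot> (k \<cdot> u) = zero_arr C T (Cod C f)"
      using a uv by (simp add: hom_def comp_reassoc[OF z])
    moreover have "k \<cdot> u \<in> hom C T (Dom C f)" "f \<cdot> (k \<cdot> u) \<in> hom C T (Cod C f)"
      using a uv by (simp_all add: hom_def)
    ultimately have "\<exists>!h. h \<in> hom C T (Dom C k) \<and> k \<cdot> h = k \<cdot> u"
      using assms is_zero_arr_iff unfolding is_kernel_def by blast
    then show "u = v" using uv by metis
  qed
qed

lemma kernel_lift:
  assumes "is_kernel C f k" "f \<cdot> u = zero_arr C T (Cod C f)" "u \<in> hom C T (Dom C f)"
  obtains h where "h \<in> hom C T (Dom C k)" "k \<cdot> h = u"
proof -
  have "f \<cdot> u \<in> hom C T (Cod C f)" using assms by (auto simp: is_kernel_def hom_def)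
  then have "is_zero_arr C (f \<cdot> u)" using assms(2) is_zero_arr_iff by blast
  then show thesis using assms that unfolding is_kernel_def by blast
qed

end

text \<open>The structure used to form cosmash products; it is shared by a semi-abelian category and
  its full subcategory of two-nilpotent objects.\<close>

locale cosmash_category = pointed_category C
  for C :: "('o, 'm) cat" (structure) +
  assumes products: "\<lbrakk>X \<in> Obj C; Y \<in> Obj C\<rbrakk> \<Longrightarrow> \<exists>P p q. is_product C X Y P p q"
    and coproducts: "\<lbrakk>X \<in> Obj C; Y \<in> Obj C\<rbrakk> \<Longrightarrow> \<exists>S i j. is_coproduct C X Y S i j"
    and kernels: "f \<in> Arr C \<Longrightarrow> \<exists>k. is_kernel C f k"
begin

lemma chosen_is_product:
  "\<lbrakk>X \<in> Obj C; Y \<in> Obj C\<rbrakk> \<Longrightarrow> is_product C X Y (prd C X Y) (pr1 C X Y) (pr2 C X Y)"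
  using someI_ex[of "\<lambda>(P, p, q). is_product C X Y P p q"] products[of X Y]
  unfolding prd_def pr1_def pr2_def chosen_product_def by (force split: prod.splits)

lemma chosen_is_coproduct:
  "\<lbrakk>X \<in> Obj C; Y \<in> Obj C\<rbrakk> \<Longrightarrow> is_coproduct C X Y (coprd C X Y) (in1 C X Y) (in2 C X Y)"
  using someI_ex[of "\<lambda>(S, i, j). is_coproduct C X Y S i j"] coproducts[of X Y]
  unfolding coprd_def in1_def in2_def chosen_coproduct_def by (force split: prod.splits)

lemma pr_simps [simp]:
  assumes "X \<in> Obj C" "Y \<in> Obj C"
  shows "pr1 C X Y \<in> Arr C" "Dom C (pr1 C X Y) = prd C X Y" "Cod C (pr1 C X Y) = X"
    "pr2 C X Y \<in> Arr C" "Dom C (pr2 C X Y) = prd C X Y" "Cod C (pr2 C X Y) = Y"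
  using chosen_is_product[OF assms] by (auto simp: is_product_def hom_def)

lemma in_simps [simp]:
  assumes "X \<in> Obj C" "Y \<in> Obj C"
  shows "in1 C X Y \<in> Arr C" "Cod C (in1 C X Y) = coprd C X Y" "Dom C (in1 C X Y) = X"
    "in2 C X Y \<in> Arr C" "Cod C (in2 C X Y) = coprd C X Y" "Dom C (in2 C X Y) = Y"
  using chosen_is_coproduct[OF assms] by (auto simp: is_coproduct_def hom_def)

lemma prd_obj [simp]: "\<lbrakk>X \<in> Obj C; Y \<in> Obj C\<rbrakk> \<Longrightarrow> prd C X Y \<in> Obj C"
  using dom_obj[of "pr1 C X Y"] by simp

lemma coprd_obj [simp]: "\<lbrakk>X \<in> Obj C; Y \<in> Obj C\<rbrakk> \<Longrightarrow> coprd C X Y \<in> Obj C"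
  using cod_obj[of "in1 C X Y"] by simp

lemma pair_props:
  assumes "f \<in> Arr C" "g \<in> Arr C" "Dom C f = Dom C g"
  shows "pair C f g \<in> hom C (Dom C f) (prd C (Cod C f) (Cod C g)) \<and>
    pr1 C (Cod C f) (Cod C g) \<cdot> pair C f g = f \<and> pr2 C (Cod C f) (Cod C g) \<cdot> pair C f g = g"
  unfolding pair_def
proof (rule theI')
  have "f \<in> hom C (Dom C f) (Cod C f)" "g \<in> hom C (Dom C f) (Cod C g)"
    using assms by (simp_all add: hom_def)
  then show "\<exists>!h. h \<in> hom C (Dom C f) (prd C (Cod C f) (Cod C g)) \<and>
      pr1 C (Cod C f) (Cod C g) \<cdot> h = f \<and> pr2 C (Cod C f) (Cod C g) \<cdot> h = g"
    using chosen_is_product[OF cod_obj[OF assms(1)] cod_obj[OF assms(2)]]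
    unfolding is_product_def by blast
qed

lemma copair_props:
  assumes "f \<in> Arr C" "g \<in> Arr C" "Cod C f = Cod C g"
  shows "copair C f g \<in> hom C (coprd C (Dom C f) (Dom C g)) (Cod C f) \<and>
    copair C f g \<cdot> in1 C (Dom C f) (Dom C g) = f \<and> copair C f g \<cdot> in2 C (Dom C f) (Dom C g) = g"
  unfolding copair_def
proof (rule theI')
  have "f \<in> hom C (Dom C f) (Cod C f)" "g \<in> hom C (Dom C g) (Cod C f)"
    using assms by (simp_all add: hom_def)
  then show "\<exists>!h. h \<in> hom C (coprd C (Dom C f) (Dom C g)) (Cod C f) \<and>
      h \<cdot> in1 C (Dom C f) (Dom C g) = f \<and> h \<cdot> in2 C (Dom C f) (Dom C g) = g"
    using chosen_is_coproduct[OF dom_obj[OF assms(1)] dom_obj[OF assms(2)]]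
    unfolding is_coproduct_def by blast
qed

lemma pair_simps [simp]:
  assumes "f \<in> Arr C" "g \<in> Arr C" "Dom C f = Dom C g"
  shows "pair C f g \<in> Arr C" "Dom C (pair C f g) = Dom C g"
    "Cod C (pair C f g) = prd C (Cod C f) (Cod C g)"
  using pair_props[OF assms] assms(3) by (auto simp: hom_def)

lemma copair_simps [simp]:
  assumes "f \<in> Arr C" "g \<in> Arr C" "Cod C f = Cod C g"
  shows "copair C f g \<in> Arr C" "Cod C (copair C f g) = Cod C g"
    "Dom C (copair C f g) = coprd C (Dom C f) (Dom C g)"
  using copair_props[OF assms] assms(3) by (auto simp: hom_def)

lemma pr_pair [simp]:
  assumes "f \<in> Arr C" "g \<in> Arr C" "Dom C f = Dom C g" "Cod C f = X" "Cod C g = Y"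
  shows "pr1 C X Y \<cdot> pair C f g = f" "pr2 C X Y \<cdot> pair C f g = g"
  using pair_props[OF assms(1-3)] assms(4,5) by auto

lemma copair_in [simp]:
  assumes "f \<in> Arr C" "g \<in> Arr C" "Cod C f = Cod C g" "Dom C f = X" "Dom C g = Y"
  shows "copair C f g \<cdot> in1 C X Y = f" "copair C f g \<cdot> in2 C X Y = g"
  using copair_props[OF assms(1-3)] assms(4,5) by auto

lemma pr_pair_comp [simp]:
  assumes "f \<in> Arr C" "g \<in> Arr C" "Dom C f = Dom C g" "Cod C f = X" "Cod C g = Y"
    "x \<in> Arr C" "Cod C x = Dom C g"
  shows "pr1 C X Y \<cdot> (pair C f g \<cdot> x) = f \<cdot> x" "pr2 C X Y \<cdot> (pair C f g \<cdot> x) = g \<cdot> x"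
  using assms by (auto simp: comp_reassoc[OF pr_pair(1)] comp_reassoc[OF pr_pair(2)])

lemma copair_in_comp [simp]:
  assumes "f \<in> Arr C" "g \<in> Arr C" "Cod C f = Cod C g" "Dom C f = X" "Dom C g = Y" "x \<in> Arr C"
  shows "Cod C x = X \<Longrightarrow> copair C f g \<cdot> (in1 C X Y \<cdot> x) = f \<cdot> x"
    "Cod C x = Y \<Longrightarrow> copair C f g \<cdot> (in2 C X Y \<cdot> x) = g \<cdot> x"
  using assms by (auto simp: comp_reassoc[OF copair_in(1)] comp_reassoc[OF copair_in(2)])

lemma prd_ext:
  assumes "u \<in> hom C T (prd C X Y)" "v \<in> hom C T (prd C X Y)" "X \<in> Obj C" "Y \<in> Obj C"
    "pr1 C X Y \<cdot> u = pr1 C X Y \<cdot> v" "pr2 C X Y \<cdot> u = pr2 C X Y \<cdot> v"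
  shows "u = v"
proof -
  have "pr1 C X Y \<cdot> u \<in> hom C T X" "pr2 C X Y \<cdot> u \<in> hom C T Y"
    using assms by (simp_all add: hom_def)
  then have "\<exists>!h. h \<in> hom C T (prd C X Y) \<and> pr1 C X Y \<cdot> h = pr1 C X Y \<cdot> u \<and>
      pr2 C X Y \<cdot> h = pr2 C X Y \<cdot> u"
    using chosen_is_product[OF assms(3,4)] unfolding is_product_def by blast
  then show ?thesis using assms by metis
qed

lemma coprd_ext:
  assumes "u \<in> hom C (coprd C X Y) T" "v \<in> hom C (coprd C X Y) T" "X \<in> Obj C" "Y \<in> Obj C"
    "u \<cdot> in1 C X Y = v \<cdot> in1 C X Y" "u \<cdot> in2 C X Y = v \<cdot> in2 C X Y"
  shows "u = v"
proof -
  have "u \<cdot> in1 C X Y \<in> hom C X T" "u \<cdot> in2 C X Y \<in> hom C Y T"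
    using assms by (simp_all add: hom_def)
  then have "\<exists>!h. h \<in> hom C (coprd C X Y) T \<and> h \<cdot> in1 C X Y = u \<cdot> in1 C X Y \<and>
      h \<cdot> in2 C X Y = u \<cdot> in2 C X Y"
    using chosen_is_coproduct[OF assms(3,4)] unfolding is_coproduct_def by blast
  then show ?thesis using assms by metis
qed

lemma pair_comp:
  assumes "f \<in> Arr C" "g \<in> Arr C" "Dom C f = Dom C g" "x \<in> Arr C" "Cod C x = Dom C g"
  shows "pair C f g \<cdot> x = pair C (f \<cdot> x) (g \<cdot> x)"
  by (rule prd_ext[of _ "Dom C x" "Cod C f" "Cod C g"]) (use assms in \<open>simp_all add: hom_def\<close>)

lemma comp_copair:
  assumes "f \<in> Arr C" "g \<in> Arr C" "Cod C f = Cod C g" "x \<in> Arr C" "Dom C x = Cod C g"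
  shows "x \<cdot> copair C f g = copair C (x \<cdot> f) (x \<cdot> g)"
  by (rule coprd_ext[of _ "Dom C f" "Dom C g" "Cod C x"]) (use assms in \<open>simp_all add: hom_def\<close>)

lemma pair_eq_zero_iff:
  assumes "f \<in> hom C T X" "g \<in> hom C T Y"
  shows "pair C f g = zero_arr C T (prd C X Y) \<longleftrightarrow> f = zero_arr C T X \<and> g = zero_arr C T Y"
proof -
  have o: "T \<in> Obj C" "X \<in> Obj C" "Y \<in> Obj C" using hom_obj assms by blast+
  have "f = zero_arr C T X \<and> g = zero_arr C T Y" if "pair C f g = zero_arr C T (prd C X Y)"
  proof -
    have "pr1 C X Y \<cdot> pair C f g = zero_arr C T X" "pr2 C X Y \<cdot> pair C f g = zero_arr C T Y"
      unfolding that using o by simp_all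
    then show ?thesis using assms by (simp add: hom_def)
  qed
  moreover have "pair C (zero_arr C T X) (zero_arr C T Y) = zero_arr C T (prd C X Y)"
    by (rule prd_ext[of _ T X Y]) (use o in \<open>simp_all add: hom_def\<close>)
  ultimately show ?thesis by metis
qed

lemma coprd_map_simps [simp]:
  assumes "f \<in> Arr C" "g \<in> Arr C"
  shows "coprd_map C f g \<in> Arr C" "Dom C (coprd_map C f g) = coprd C (Dom C f) (Dom C g)"
    "Cod C (coprd_map C f g) = coprd C (Cod C f) (Cod C g)"
  using assms by (simp_all add: coprd_map_def)

lemma copair_coprd_map:
  assumes "f \<in> Arr C" "g \<in> Arr C" "u \<in> Arr C" "v \<in> Arr C"
    "Dom C u = Cod C f" "Dom C v = Cod C g" "Cod C u = Cod C v"
  shows "copair C u v \<cdot> coprd_map C f g = copair C (u \<cdot> f) (v \<cdot> g)"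
  using assms unfolding coprd_map_def by (simp add: comp_copair)

lemma ker_is_kernel: "f \<in> Arr C \<Longrightarrow> is_kernel C f (ker C f)"
  unfolding ker_def using kernels by (rule someI_ex)

section \<open>Binary cosmash products and their functoriality\<close>

abbreviation ret1 where "ret1 X Y \<equiv> copair C (Ident C X) (zero_arr C Y X)"
abbreviation ret2 where "ret2 X Y \<equiv> copair C (zero_arr C X Y) (Ident C Y)"

text \<open>Written as a pairing, the comparison from sum to product splits into its two components,
  so the cosmash product consists of what both retractions of the sum kill.\<close>

lemma pair_ret:
  assumes "X \<in> Obj C" "Y \<in> Obj C"
  shows "copair C (pair C (Ident C X) (zero_arr C X Y)) (pair C (zero_arr C Y X) (Ident C Y))
    = pair C (ret1 X Y) (ret2 X Y)"
  by (rule coprd_ext[of _ X Y "prd C X Y"]) (use assms in \<open>simp_all add: hom_def pair_comp\<close>)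

lemma cosmash_arr_kernel:
  assumes "X \<in> Obj C" "Y \<in> Obj C"
  shows "is_kernel C (pair C (ret1 X Y) (ret2 X Y)) (cosmash_arr C X Y)"
  unfolding cosmash_arr_def pair_ret[OF assms] by (rule ker_is_kernel) (use assms in simp)

lemma cosmash_arr_simps [simp]:
  assumes "X \<in> Obj C" "Y \<in> Obj C"
  shows "cosmash_arr C X Y \<in> Arr C" "Dom C (cosmash_arr C X Y) = cosmash C X Y"
    "Cod C (cosmash_arr C X Y) = coprd C X Y"
  using kernelD[OF cosmash_arr_kernel[OF assms]] assms by (simp_all add: cosmash_def)

lemma cosmash_obj [simp]: "\<lbrakk>X \<in> Obj C; Y \<in> Obj C\<rbrakk> \<Longrightarrow> cosmash C X Y \<in> Obj C"
  using dom_obj[of "cosmash_arr C X Y"] by simp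

lemma cosmash_arr_mono: "\<lbrakk>X \<in> Obj C; Y \<in> Obj C\<rbrakk> \<Longrightarrow> is_mono C (cosmash_arr C X Y)"
  using kernelD(5)[OF cosmash_arr_kernel] .

lemma ret_cosmash_arr [simp]:
  assumes "X \<in> Obj C" "Y \<in> Obj C"
  shows "ret1 X Y \<cdot> cosmash_arr C X Y = zero_arr C (cosmash C X Y) X"
    "ret2 X Y \<cdot> cosmash_arr C X Y = zero_arr C (cosmash C X Y) Y"
proof -
  let ?c = "cosmash_arr C X Y"
  have "pair C (ret1 X Y \<cdot> ?c) (ret2 X Y \<cdot> ?c) = zero_arr C (cosmash C X Y) (prd C X Y)"
    using kernelD(4)[OF cosmash_arr_kernel[OF assms]] assms by (simp add: pair_comp)
  moreover have "ret1 X Y \<cdot> ?c \<in> hom C (cosmash C X Y) X" "ret2 X Y \<cdot> ?c \<in> hom C (cosmash C X Y) Y"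
    using assms by (simp_all add: hom_def)
  ultimately show "ret1 X Y \<cdot> ?c = zero_arr C (cosmash C X Y) X"
    "ret2 X Y \<cdot> ?c = zero_arr C (cosmash C X Y) Y"
    using pair_eq_zero_iff by blast+
qed

lemma cosmash_lift:
  assumes "u \<in> hom C T (coprd C X Y)" "X \<in> Obj C" "Y \<in> Obj C"
    "ret1 X Y \<cdot> u = zero_arr C T X" "ret2 X Y \<cdot> u = zero_arr C T Y"
  obtains h where "h \<in> hom C T (cosmash C X Y)" "cosmash_arr C X Y \<cdot> h = u"
proof (rule kernel_lift[OF cosmash_arr_kernel[OF assms(2,3)], of u T])
  have h: "ret1 X Y \<cdot> u \<in> hom C T X" "ret2 X Y \<cdot> u \<in> hom C T Y"
    using assms(1-3) by (simp_all add: hom_def)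
  have "pair C (ret1 X Y) (ret2 X Y) \<cdot> u = pair C (ret1 X Y \<cdot> u) (ret2 X Y \<cdot> u)"
    using assms(1-3) by (subst pair_comp) (simp_all add: hom_def)
  then show "pair C (ret1 X Y) (ret2 X Y) \<cdot> u = zero_arr C T (Cod C (pair C (ret1 X Y) (ret2 X Y)))"
    using pair_eq_zero_iff[OF h] assms(2-5) by simp
  show "u \<in> hom C T (Dom C (pair C (ret1 X Y) (ret2 X Y)))" using assms by (simp add: hom_def)
qed (use assms that in simp)

lemma cosmash_map_ex1:
  assumes "f \<in> Arr C" "g \<in> Arr C"
  shows "\<exists>!h. h \<in> hom C (cosmash C (Dom C f) (Dom C g)) (cosmash C (Cod C f) (Cod C g)) \<and>
    cosmash_arr C (Cod C f) (Cod C g) \<cdot> h = coprd_map C f g \<cdot> cosmash_arr C (Dom C f) (Dom C g)"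
proof (rule ex_ex1I)
  let ?X = "Dom C f" and ?Y = "Dom C g" and ?X' = "Cod C f" and ?Y' = "Cod C g"
  let ?c = "cosmash_arr C ?X ?Y"
  have "ret1 ?X' ?Y' \<cdot> coprd_map C f g = f \<cdot> ret1 ?X ?Y"
    "ret2 ?X' ?Y' \<cdot> coprd_map C f g = g \<cdot> ret2 ?X ?Y"
    using assms by (simp_all add: copair_coprd_map comp_copair)
  then have "ret1 ?X' ?Y' \<cdot> (coprd_map C f g \<cdot> ?c) = zero_arr C (cosmash C ?X ?Y) ?X'"
    "ret2 ?X' ?Y' \<cdot> (coprd_map C f g \<cdot> ?c) = zero_arr C (cosmash C ?X ?Y) ?Y'"
    using assms by (simp_all add: comp_reassoc)
  then show "\<exists>h. h \<in> hom C (cosmash C ?X ?Y) (cosmash C ?X' ?Y') \<and>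
      cosmash_arr C ?X' ?Y' \<cdot> h = coprd_map C f g \<cdot> ?c"
    using cosmash_lift[of "coprd_map C f g \<cdot> ?c" "cosmash C ?X ?Y" ?X' ?Y'] assms
    by (auto simp: hom_def)
  fix x y
  assume "x \<in> hom C (cosmash C ?X ?Y) (cosmash C ?X' ?Y') \<and>
      cosmash_arr C ?X' ?Y' \<cdot> x = coprd_map C f g \<cdot> ?c"
    "y \<in> hom C (cosmash C ?X ?Y) (cosmash C ?X' ?Y') \<and>
      cosmash_arr C ?X' ?Y' \<cdot> y = coprd_map C f g \<cdot> ?c"
  then show "x = y"
    using mono_cancel[OF cosmash_arr_mono[of ?X' ?Y'], of x y] assms by (auto simp: hom_def)
qed

lemmas cosmash_map_props = theI'[OF cosmash_map_ex1, folded cosmash_map_def]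

lemma cosmash_mapI:
  assumes "f \<in> hom C X X'" "g \<in> hom C Y Y'" "h \<in> hom C (cosmash C X Y) (cosmash C X' Y')"
    "cosmash_arr C X' Y' \<cdot> h = coprd_map C f g \<cdot> cosmash_arr C X Y"
  shows "cosmash_map C f g = h"
proof -
  have d: "f \<in> Arr C" "g \<in> Arr C" "Dom C f = X" "Cod C f = X'" "Dom C g = Y" "Cod C g = Y'"
    using assms by (auto simp: hom_def)
  show ?thesis
    unfolding cosmash_map_def
    by (rule the1_equality[OF cosmash_map_ex1[OF d(1,2)]]) (use assms(3,4) in \<open>simp add: d\<close>)
qed

lemma cosmash_map_ident:
  assumes "X \<in> Obj C" "Y \<in> Obj C"
  shows "cosmash_map C (Ident C X) (Ident C Y) = Ident C (cosmash C X Y)"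
proof -
  have "coprd_map C (Ident C X) (Ident C Y) = Ident C (coprd C X Y)"
    by (rule coprd_ext[of _ X Y "coprd C X Y"]) (use assms in \<open>simp_all add: hom_def coprd_map_def\<close>)
  then show ?thesis
    by (intro cosmash_mapI[of _ X X _ Y Y]) (use assms in \<open>simp_all add: hom_def\<close>)
qed

lemma cosmash_map_comp:
  assumes "f \<in> hom C X Y" "f' \<in> hom C Y Z" "g \<in> hom C U V" "g' \<in> hom C V W"
  shows "cosmash_map C (f' \<cdot> f) (g' \<cdot> g) = cosmash_map C f' g' \<cdot> cosmash_map C f g"
proof -
  have o: "X \<in> Obj C" "Y \<in> Obj C" "Z \<in> Obj C" "U \<in> Obj C" "V \<in> Obj C" "W \<in> Obj C"
    using assms hom_obj by blast+
  have a: "f \<in> Arr C" "f' \<in> Arr C" "g \<in> Arr C" "g' \<in> Arr C"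
    "Dom C f = X" "Cod C f = Y" "Dom C f' = Y" "Cod C f' = Z"
    "Dom C g = U" "Cod C g = V" "Dom C g' = V" "Cod C g' = W"
    using assms by (auto simp: hom_def)
  have m: "coprd_map C (f' \<cdot> f) (g' \<cdot> g) = coprd_map C f' g' \<cdot> coprd_map C f g"
    using a o by (simp add: coprd_map_def[of C f' g'] copair_coprd_map)
      (simp add: coprd_map_def)
  let ?m = "cosmash_map C f g" and ?m' = "cosmash_map C f' g'"
  have p: "?m \<in> Arr C" "Dom C ?m = cosmash C X U" "Cod C ?m = cosmash C Y V"
    "?m' \<in> Arr C" "Dom C ?m' = cosmash C Y V" "Cod C ?m' = cosmash C Z W"
    and e: "cosmash_arr C Y V \<cdot> ?m = coprd_map C f g \<cdot> cosmash_arr C X U"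
    "cosmash_arr C Z W \<cdot> ?m' = coprd_map C f' g' \<cdot> cosmash_arr C Y V"
    using cosmash_map_props[of f g] cosmash_map_props[of f' g'] a by (auto simp: hom_def)
  have "cosmash_arr C Z W \<cdot> (?m' \<cdot> ?m) = coprd_map C f' g' \<cdot> (coprd_map C f g \<cdot> cosmash_arr C X U)"
    using p a o by (simp add: comp_reassoc[OF e(2)] e(1))
  then show ?thesis
    by (intro cosmash_mapI[of _ X Z _ U W]) (use p a o in \<open>simp_all add: m hom_def\<close>)
qed

end

section \<open>Finite limits in a semi-abelian category\<close>

context semi_abelian_category
begin

sublocale pointed_category C
  by unfold_locales (rule pointed)

lemma finitely_complete: "finitely_complete C" and regular: "regular_category C"
  using Barr_exact by (simp_all add: Barr_exact_def regular_category_def)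

lemma pullback_exists:
  assumes "f \<in> hom C X Z" "g \<in> hom C Y Z"
  obtains P p q where "is_pullback C f g P p q" "p \<in> hom C P X" "q \<in> hom C P Y" "f \<cdot> p = g \<cdot> q"
proof -
  have fg: "f \<in> Arr C" "g \<in> Arr C" "Cod C f = Cod C g" using assms by (auto simp: hom_def)
  then obtain P p q where P: "is_pullback C f g P p q"
    using finitely_complete unfolding finitely_complete_def by metis
  have "p \<in> hom C P X" "q \<in> hom C P Y" "f \<cdot> p = g \<cdot> q"
    using is_pullbackD[OF P] assms by (auto simp: hom_def)
  with P that show thesis by blast
qed

lemma product_exists:
  assumes "X \<in> Obj C" "Y \<in> Obj C"
  shows "\<exists>P p q. is_product C X Y P p q"
proof -
  obtain Z where Z: "is_zero C Z" "Z \<in> Obj C" by (rule zero_object)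
  let ?f = "zero_arr C X Z" and ?g = "zero_arr C Y Z"
  have fg: "?f \<in> hom C X Z" "?g \<in> hom C Y Z" using assms Z by (simp_all add: hom_def)
  obtain P p q where P: "is_pullback C ?f ?g P p q" "p \<in> hom C P X" "q \<in> hom C P Y"
    using pullback_exists[OF fg] by metis
  have "is_product C X Y P p q"
    unfolding is_product_def
  proof (intro conjI allI ballI P(2,3) ex_ex1I)
    fix T u v assume uv: "u \<in> hom C T X" "v \<in> hom C T Y"
    have "?f \<cdot> u = ?g \<cdot> v" using uv Z by (simp add: hom_def)
    then show "\<exists>h. h \<in> hom C T P \<and> p \<cdot> h = u \<and> q \<cdot> h = v"
      using pullback_lift[OF P(1), of u v T] uv assms Z by (auto simp: hom_def)
    fix x y assume "x \<in> hom C T P \<and> p \<cdot> x = u \<and> q \<cdot> x = v" "y \<in> hom C T P \<and> p \<cdot> y = u \<and> q \<cdot> y = v"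
    then show "x = y" using pullback_ext[OF P(1), of x y T] by simp
  qed
  then show ?thesis by blast
qed

lemma kernel_exists:
  assumes "f \<in> Arr C"
  shows "\<exists>k. is_kernel C f k"
proof -
  let ?X = "Dom C f" and ?Y = "Cod C f"
  obtain Z where Z: "is_zero C Z" "Z \<in> Obj C" by (rule zero_object)
  let ?z = "zero_arr C Z ?Y"
  have fg: "f \<in> hom C ?X ?Y" "?z \<in> hom C Z ?Y" using assms Z by (simp_all add: hom_def)
  obtain P p q where P: "is_pullback C f ?z P p q" "p \<in> hom C P ?X" "q \<in> hom C P Z" "f \<cdot> p = ?z \<cdot> q"
    using pullback_exists[OF fg] by metis
  have "is_kernel C f p"
  proof (rule is_kernelI[OF fg(1) P(2)])
    show "f \<cdot> p = zero_arr C P ?Y" unfolding P(4) using P(3) assms by (simp add: hom_def)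
    show "is_mono C p"
    proof (rule is_monoI[OF P(2)])
      fix T u v assume uv: "u \<in> hom C T P" "v \<in> hom C T P" "p \<cdot> u = p \<cdot> v"
      have "q \<cdot> u = q \<cdot> v"
        using hom_zero_object(1)[OF Z(1) Comp_in_hom[OF uv(1) P(3)]]
          hom_zero_object(1)[OF Z(1) Comp_in_hom[OF uv(2) P(3)]] by simp
      then show "u = v" using pullback_ext[OF P(1) uv(3)] uv by blast
    qed
    fix T u assume u: "u \<in> hom C T ?X" "f \<cdot> u = zero_arr C T ?Y"
    then have "f \<cdot> u = ?z \<cdot> zero_arr C T Z" "T \<in> Obj C" using Z assms hom_obj by simp_all
    then show "\<exists>h \<in> hom C T P. p \<cdot> h = u"
      using pullback_lift[OF P(1), of u "zero_arr C T Z" T] u Z assms by (auto simp: hom_def)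
  qed
  then show ?thesis by blast
qed

sublocale cosmash_category C
  using product_exists kernel_exists has_finite_coproducts
  by unfold_locales (auto simp: has_finite_coproducts_def)

text \<open>The equalizer is the pullback of the graphs of \<open>f\<close> and \<open>g\<close>:
  the first coordinates force its two projections to coincide, the second ones give the
  equation.\<close>

lemma equalizer_exists:
  assumes "f \<in> hom C X Y" "g \<in> hom C X Y"
  obtains E m where "is_mono C m" "m \<in> hom C E X" "f \<cdot> m = g \<cdot> m"
    "\<And>T u. \<lbrakk>u \<in> hom C T X; f \<cdot> u = g \<cdot> u\<rbrakk> \<Longrightarrow> \<exists>h \<in> hom C T E. m \<cdot> h = u"
proof -
  have d: "f \<in> Arr C" "Dom C f = X" "Cod C f = Y" "g \<in> Arr C" "Dom C g = X" "Cod C g = Y"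
    "X \<in> Obj C" "Y \<in> Obj C"
    using assms hom_obj by (auto simp: hom_def)
  let ?f = "pair C (Ident C X) f" and ?g = "pair C (Ident C X) g"
  have fg: "?f \<in> hom C X (prd C X Y)" "?g \<in> hom C X (prd C X Y)" using d by (simp_all add: hom_def)
  obtain E p q where P: "is_pullback C ?f ?g E p q" "p \<in> hom C E X" "q \<in> hom C E X" "?f \<cdot> p = ?g \<cdot> q"
    using pullback_exists[OF fg] by metis
  have "pr1 C X Y \<cdot> (?f \<cdot> p) = pr1 C X Y \<cdot> (?g \<cdot> q)" "pr2 C X Y \<cdot> (?f \<cdot> p) = pr2 C X Y \<cdot> (?g \<cdot> q)"
    using P(4) by simp_all
  then have pq: "p = q" "f \<cdot> p = g \<cdot> p" using P(2,3) d by (simp_all add: hom_def)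
  show thesis
  proof (rule that[OF _ P(2) pq(2)])
    show "is_mono C p"
      by (rule is_monoI[OF P(2)]) (use pullback_ext[OF P(1)] pq in blast)
    fix T u assume u: "u \<in> hom C T X" "f \<cdot> u = g \<cdot> u"
    then have "?f \<cdot> u = ?g \<cdot> u" using d by (simp add: hom_def pair_comp)
    then show "\<exists>h \<in> hom C T E. p \<cdot> h = u"
      using pullback_lift[OF P(1), of u u T] u d by (auto simp: hom_def)
  qed
qed

section \<open>Regular epimorphisms and images\<close>

lemma regular_epi_pullback:
  "\<lbrakk>is_pullback C f g P p q; is_regular_epi C g\<rbrakk> \<Longrightarrow> is_regular_epi C p"
  using regular unfolding regular_category_def by blast

text \<open>\<open>e\<close> is the coequalizer of the kernel pair of \<open>f\<close>. That the
  induced \<open>m\<close> is monic is checked after covering the test object, which is possible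
  because regular epimorphisms are stable under pullback.\<close>

lemma image_factorization:
  assumes "f \<in> hom C X Y"
  obtains I m e where "is_regular_epi C e" "is_mono C m" "e \<in> hom C X I" "m \<in> hom C I Y" "m \<cdot> e = f"
proof -
  obtain R p q where R: "is_pullback C f f R p q" "p \<in> hom C R X" "q \<in> hom C R X" "f \<cdot> p = f \<cdot> q"
    using pullback_exists[OF assms assms] by metis
  obtain e where e: "is_coequalizer C p q e" using regular R(1) unfolding regular_category_def by blast
  let ?I = "Cod C e"
  note d = coequalizerD[OF e]
  have eh: "e \<in> hom C X ?I" using d R by (simp add: hom_def)
  obtain m where m: "m \<in> hom C ?I Y" "m \<cdot> e = f"
    using coequalizer_desc[OF e R(4), of Y] assms eh by (auto simp: hom_def)
  have er: "is_regular_epi C e" using e by (auto simp: is_regular_epi_def)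
  have "is_mono C m"
  proof (rule is_monoI[OF m(1)])
    fix T u v assume uv: "u \<in> hom C T ?I" "v \<in> hom C T ?I" "m \<cdot> u = m \<cdot> v"
    \<comment> \<open>Two successive pullbacks of \<open>e\<close> cover \<open>T\<close> by
      \<open>T2\<close>, over which both \<open>u\<close> and \<open>v\<close> lift to
      \<open>X\<close>, by \<open>x \<cdot> w\<close> and \<open>y\<close>. The lifts have equal
      images under \<open>f\<close>, so they form an element of the kernel pair, which
      \<open>e\<close> identifies.\<close>
    obtain T1 u' x where a: "is_pullback C u e T1 u' x" "u' \<in> hom C T1 T" "x \<in> hom C T1 X" "u \<cdot> u' = e \<cdot> x"
      using pullback_exists[OF uv(1) eh] by metis
    obtain T2 w y where b: "is_pullback C (v \<cdot> u') e T2 w y" "w \<in> hom C T2 T1" "y \<in> hom C T2 X"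
        "(v \<cdot> u') \<cdot> w = e \<cdot> y"
      using pullback_exists[OF Comp_in_hom[OF a(2) uv(2)] eh] by metis
    note t = uv(1,2) a(2,3) b(2,3) m(1) eh
    have "f \<cdot> (x \<cdot> w) = m \<cdot> (e \<cdot> (x \<cdot> w))"
      using t by (simp add: hom_def comp_reassoc[OF m(2)])
    also have "e \<cdot> (x \<cdot> w) = u \<cdot> (u' \<cdot> w)"
      using t by (simp add: hom_def comp_reassoc[OF a(4)])
    also have "m \<cdot> (u \<cdot> (u' \<cdot> w)) = m \<cdot> (v \<cdot> (u' \<cdot> w))"
      using t by (simp add: hom_def comp_reassoc[OF uv(3)])
    also have "v \<cdot> (u' \<cdot> w) = e \<cdot> y" using t b(4) by (simp add: hom_def)
    also have "m \<cdot> (e \<cdot> y) = f \<cdot> y"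
      using t by (simp add: hom_def comp_reassoc[OF m(2)])
    finally have "f \<cdot> (x \<cdot> w) = f \<cdot> y" .
    then obtain z where z: "z \<in> hom C T2 R" "p \<cdot> z = x \<cdot> w" "q \<cdot> z = y"
      using pullback_lift[OF R(1), of "x \<cdot> w" y T2] t assms by (auto simp: hom_def)
    have "e \<cdot> (x \<cdot> w) = e \<cdot> y"
      using z(1) R(2,3) eh d(7) comp_reassoc[OF d(7)] by (simp add: hom_def flip: z(2,3))
    then have "u \<cdot> (u' \<cdot> w) = v \<cdot> (u' \<cdot> w)"
      using t b(4) by (simp add: hom_def comp_reassoc[OF a(4)])
    then have "(u \<cdot> u') \<cdot> w = (v \<cdot> u') \<cdot> w" using t by (simp add: hom_def)
    then have "u \<cdot> u' = v \<cdot> u'"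
      by (rule epi_cancel[OF regular_epi_is_epi[OF regular_epi_pullback[OF b(1) er]]])
        (use t in \<open>auto simp: hom_def\<close>)
    then show "u = v"
      by (rule epi_cancel[OF regular_epi_is_epi[OF regular_epi_pullback[OF a(1) er]]])
        (use t in \<open>auto simp: hom_def\<close>)
  qed
  then show thesis using that er eh m by blast
qed

text \<open>The hypothesis applies to the monic part of the image factorisation of \<open>f\<close>.
  It is the standard way below to recognise a regular epimorphism.\<close>

lemma extremal_regular_epi:
  assumes "f \<in> hom C X Y"
    and "\<And>I m l. \<lbrakk>is_mono C m; m \<in> hom C I Y; l \<in> hom C X I; m \<cdot> l = f\<rbrakk> \<Longrightarrow> is_iso C m"
  shows "is_regular_epi C f"
proof -
  obtain I m e where m: "is_regular_epi C e" "is_mono C m" "e \<in> hom C X I" "m \<in> hom C I Y" "m \<cdot> e = f"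
    using image_factorization[OF assms(1)] by metis
  have "is_regular_epi C (m \<cdot> e)"
    by (rule is_regular_epi_iso_comp[OF m(1) assms(2)[OF m(2,4,3,5)]]) (use m in \<open>simp add: hom_def\<close>)
  then show ?thesis using m by simp
qed

text \<open>A subobject through which the arrow factors contains both injections, by lifting along
  \<open>f\<close> and \<open>g\<close> separately, and hence the whole sum.\<close>

lemma coprd_map_regular_epi:
  assumes "is_regular_epi C f" "is_regular_epi C g"
  shows "is_regular_epi C (coprd_map C f g)"
proof (rule extremal_regular_epi)
  have a: "f \<in> Arr C" "g \<in> Arr C" using assms regular_epi_arr by auto
  let ?X = "Dom C f" and ?Y = "Dom C g" and ?X' = "Cod C f" and ?Y' = "Cod C g"
  show "coprd_map C f g \<in> hom C (coprd C ?X ?Y) (coprd C ?X' ?Y')" using a by (simp add: hom_def)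
  fix I m l assume m: "is_mono C m" "m \<in> hom C I (coprd C ?X' ?Y')" "l \<in> hom C (coprd C ?X ?Y) I"
    "m \<cdot> l = coprd_map C f g"
  have "m \<cdot> (l \<cdot> in1 C ?X ?Y) = in1 C ?X' ?Y' \<cdot> f" "m \<cdot> (l \<cdot> in2 C ?X ?Y) = in2 C ?X' ?Y' \<cdot> g"
    using m(2,3) a by (simp_all add: hom_def comp_reassoc[OF m(4)]) (simp_all add: coprd_map_def)
  moreover have "l \<cdot> in1 C ?X ?Y \<in> hom C ?X I" "l \<cdot> in2 C ?X ?Y \<in> hom C ?Y I"
    "in1 C ?X' ?Y' \<in> hom C ?X' (coprd C ?X' ?Y')" "in2 C ?X' ?Y' \<in> hom C ?Y' (coprd C ?X' ?Y')"
    "f \<in> hom C ?X ?X'" "g \<in> hom C ?Y ?Y'"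
    using m(2,3) a by (simp_all add: hom_def)
  ultimately obtain x y where xy: "x \<in> hom C ?X' I" "m \<cdot> x = in1 C ?X' ?Y'"
      "y \<in> hom C ?Y' I" "m \<cdot> y = in2 C ?X' ?Y'"
    using regular_epi_lift[OF assms(1) m(1) _ m(2)] regular_epi_lift[OF assms(2) m(1) _ m(2)] by metis
  have "m \<cdot> copair C x y = Ident C (coprd C ?X' ?Y')"
    by (rule coprd_ext[of _ ?X' ?Y' "coprd C ?X' ?Y'"]) (use xy m(2) a in \<open>simp_all add: hom_def\<close>)
  moreover have "copair C x y \<in> hom C (coprd C ?X' ?Y') I" using xy by (simp add: hom_def)
  ultimately show "is_iso C m" using split_epi_mono_is_iso[OF m(1,2)] by blast
qed

section \<open>Protomodularity\<close>

text \<open>The case in which both points have the same pullback \<open>Q\<close> and the comparison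
  arrow is the identity.\<close>

lemma protomodular:
  assumes "d \<in> hom C E B" "is_point C B A a s" "is_point C B A' a' s'" "is_point_mor C A a s A' a' s' h"
    "is_pullback C d a Q e u" "is_pullback C d a' Q e u'" "u' = h \<cdot> u"
  shows "is_iso C h"
proof -
  have Q: "Q \<in> Obj C" "e \<in> hom C Q E" "u' \<in> hom C Q A'"
    using is_pullbackD[OF assms(6)] dom_obj[of e] assms(1,3) by (auto simp: hom_def is_point_def)
  then have "Ident C Q \<in> hom C Q Q" "e \<cdot> Ident C Q = e" "u' \<cdot> Ident C Q = h \<cdot> u" "is_iso C (Ident C Q)"
    using assms(7) is_iso_ident by (auto simp: hom_def)
  with assms(1-6) Bourn_protomodular show ?thesis
    unfolding Bourn_protomodular_def by blast
qed

text \<open>If a monomorphism \<open>m\<close> into \<open>T\<close> contains both \<open>u\<close>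
  and \<open>s\<close>, its domain inherits the structure of a point over \<open>E\<close>, and the
  pullback of this point along \<open>d\<close> is still \<open>Q\<close>. So \<open>m\<close> is a
  morphism of points that becomes an identity after pulling back.\<close>

lemma protomodular_extremal:
  assumes "is_point C E T t s" "is_pullback C d t Q e u"
  shows "jointly_extremal C u s"
proof -
  note d = is_pullbackD[OF assms(2)]
  have s: "t \<in> Arr C" "s \<in> Arr C" "Dom C s = E" "Cod C s = T" "Dom C t = T" "Cod C t = E" "t \<cdot> s = Ident C E"
    using assms(1) by (auto simp: is_point_def hom_def)
  have "is_iso C m" if m: "is_mono C m" "Cod C m = Cod C u" "u' \<in> hom C (Dom C u) (Dom C m)" "m \<cdot> u' = u"
    "s' \<in> hom C (Dom C s) (Dom C m)" "m \<cdot> s' = s" for m u' s'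
  proof (rule protomodular[where d = d and u = u' and a = "t \<cdot> m" and s = s'])
    let ?J = "Dom C m"
    have ma: "m \<in> Arr C" using m(1) by (rule is_mono_arr)
    show "d \<in> hom C (Dom C d) E" using d s by (simp add: hom_def)
    show "is_point C E T t s" by (rule assms(1))
    show "is_point C E ?J (t \<cdot> m) s'"
      using ma m(2,3,5) s d(1-9) by (simp add: is_point_def hom_def m(6))
    show "is_point_mor C ?J (t \<cdot> m) s' T t s m"
      using ma m s d(1-9) by (simp add: is_point_mor_def hom_def)
    show "is_pullback C d t Q e u" by (rule assms(2))
    show "u = m \<cdot> u'" using m by simp
    show "is_pullback C d (t \<cdot> m) Q e u'"
    proof (rule is_pullbackI[where X = "Dom C d" and Y = ?J and Z = E])
      show "d \<cdot> e = (t \<cdot> m) \<cdot> u'" using ma m s d by (simp add: hom_def)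
      fix T' x y assume xy: "x \<in> hom C T' (Dom C d)" "y \<in> hom C T' ?J" "d \<cdot> x = (t \<cdot> m) \<cdot> y"
      have "d \<cdot> x = t \<cdot> (m \<cdot> y)" using xy ma m s d by (simp add: hom_def)
      then obtain h where h: "h \<in> hom C T' Q" "e \<cdot> h = x" "u \<cdot> h = m \<cdot> y"
        using pullback_lift[OF assms(2), of x "m \<cdot> y" T'] xy ma m d s by (auto simp: hom_def)
      have "m \<cdot> (u' \<cdot> h) = m \<cdot> y"
        using h ma m(2,3) s d(1-9) by (simp add: hom_def comp_reassoc[OF m(4)])
      then have "u' \<cdot> h = y"
        by (rule mono_cancel[OF m(1)]) (use h(1) ma m(2,3) xy d(1-9) in \<open>auto simp: hom_def\<close>)
      then show "\<exists>h \<in> hom C T' Q. e \<cdot> h = x \<and> u' \<cdot> h = y" using h by blast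
    next
      fix T' x y assume xy: "x \<in> hom C T' Q" "y \<in> hom C T' Q" "e \<cdot> x = e \<cdot> y" "u' \<cdot> x = u' \<cdot> y"
      have "u \<cdot> x = m \<cdot> (u' \<cdot> x)" "u \<cdot> y = m \<cdot> (u' \<cdot> y)"
        using xy(1,2) ma m(2,3) d(1-9) by (simp_all add: hom_def comp_reassoc[OF m(4)])
      then have "u \<cdot> x = u \<cdot> y" using xy(4) by simp
      then show "x = y" using pullback_ext[OF assms(2) xy(3)] xy by blast
    qed (use ma m s d in \<open>auto simp: hom_def\<close>)
  qed
  then show ?thesis using d s unfolding jointly_extremal_def by auto
qed

lemma jointly_extremalD:
  assumes "jointly_extremal C u v" "is_mono C m" "m \<in> hom C J (Cod C u)"
    "\<exists>x \<in> hom C (Dom C u) J. m \<cdot> x = u" "\<exists>y \<in> hom C (Dom C v) J. m \<cdot> y = v"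
  shows "is_iso C m"
proof -
  have "Dom C m = J" "Cod C m = Cod C u" using assms(3) by (simp_all add: hom_def)
  then show ?thesis using assms unfolding jointly_extremal_def by blast
qed

text \<open>The equalizer of \<open>f\<close> and \<open>g\<close> contains both arrows of the
  pair.\<close>

lemma jointly_extremal_ext:
  assumes "jointly_extremal C u v" "f \<cdot> u = g \<cdot> u" "f \<cdot> v = g \<cdot> v"
    "f \<in> hom C (Cod C u) Y" "g \<in> hom C (Cod C u) Y"
  shows "f = g"
proof -
  have uv: "u \<in> Arr C" "v \<in> Arr C" "Cod C v = Cod C u" using assms(1) by (auto simp: jointly_extremal_def)
  obtain E m where m: "is_mono C m" "m \<in> hom C E (Cod C u)" "f \<cdot> m = g \<cdot> m"
    "\<And>T x. \<lbrakk>x \<in> hom C T (Cod C u); f \<cdot> x = g \<cdot> x\<rbrakk> \<Longrightarrow> \<exists>h \<in> hom C T E. m \<cdot> h = x"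
    using equalizer_exists[OF assms(4,5)] by metis
  have "is_iso C m"
    by (rule jointly_extremalD[OF assms(1) m(1,2)]) (use m(4) uv assms(2,3) in \<open>simp_all add: hom_def\<close>)
  then obtain n where n: "n \<in> hom C (Cod C u) E" "m \<cdot> n = Ident C (Cod C u)"
    using is_isoE m(2) by metis
  have "(f \<cdot> m) \<cdot> n = (g \<cdot> m) \<cdot> n" using m(3) by simp
  then show ?thesis using n m(2) assms(4,5) by (simp add: hom_def)
qed

text \<open>The preimage of the subobject \<open>m\<close> under \<open>f\<close> contains both
  arrows of the pair, so it is everything.\<close>

lemma jointly_extremal_factor:
  assumes "jointly_extremal C u v" "is_mono C m" "m \<in> hom C J A" "f \<in> hom C (Cod C u) A"
    "x \<in> hom C (Dom C u) J" "y \<in> hom C (Dom C v) J" "m \<cdot> x = f \<cdot> u" "m \<cdot> y = f \<cdot> v"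
  obtains h where "h \<in> hom C (Cod C u) J" "m \<cdot> h = f"
proof -
  have uv: "u \<in> Arr C" "v \<in> Arr C" "Cod C v = Cod C u" using assms(1) by (auto simp: jointly_extremal_def)
  obtain P p q where P: "is_pullback C f m P p q" "p \<in> hom C P (Cod C u)" "q \<in> hom C P J" "f \<cdot> p = m \<cdot> q"
    using pullback_exists[OF assms(4,3)] by metis
  have pm: "is_mono C p" by (rule pullback_mono[OF P(1) assms(2)])
  have fm: "Dom C f = Cod C u" "Dom C m = J" using assms(3,4) by (auto simp: hom_def)
  have uv': "u \<in> hom C (Dom C u) (Cod C u)" "v \<in> hom C (Dom C v) (Cod C u)" using uv by (auto simp: hom_def)
  have "\<exists>h \<in> hom C (Dom C u) P. p \<cdot> h = u" "\<exists>h \<in> hom C (Dom C v) P. p \<cdot> h = v"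
    by (rule pullback_lift[OF P(1) assms(7)[symmetric], unfolded fm, OF uv'(1) assms(5)], blast)
      (rule pullback_lift[OF P(1) assms(8)[symmetric], unfolded fm, OF uv'(2) assms(6)], blast)
  then have "is_iso C p" by (rule jointly_extremalD[OF assms(1) pm P(2)])
  then obtain n where n: "n \<in> hom C (Cod C u) P" "p \<cdot> n = Ident C (Cod C u)"
    using is_isoE P(2) by metis
  have "m \<cdot> (q \<cdot> n) = f \<cdot> (p \<cdot> n)"
    using n(1) P(2,3) assms(3,4) by (simp add: hom_def comp_reassoc[OF P(4)])
  then have "m \<cdot> (q \<cdot> n) = f" using n(2) assms(4) by (simp add: hom_def)
  with that show thesis using Comp_in_hom[OF n(1) P(3)] by blast
qed

text \<open>Brings kernels into the form required by protomodularity, which speaks of pullbacks of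
  points: change of base along the arrow from the zero object.\<close>

lemma kernel_is_pullback:
  assumes "is_kernel C a k" "a \<in> hom C A B" "is_zero C Z"
  shows "is_pullback C (zero_arr C Z B) a (Dom C k) (zero_arr C (Dom C k) Z) k"
proof -
  have Z: "is_zero C Z" "Z \<in> Obj C" using assms(3) by (auto simp: is_zero_def is_initial_def)
  note k = kernelD[OF assms(1)]
  have a: "a \<in> Arr C" "Dom C a = A" "Cod C a = B" "B \<in> Obj C"
    using assms(2) hom_obj by (auto simp: hom_def)
  show ?thesis
  proof (rule is_pullbackI[where X = Z and Y = A and Z = B])
    fix T u v assume uv: "u \<in> hom C T Z" "v \<in> hom C T A" "zero_arr C Z B \<cdot> u = a \<cdot> v"
    then have "a \<cdot> v = zero_arr C T (Cod C a)" using a by (simp add: hom_def)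
    then obtain h where h: "h \<in> hom C T (Dom C k)" "k \<cdot> h = v"
      using kernel_lift[OF assms(1), of v T] uv a by auto
    moreover have "zero_arr C (Dom C k) Z \<cdot> h = u"
      using hom_zero_object(1)[OF Z(1) uv(1)] h(1) k Z by (simp add: hom_def)
    ultimately show "\<exists>h \<in> hom C T (Dom C k). zero_arr C (Dom C k) Z \<cdot> h = u \<and> k \<cdot> h = v" by blast
  next
    fix T x y assume "x \<in> hom C T (Dom C k)" "y \<in> hom C T (Dom C k)" "k \<cdot> x = k \<cdot> y"
    then show "x = y" using mono_cancel[OF k(5)] by (auto simp: hom_def)
  qed (use Z k a in \<open>auto simp: hom_def\<close>)
qed

text \<open>For groups: every element of a split extension is a product of an element of the kernel
  and one in the image of the section.\<close>

lemma kernel_section_extremal: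
  assumes "is_point C B A a s" "is_kernel C a k"
  shows "jointly_extremal C k s"
proof -
  obtain Z where "is_zero C Z" by (rule zero_object)
  then show ?thesis
    using protomodular_extremal[OF assms(1)] kernel_is_pullback[OF assms(2)] assms(1)
    unfolding is_point_def by blast
qed

lemma prd_kernel:
  assumes "X \<in> Obj C" "Y \<in> Obj C"
  shows "is_kernel C (pr2 C X Y) (pair C (Ident C X) (zero_arr C X Y))"
proof (rule is_kernelI[where X = "prd C X Y" and Y = Y and K = X])
  show "is_mono C (pair C (Ident C X) (zero_arr C X Y))"
    by (rule split_mono_is_mono[of _ X "prd C X Y" "pr1 C X Y"]) (use assms in \<open>auto simp: hom_def\<close>)
  fix T u assume u: "u \<in> hom C T (prd C X Y)" "pr2 C X Y \<cdot> u = zero_arr C T Y"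
  have "pair C (Ident C X) (zero_arr C X Y) \<cdot> (pr1 C X Y \<cdot> u) = u"
    by (rule prd_ext[of _ T X Y]) (use u assms in \<open>auto simp: hom_def\<close>)
  then show "\<exists>h \<in> hom C T X. pair C (Ident C X) (zero_arr C X Y) \<cdot> h = u"
    by (rule bexI) (use u assms in \<open>auto simp: hom_def\<close>)
qed (use assms in \<open>auto simp: hom_def\<close>)

lemma prd_extremal:
  assumes "X \<in> Obj C" "Y \<in> Obj C"
  shows "jointly_extremal C (pair C (Ident C X) (zero_arr C X Y)) (pair C (zero_arr C Y X) (Ident C Y))"
  by (rule kernel_section_extremal[OF _ prd_kernel[OF assms], where B = Y and A = "prd C X Y"])
    (use assms in \<open>auto simp: is_point_def hom_def\<close>)

text \<open>In elements, \<open>u\<close> sends \<open>x\<close> to \<open>(x, d (a x))\<close> and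
  \<open>v\<close> sends \<open>y\<close> to \<open>(s (p y), y)\<close>. The arrow \<open>u\<close>
  is the pullback of the section \<open>d\<close> along \<open>\<beta>\<close>, and
  \<open>\<beta>\<close> is split by \<open>v\<close>, so the general criterion for points
  applies.\<close>

lemma split_pullback_extremal:
  assumes "is_point C B A a s" "is_point C B E p d" "is_pullback C a p T \<alpha> \<beta>"
  obtains u v where "jointly_extremal C u v" "u \<in> hom C A T" "\<alpha> \<cdot> u = Ident C A" "\<beta> \<cdot> u = d \<cdot> a"
    "v \<in> hom C E T" "\<alpha> \<cdot> v = s \<cdot> p" "\<beta> \<cdot> v = Ident C E"
proof -
  note t = is_pullbackD[OF assms(3)]
  have d: "a \<in> Arr C" "s \<in> Arr C" "p \<in> Arr C" "d \<in> Arr C" "Dom C a = A" "Cod C a = B" "Dom C s = B"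
    "Cod C s = A" "Dom C p = E" "Cod C p = B" "Dom C d = B" "Cod C d = E" "A \<in> Obj C" "E \<in> Obj C" "B \<in> Obj C"
    and as: "a \<cdot> s = Ident C B" and pd: "p \<cdot> d = Ident C B"
    using assms(1,2) dom_obj[of a] dom_obj[of p] dom_obj[of d] by (auto simp: is_point_def hom_def)
  have "a \<cdot> Ident C A = p \<cdot> (d \<cdot> a)" "a \<cdot> (s \<cdot> p) = p \<cdot> Ident C E"
    using d by (simp_all add: comp_reassoc[OF as] comp_reassoc[OF pd])
  then obtain u v where u: "u \<in> hom C A T" "\<alpha> \<cdot> u = Ident C A" "\<beta> \<cdot> u = d \<cdot> a"
    and v: "v \<in> hom C E T" "\<alpha> \<cdot> v = s \<cdot> p" "\<beta> \<cdot> v = Ident C E"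
    using pullback_lift[OF assms(3), of "Ident C A" "d \<cdot> a" A] pullback_lift[OF assms(3), of "s \<cdot> p" "Ident C E" E] d
    by (simp add: hom_def) metis
  have "is_pullback C d \<beta> A a u"
  proof (rule is_pullbackI[where X = B and Y = T and Z = E])
    show "d \<cdot> a = \<beta> \<cdot> u" using u by simp
    fix T' x y assume xy: "x \<in> hom C T' B" "y \<in> hom C T' T" "d \<cdot> x = \<beta> \<cdot> y"
    have ay: "a \<cdot> (\<alpha> \<cdot> y) = x"
    proof -
      have "a \<cdot> (\<alpha> \<cdot> y) = p \<cdot> (\<beta> \<cdot> y)" using t(1-9) xy d by (simp add: hom_def comp_reassoc[OF t(10)])
      also have "\<dots> = x" unfolding xy(3)[symmetric] using xy(1) d by (simp add: hom_def comp_reassoc[OF pd])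
      finally show ?thesis .
    qed
    moreover have "u \<cdot> (\<alpha> \<cdot> y) = y"
      by (rule pullback_ext[OF assms(3), of _ _ T'])
        (use t(1-9) xy d u(1) ay in \<open>simp_all add: hom_def comp_reassoc[OF u(2)] comp_reassoc[OF u(3)]\<close>)
    moreover have "\<alpha> \<cdot> y \<in> hom C T' A" using t xy d by (simp add: hom_def)
    ultimately show "\<exists>h \<in> hom C T' A. a \<cdot> h = x \<and> u \<cdot> h = y" by blast
  next
    fix T' x y assume xy: "x \<in> hom C T' A" "y \<in> hom C T' A" "u \<cdot> x = u \<cdot> y"
    have "\<alpha> \<cdot> (u \<cdot> x) = x" "\<alpha> \<cdot> (u \<cdot> y) = y"
      using xy(1,2) u(1) t(1-9) d by (simp_all add: hom_def comp_reassoc[OF u(2)])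
    then show "x = y" using xy(3) by metis
  qed (use t d u in \<open>auto simp: hom_def\<close>)
  moreover have "is_point C E T \<beta> v" using t v d by (simp add: is_point_def hom_def)
  ultimately have "jointly_extremal C u v" using protomodular_extremal by blast
  with that u v show thesis by blast
qed

end

section \<open>Cokernels, the Mal'tsev property and kernels of points\<close>

context pointed_category
begin

lemma is_cokernelI:
  assumes "f \<in> hom C X Y" "q \<in> hom C Y Q" "q \<cdot> f = zero_arr C X Q"
    and "\<And>T u. \<lbrakk>u \<in> hom C Y T; u \<cdot> f = zero_arr C X T\<rbrakk> \<Longrightarrow> \<exists>!h. h \<in> hom C Q T \<and> h \<cdot> q = u"
  shows "is_cokernel C f q"
proof -
  have d: "f \<in> Arr C" "q \<in> Arr C" "Dom C f = X" "Cod C f = Y" "Dom C q = Y" "Cod C q = Q"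
    using assms(1,2) by (auto simp: hom_def)
  have "is_zero_arr C (q \<cdot> f)"
    using is_zero_arr_iff[OF Comp_in_hom[OF assms(1,2)]] assms(3) by blast
  moreover have "\<exists>!h. h \<in> hom C Q T \<and> h \<cdot> q = u" if "u \<in> hom C Y T" "is_zero_arr C (u \<cdot> f)" for T u
    using assms(4)[OF that(1)] is_zero_arr_iff[OF Comp_in_hom[OF assms(1) that(1)]] that(2) by blast
  ultimately show ?thesis unfolding is_cokernel_def d using d(1,2) by blast
qed

lemma cokernelD:
  assumes "is_cokernel C f q" "f \<in> hom C X Y"
  shows "q \<in> Arr C" "Dom C q = Y" "q \<cdot> f = zero_arr C X (Cod C q)" "is_regular_epi C q"
proof -
  have d: "f \<in> Arr C" "Dom C f = X" "Cod C f = Y" "X \<in> Obj C" "Y \<in> Obj C"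
    using assms(2) hom_obj by (auto simp: hom_def)
  show q: "q \<in> Arr C" "Dom C q = Y" using assms(1) d by (auto simp: is_cokernel_def)
  have "q \<cdot> f \<in> hom C X (Cod C q)" using q d by (simp add: hom_def)
  then show z: "q \<cdot> f = zero_arr C X (Cod C q)"
    using assms(1) is_zero_arr_iff by (auto simp: is_cokernel_def)
  have "is_coequalizer C f (zero_arr C X Y) q"
    unfolding is_coequalizer_def
  proof (intro conjI allI ballI impI)
    show "q \<cdot> f = q \<cdot> zero_arr C X Y" using z q d by simp
    fix T u assume u: "u \<in> hom C (Cod C f) T" "u \<cdot> f = u \<cdot> zero_arr C X Y"
    have uY: "u \<in> hom C Y T" using u(1) d by simp
    have "u \<cdot> f = zero_arr C X T" using u(2) d uY by (simp add: hom_def)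
    moreover have "u \<cdot> f \<in> hom C X T" using Comp_in_hom[OF assms(2) uY] .
    ultimately have "is_zero_arr C (u \<cdot> f)" using is_zero_arr_iff by blast
    then show "\<exists>!h. h \<in> hom C (Cod C q) T \<and> h \<cdot> q = u"
      using assms(1) u(1) unfolding is_cokernel_def by blast
  qed (use q d in \<open>auto simp: hom_def\<close>)
  then show "is_regular_epi C q" unfolding is_regular_epi_def by blast
qed

lemma cokernel_desc:
  assumes "is_cokernel C f q" "f \<in> hom C X Y" "u \<in> hom C Y T" "u \<cdot> f = zero_arr C X T"
  obtains h where "h \<in> hom C (Cod C q) T" "h \<cdot> q = u"
proof -
  have "is_zero_arr C (u \<cdot> f)" using is_zero_arr_iff[OF Comp_in_hom[OF assms(2,3)]] assms(4) by blast
  moreover have "u \<in> hom C (Cod C f) T" using assms(2,3) by (simp add: hom_def)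
  ultimately have "\<exists>!h. h \<in> hom C (Cod C q) T \<and> h \<cdot> q = u"
    using assms(1) unfolding is_cokernel_def by blast
  with that show thesis by blast
qed

end

context semi_abelian_category
begin

text \<open>The kernel pair \<open>R\<close> of \<open>q\<close> is a split epimorphism over
  \<open>X\<close> by \<open>p1\<close>, with the diagonal as section and \<open>(0, k)\<close> as
  kernel. On both of these \<open>f \<cdot> p1\<close> and \<open>f \<cdot> p2\<close> agree, hence
  everywhere; and any pair with coequalizer \<open>q\<close> factors through
  \<open>R\<close>.\<close>

lemma regular_epi_desc:
  assumes "is_regular_epi C q" "q \<in> hom C X Y" "is_kernel C q k" "f \<in> hom C X T"
    "f \<cdot> k = zero_arr C (Dom C k) T"
  obtains h where "h \<in> hom C Y T" "h \<cdot> q = f"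
proof -
  note k = kernelD[OF assms(3)]
  have X: "X \<in> Obj C" "Y \<in> Obj C" using assms(2) hom_obj by blast+
  obtain R p1 p2 where R: "is_pullback C q q R p1 p2" "p1 \<in> hom C R X" "p2 \<in> hom C R X" "q \<cdot> p1 = q \<cdot> p2"
    using pullback_exists[OF assms(2,2)] by metis
  have dq: "Dom C q = X" using assms(2) by (simp add: hom_def)
  have I: "Ident C X \<in> hom C X X" using X by (simp add: hom_def)
  obtain d where d: "d \<in> hom C X R" "p1 \<cdot> d = Ident C X" "p2 \<cdot> d = Ident C X"
    using pullback_lift[OF R(1) refl, unfolded dq, OF I I] by metis
  have pt: "is_point C X R p1 d" using d R by (simp add: is_point_def)
  let ?K = "Dom C k"
  have kX: "k \<in> hom C ?K X" using k dq by (simp add: hom_def)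
  have zX: "zero_arr C ?K X \<in> hom C ?K X" using k X by (simp add: hom_def)
  have "q \<cdot> zero_arr C ?K X = q \<cdot> k" using k assms(2) by (simp add: hom_def)
  then obtain l where l: "l \<in> hom C ?K R" "p1 \<cdot> l = zero_arr C ?K X" "p2 \<cdot> l = k"
    using pullback_lift[OF R(1), unfolded dq, OF _ zX kX] by metis
  have "is_kernel C p1 l"
  proof (rule is_kernelI[OF R(2) l(1,2)])
    show "is_mono C l"
    proof (rule is_monoI[OF l(1)])
      fix S u v assume uv: "u \<in> hom C S ?K" "v \<in> hom C S ?K" "l \<cdot> u = l \<cdot> v"
      have "k \<cdot> u = p2 \<cdot> (l \<cdot> u)" "k \<cdot> v = p2 \<cdot> (l \<cdot> v)"
        using uv(1,2) R(2,3) l(1) by (simp_all add: hom_def comp_reassoc[OF l(3)])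
      then show "u = v" using mono_cancel[OF k(5), of u v] uv by (auto simp: hom_def)
    qed
    fix S u assume u: "u \<in> hom C S R" "p1 \<cdot> u = zero_arr C S X"
    have "q \<cdot> (p2 \<cdot> u) = q \<cdot> (p1 \<cdot> u)"
      using u(1) R(2,3) assms(2) by (simp add: hom_def comp_reassoc[OF R(4)])
    then have "q \<cdot> (p2 \<cdot> u) = zero_arr C S (Cod C q)"
      unfolding u(2) using u(1) assms(2) hom_obj(1)[OF u(1)] by (simp add: hom_def)
    then obtain h where h: "h \<in> hom C S ?K" "k \<cdot> h = p2 \<cdot> u"
      using kernel_lift[OF assms(3), unfolded dq] Comp_in_hom[OF u(1) R(3)] by metis
    have "l \<cdot> h = u"
      by (rule pullback_ext[OF R(1), of _ _ S])
       (use h u R(2,3) l(1) X in \<open>simp_all add: hom_def comp_reassoc[OF l(2)] comp_reassoc[OF l(3)]\<close>)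
    with h show "\<exists>h \<in> hom C S ?K. l \<cdot> h = u" by blast
  qed
  then have je: "jointly_extremal C l d" by (rule kernel_section_extremal[OF pt])
  have lR: "Cod C l = R" using l by (simp add: hom_def)
  have fp: "f \<cdot> p1 = f \<cdot> p2"
  proof (rule jointly_extremal_ext[OF je, where Y = T])
    show "(f \<cdot> p1) \<cdot> l = (f \<cdot> p2) \<cdot> l" using R(2,3) l assms(4,5) k by (simp add: hom_def)
    show "(f \<cdot> p1) \<cdot> d = (f \<cdot> p2) \<cdot> d" using R(2,3) d assms(4) by (simp add: hom_def)
  qed (use R assms(4) lR in \<open>auto simp: hom_def\<close>)
  obtain a b where ab: "is_coequalizer C a b q" using assms(1) by (auto simp: is_regular_epi_def)
  note c = coequalizerD[OF ab]
  have abX: "a \<in> hom C (Dom C a) X" "b \<in> hom C (Dom C a) X" using c dq by (auto simp: hom_def)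
  obtain w where w: "w \<in> hom C (Dom C a) R" "p1 \<cdot> w = a" "p2 \<cdot> w = b"
    using pullback_lift[OF R(1) c(7), unfolded dq, OF abX] by metis
  have "(f \<cdot> p1) \<cdot> w = (f \<cdot> p2) \<cdot> w" using fp by simp
  then have "f \<cdot> a = f \<cdot> b" using w R(2,3) assms(4) by (simp add: hom_def)
  then show thesis
    using coequalizer_desc[OF ab, of f T] assms(2,4) that by (auto simp: hom_def)
qed

text \<open>The generalized elements \<open>x, y, z\<close> of the relation \<open>R\<close> stand for \<open>a R b\<close>, \<open>c R b\<close>, \<open>c R d\<close>.  The
  triples of this kind form a pullback of two split epimorphisms, whose sections give the cases
  \<open>a = c\<close> and \<open>b = d\<close>, in which \<open>a R d\<close> is clear.\<close>

lemma difunctional: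
  assumes "r \<in> hom C R X" "s \<in> hom C R Y"
    and mm: "is_mono C (pair C r s)"
    and "x \<in> hom C W R" "y \<in> hom C W R" "z \<in> hom C W R" "s \<cdot> x = s \<cdot> y" "r \<cdot> y = r \<cdot> z"
  obtains w where "w \<in> hom C W R" "r \<cdot> w = r \<cdot> x" "s \<cdot> w = s \<cdot> z"
proof -
  have o: "R \<in> Obj C" "X \<in> Obj C" "Y \<in> Obj C" using assms(1,2) hom_obj by blast+
  have I: "Ident C R \<in> hom C R R" using o by (simp add: hom_def)
  have dr: "Dom C r = R" "Dom C s = R" using assms(1,2) by (auto simp: hom_def)
  obtain D1 p1 p2 where D1: "is_pullback C s s D1 p1 p2" "p1 \<in> hom C D1 R" "p2 \<in> hom C D1 R" "s \<cdot> p1 = s \<cdot> p2"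
    using pullback_exists[OF assms(2,2)] by metis
  obtain D2 q1 q2 where D2: "is_pullback C r r D2 q1 q2" "q1 \<in> hom C D2 R" "q2 \<in> hom C D2 R" "r \<cdot> q1 = r \<cdot> q2"
    using pullback_exists[OF assms(1,1)] by metis
  obtain d1 where d1: "d1 \<in> hom C R D1" "p1 \<cdot> d1 = Ident C R" "p2 \<cdot> d1 = Ident C R"
    using pullback_lift[OF D1(1) refl, unfolded dr, OF I I] by metis
  obtain d2 where d2: "d2 \<in> hom C R D2" "q1 \<cdot> d2 = Ident C R" "q2 \<cdot> d2 = Ident C R"
    using pullback_lift[OF D2(1) refl, unfolded dr, OF I I] by metis
  obtain T a b where T: "is_pullback C p2 q1 T a b" "a \<in> hom C T D1" "b \<in> hom C T D2" "p2 \<cdot> a = q1 \<cdot> b"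
    using pullback_exists[OF D1(3) D2(2)] by metis
  have pt: "is_point C R D1 p2 d1" "is_point C R D2 q1 d2"
    using d1 d2 D1 D2 by (simp_all add: is_point_def)
  obtain u v where uv: "jointly_extremal C u v" "u \<in> hom C D1 T" "a \<cdot> u = Ident C D1" "b \<cdot> u = d2 \<cdot> p2"
    "v \<in> hom C D2 T" "a \<cdot> v = d1 \<cdot> q1" "b \<cdot> v = Ident C D2"
    using split_pullback_extremal[OF pt T(1)] by metis
  note t = D1(2,3) D2(2,3) d1(1) d2(1) T(2,3) uv(2,5) assms(1,2)
  let ?m = "pair C r s"
  have mh: "?m \<in> hom C R (prd C X Y)" using assms(1,2) by (simp add: hom_def)
  let ?f = "pair C (r \<cdot> (p1 \<cdot> a)) (s \<cdot> (q2 \<cdot> b))"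
  have fh: "?f \<in> hom C T (prd C X Y)" using t by (simp add: hom_def)
  have cu: "Cod C u = T" "Dom C u = D1" "Dom C v = D2" using uv by (auto simp: hom_def)
  have fu: "?m \<cdot> p1 = ?f \<cdot> u"
    using t D1(4) by (simp add: hom_def pair_comp uv(3,4))
      (simp add: comp_reassoc[OF d2(3)])
  have fv: "?m \<cdot> q2 = ?f \<cdot> v"
    using t D2(4) by (simp add: hom_def pair_comp uv(6,7))
      (simp add: comp_reassoc[OF d1(2)])
  obtain h where h: "h \<in> hom C T R" "?m \<cdot> h = ?f"
    by (rule jointly_extremal_factor[OF uv(1) mm mh, unfolded cu, OF fh D1(2) D2(3) fu fv])
  have rh: "r \<cdot> h = r \<cdot> (p1 \<cdot> a)" "s \<cdot> h = s \<cdot> (q2 \<cdot> b)"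
  proof -
    have "pr1 C X Y \<cdot> (?m \<cdot> h) = r \<cdot> (p1 \<cdot> a)" "pr2 C X Y \<cdot> (?m \<cdot> h) = s \<cdot> (q2 \<cdot> b)"
      unfolding h(2) using t o by (simp_all add: hom_def)
    then show "r \<cdot> h = r \<cdot> (p1 \<cdot> a)" "s \<cdot> h = s \<cdot> (q2 \<cdot> b)" using h(1) t o by (simp_all add: hom_def)
  qed
  obtain e1 where e1: "e1 \<in> hom C W D1" "p1 \<cdot> e1 = x" "p2 \<cdot> e1 = y"
    using pullback_lift[OF D1(1) assms(7), unfolded dr, OF assms(4,5)] by metis
  obtain e2 where e2: "e2 \<in> hom C W D2" "q1 \<cdot> e2 = y" "q2 \<cdot> e2 = z"
    using pullback_lift[OF D2(1) assms(8), unfolded dr, OF assms(5,6)] by metis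
  have dp: "Dom C p2 = D1" "Dom C q1 = D2" using t by (auto simp: hom_def)
  have "p2 \<cdot> e1 = q1 \<cdot> e2" using e1 e2 by simp
  then obtain g where g: "g \<in> hom C W T" "a \<cdot> g = e1" "b \<cdot> g = e2"
    using pullback_lift[OF T(1), unfolded dp, OF _ e1(1) e2(1)] by metis
  have "r \<cdot> (h \<cdot> g) = r \<cdot> x" "s \<cdot> (h \<cdot> g) = s \<cdot> z"
    using t g h(1) e1(2) e2(3) by (simp_all add: hom_def comp_reassoc[OF rh(1)] comp_reassoc[OF rh(2)])
  then show thesis using that Comp_in_hom[OF g(1) h(1)] by blast
qed

text \<open>The Mal'tsev property. Symmetry completes the chain \<open>b R b\<close>,
  \<open>a R b\<close>, \<open>a R a\<close> to \<open>b R a\<close>; transitivity completes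
  \<open>a R b\<close>, \<open>b R b\<close>, \<open>b R c\<close> to \<open>a R c\<close>.\<close>

lemma reflexive_relation_is_equivalence:
  assumes "r \<in> hom C R X" "s \<in> hom C R X"
    and mm: "is_mono C (pair C r s)"
    and "d \<in> hom C X R" "r \<cdot> d = Ident C X" "s \<cdot> d = Ident C X"
  shows "is_equivalence_relation C X R r s"
  unfolding is_equivalence_relation_def
proof (intro conjI assms(1,2) allI ballI impI)
  note t = assms(1,2,4)
  have o: "R \<in> Obj C" "X \<in> Obj C" using assms(1,2) hom_obj by blast+
  show "u = v" if "u \<in> hom C T R" "v \<in> hom C T R" "r \<cdot> u = r \<cdot> v \<and> s \<cdot> u = s \<cdot> v" for T u v
    by (rule mono_cancel[OF mm]) (use that t in \<open>simp_all add: hom_def pair_comp\<close>)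
  show "\<exists>d \<in> hom C X R. r \<cdot> d = Ident C X \<and> s \<cdot> d = Ident C X" using assms(4-6) by blast
  have e: "d \<cdot> s \<in> hom C R R" "Ident C R \<in> hom C R R" "d \<cdot> r \<in> hom C R R"
    using t o by (simp_all add: hom_def)
  have "s \<cdot> (d \<cdot> s) = s \<cdot> Ident C R" "r \<cdot> Ident C R = r \<cdot> (d \<cdot> r)"
    using t o by (simp_all add: hom_def comp_reassoc[OF assms(5)] comp_reassoc[OF assms(6)])
  then obtain w where "w \<in> hom C R R" "r \<cdot> w = r \<cdot> (d \<cdot> s)" "s \<cdot> w = s \<cdot> (d \<cdot> r)"
    using difunctional[OF assms(1,2) mm e] by metis
  then show "\<exists>t \<in> hom C R R. r \<cdot> t = s \<and> s \<cdot> t = r"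
    using t by (intro bexI[of _ w]) (simp_all add: hom_def comp_reassoc[OF assms(5)] comp_reassoc[OF assms(6)])
  fix P p q assume P: "is_pullback C s r P p q"
  note pb = is_pullbackD[OF P]
  have pq: "p \<in> hom C P R" "q \<in> hom C P R" using pb t by (auto simp: hom_def)
  have m: "d \<cdot> (s \<cdot> p) \<in> hom C P R" using t pq by (simp add: hom_def)
  have "s \<cdot> p = s \<cdot> (d \<cdot> (s \<cdot> p))" "r \<cdot> (d \<cdot> (s \<cdot> p)) = r \<cdot> q"
    using t pq pb(10) by (simp_all add: hom_def comp_reassoc[OF assms(5)] comp_reassoc[OF assms(6)])
  then show "\<exists>t \<in> hom C P R. r \<cdot> t = r \<cdot> p \<and> s \<cdot> t = s \<cdot> q"
    using difunctional[OF assms(1,2) mm pq(1) m pq(2)] by metis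
qed

text \<open>The cokernel of \<open>f\<close> is the quotient by the equivalence relation generated by the
  reflexive pair \<open>[f, 1], [0, 1] : A + X \<rightarrow> X\<close>; by protomodularity its image is already an
  equivalence relation.\<close>

lemma cokernel_exists:
  assumes "f \<in> hom C A X"
  shows "\<exists>q. is_cokernel C f q"
proof -
  have o: "A \<in> Obj C" "X \<in> Obj C" and fa: "f \<in> Arr C" "Dom C f = A" "Cod C f = X"
    using assms hom_obj by (auto simp: hom_def)
  let ?r = "copair C f (Ident C X)" and ?s = "copair C (zero_arr C A X) (Ident C X)"
  let ?S = "coprd C A X"
  have "pair C ?r ?s \<in> hom C ?S (prd C X X)" using o fa by (simp add: hom_def)
  then obtain I m e where m: "is_regular_epi C e" "is_mono C m" "e \<in> hom C ?S I" "m \<in> hom C I (prd C X X)"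
      "m \<cdot> e = pair C ?r ?s"
    using image_factorization by metis
  let ?m1 = "pr1 C X X \<cdot> m" and ?m2 = "pr2 C X X \<cdot> m"
  have m12: "?m1 \<in> hom C I X" "?m2 \<in> hom C I X" using m o by (simp_all add: hom_def)
  have me: "?m1 \<cdot> e = ?r" "?m2 \<cdot> e = ?s" using m(3,4) o fa by (simp_all add: hom_def m(5))
  have "is_equivalence_relation C X I ?m1 ?m2"
  proof (rule reflexive_relation_is_equivalence[OF m12])
    have "pair C ?m1 ?m2 = m"
      by (rule prd_ext[of _ I X X]) (use m o in \<open>simp_all add: hom_def\<close>)
    then show "is_mono C (pair C ?m1 ?m2)" using m by simp
  next
    show "e \<cdot> in2 C A X \<in> hom C X I" using m o by (simp add: hom_def)
    show "?m1 \<cdot> (e \<cdot> in2 C A X) = Ident C X" "?m2 \<cdot> (e \<cdot> in2 C A X) = Ident C X"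
      using m(3,4) o fa comp_reassoc[OF me(1), of "in2 C A X"] comp_reassoc[OF me(2), of "in2 C A X"]
      by (simp_all add: hom_def)
  qed
  then obtain g where g: "is_pullback C g g I ?m1 ?m2" using Barr_exact unfolding Barr_exact_def by blast
  then obtain c where c: "is_coequalizer C ?m1 ?m2 c" using regular unfolding regular_category_def by blast
  note cd = coequalizerD[OF c]
  let ?Q = "Cod C c"
  have ch: "c \<in> hom C X ?Q" using cd m12 by (auto simp: hom_def)
  \<comment> \<open>Identifying the two projections of the relation is the same as killing
    \<open>f\<close>: precomposing with the epimorphism \<open>e\<close> gives \<open>[f, 1]\<close>
    and \<open>[0, 1]\<close>, which differ only on the summand \<open>A\<close>.\<close>
  have eq: "u \<cdot> ?m1 = u \<cdot> ?m2 \<longleftrightarrow> u \<cdot> f = zero_arr C A T" if u: "u \<in> hom C X T" for u T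
  proof -
    have "u \<cdot> ?m1 = u \<cdot> ?m2 \<longleftrightarrow> (u \<cdot> ?m1) \<cdot> e = (u \<cdot> ?m2) \<cdot> e"
    proof
      assume "(u \<cdot> ?m1) \<cdot> e = (u \<cdot> ?m2) \<cdot> e"
      then show "u \<cdot> ?m1 = u \<cdot> ?m2"
        by (rule epi_cancel[OF regular_epi_is_epi[OF m(1)]]) (use m(3,4) u o in \<open>auto simp: hom_def\<close>)
    qed simp
    also have "\<dots> \<longleftrightarrow> u \<cdot> ?r = u \<cdot> ?s"
      using u m(3) m12 by (simp add: hom_def me del: comp_assoc) (simp add: Comp_assoc[unfolded hom_def] me)
    also have "\<dots> \<longleftrightarrow> u \<cdot> f = zero_arr C A T"
    proof
      assume "u \<cdot> ?r = u \<cdot> ?s"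
      then have "(u \<cdot> ?r) \<cdot> in1 C A X = (u \<cdot> ?s) \<cdot> in1 C A X" by simp
      then show "u \<cdot> f = zero_arr C A T" using u o fa by (simp add: hom_def)
    next
      assume "u \<cdot> f = zero_arr C A T"
      then show "u \<cdot> ?r = u \<cdot> ?s" using u o fa by (simp add: hom_def comp_copair)
    qed
    finally show ?thesis .
  qed
  have "is_cokernel C f c"
  proof (rule is_cokernelI[OF assms ch])
    show "c \<cdot> f = zero_arr C A ?Q" using eq[OF ch] cd(7) by blast
    fix T u assume u: "u \<in> hom C X T" "u \<cdot> f = zero_arr C A T"
    then have "u \<cdot> ?m1 = u \<cdot> ?m2" using eq by blast
    moreover have "u \<in> hom C (Cod C ?m1) T" using u m12 by (auto simp: hom_def)
    ultimately show "\<exists>!h. h \<in> hom C ?Q T \<and> h \<cdot> c = u"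
      using c unfolding is_coequalizer_def by blast
  qed
  then show ?thesis by blast
qed

text \<open>The comparison arrow from \<open>A\<close> to the pullback of \<open>g\<close> and \<open>a'\<close> is a regular epimorphism, and
  \<open>v\<close> is a pullback of it.\<close>

lemma point_kernel_regular_epi:
  assumes "is_point C B A a s" "is_point C B' A' a' s'" "is_regular_epi C h" "h \<in> hom C A A'"
    "g \<in> hom C B B'" "a' \<cdot> h = g \<cdot> a" "h \<cdot> s = s' \<cdot> g"
    "is_kernel C a k" "is_kernel C a' k'" "v \<in> hom C (Dom C k) (Dom C k')" "k' \<cdot> v = h \<cdot> k"
  shows "is_regular_epi C v"
proof -
  have ah: "a \<in> hom C A B" "s \<in> hom C B A" "a' \<in> hom C A' B'" "s' \<in> hom C B' A'"
    and as: "a \<cdot> s = Ident C B" "a' \<cdot> s' = Ident C B'"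
    using assms(1,2) by (auto simp: is_point_def)
  have o: "A \<in> Obj C" "A' \<in> Obj C" "B \<in> Obj C" "B' \<in> Obj C" using ah hom_obj by blast+
  have dm: "Dom C g = B" "Dom C a' = A'" "Dom C h = A" "Dom C a = A"
    using assms(4,5) ah by (auto simp: hom_def)
  obtain P p1 p2 where P: "is_pullback C g a' P p1 p2" "p1 \<in> hom C P B" "p2 \<in> hom C P A'" "g \<cdot> p1 = a' \<cdot> p2"
    using pullback_exists[OF assms(5) ah(3)] by metis
  obtain c where c: "c \<in> hom C A P" "p1 \<cdot> c = a" "p2 \<cdot> c = h"
    using pullback_lift[OF P(1) assms(6)[symmetric], unfolded dm, OF ah(1) assms(4)] by metis
  have creg: "is_regular_epi C c"
  proof (rule extremal_regular_epi[OF c(1)])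
    fix J j l assume j: "is_mono C j" "j \<in> hom C J P" "l \<in> hom C A J" "j \<cdot> l = c"
    obtain R r1 r2 where R: "is_pullback C g g R r1 r2" "r1 \<in> hom C R B" "r2 \<in> hom C R B" "g \<cdot> r1 = g \<cdot> r2"
      using pullback_exists[OF assms(5,5)] by metis
    have IB: "Ident C B \<in> hom C B B" using o by (simp add: hom_def)
    obtain d where d: "d \<in> hom C B R" "r1 \<cdot> d = Ident C B" "r2 \<cdot> d = Ident C B"
      using pullback_lift[OF R(1) refl, unfolded dm, OF IB IB] by metis
    \<comment> \<open>In elements, \<open>T\<close> consists of an \<open>x\<close> in
      \<open>A\<close> and a pair \<open>(b, b')\<close> in \<open>R\<close> with
      \<open>a x = b\<close>; \<open>q\<close> below sends this to \<open>(b', h x)\<close>. As a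
      pullback of \<open>h\<close>, \<open>q\<close> is a regular epimorphism. \<open>T\<close> is
      generated by the elements with \<open>b = b'\<close> and those with \<open>x = s b\<close>. On
      the former \<open>q\<close> is \<open>c x\<close>, on the latter it is
      \<open>c (s b')\<close>, so \<open>q\<close> factors through \<open>J\<close>.\<close>
    obtain T x y where T: "is_pullback C a r1 T x y" "x \<in> hom C T A" "y \<in> hom C T R" "a \<cdot> x = r1 \<cdot> y"
      using pullback_exists[OF ah(1) R(2)] by metis
    have ptR: "is_point C B R r1 d" using d R by (simp add: is_point_def)
    obtain u w where uw: "jointly_extremal C u w" "u \<in> hom C A T" "x \<cdot> u = Ident C A" "y \<cdot> u = d \<cdot> a"
      "w \<in> hom C R T" "x \<cdot> w = s \<cdot> r1" "y \<cdot> w = Ident C R"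
      using split_pullback_extremal[OF assms(1) ptR T(1)] by metis
    note t = ah assms(4,5) P(2,3) c(1) R(2,3) d(1) T(2,3) uw(2,5)
    have "g \<cdot> (r2 \<cdot> y) = g \<cdot> (r1 \<cdot> y)"
      using t by (simp add: hom_def comp_reassoc[OF R(4)])
    also have "\<dots> = g \<cdot> (a \<cdot> x)" using T(4) by simp
    also have "\<dots> = a' \<cdot> (h \<cdot> x)" using t by (simp add: hom_def comp_reassoc[OF assms(6)])
    finally have gy: "g \<cdot> (r2 \<cdot> y) = a' \<cdot> (h \<cdot> x)" .
    have gyh: "r2 \<cdot> y \<in> hom C T B" "h \<cdot> x \<in> hom C T A'" using t by (simp_all add: hom_def)
    obtain q where q: "q \<in> hom C T P" "p1 \<cdot> q = r2 \<cdot> y" "p2 \<cdot> q = h \<cdot> x"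
      using pullback_lift[OF P(1) gy, unfolded dm, OF gyh] by metis
    have "is_pullback C p2 h T q x"
    proof (rule is_pullbackI[OF P(3) assms(4) q(1) T(2) q(3)])
      fix S i b assume ib: "i \<in> hom C S P" "b \<in> hom C S A" "p2 \<cdot> i = h \<cdot> b"
      have "g \<cdot> (a \<cdot> b) = a' \<cdot> (h \<cdot> b)"
        using t ib(1,2) by (simp add: hom_def comp_reassoc[OF assms(6)])
      also have "\<dots> = a' \<cdot> (p2 \<cdot> i)" using ib by simp
      also have "\<dots> = g \<cdot> (p1 \<cdot> i)" using t ib(1,2) by (simp add: hom_def comp_reassoc[OF P(4)])
      finally have "g \<cdot> (a \<cdot> b) = g \<cdot> (p1 \<cdot> i)" .
      moreover have "a \<cdot> b \<in> hom C S B" "p1 \<cdot> i \<in> hom C S B" using t ib by (simp_all add: hom_def)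
      ultimately obtain z where z: "z \<in> hom C S R" "r1 \<cdot> z = a \<cdot> b" "r2 \<cdot> z = p1 \<cdot> i"
        using pullback_lift[OF R(1), unfolded dm] by metis
      obtain n where n: "n \<in> hom C S T" "x \<cdot> n = b" "y \<cdot> n = z"
        using pullback_lift[OF T(1) z(2)[symmetric], unfolded dm, OF ib(2)] z(1) R(2) by (auto simp: hom_def)
      have "q \<cdot> n = i"
        by (rule pullback_ext[OF P(1), of _ _ S])
          (use t n(1) q(1) ib(1) z(1) in \<open>simp_all add: hom_def comp_reassoc[OF q(2)] comp_reassoc[OF q(3)] n(2,3) z(3) ib(3)\<close>)
      with n show "\<exists>n \<in> hom C S T. q \<cdot> n = i \<and> x \<cdot> n = b" by blast
    next
      fix S i b assume ib: "i \<in> hom C S T" "b \<in> hom C S T" "q \<cdot> i = q \<cdot> b" "x \<cdot> i = x \<cdot> b"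
      have "r1 \<cdot> (y \<cdot> i) = r1 \<cdot> (y \<cdot> b)"
        using t ib by (simp add: hom_def comp_reassoc[OF T(4)[symmetric]])
      moreover have "r2 \<cdot> (y \<cdot> i) = r2 \<cdot> (y \<cdot> b)"
        using t ib q(1) comp_reassoc[OF q(2)[symmetric], of i] comp_reassoc[OF q(2)[symmetric], of b]
        by (simp add: hom_def)
      ultimately have "y \<cdot> i = y \<cdot> b"
        using pullback_ext[OF R(1)] Comp_in_hom[OF ib(1) T(3)] Comp_in_hom[OF ib(2) T(3)] by metis
      then show "i = b" using pullback_ext[OF T(1) ib(4)] ib by blast
    qed
    then have qreg: "is_regular_epi C q" using regular_epi_pullback assms(3) by blast
    have cd: "Cod C u = T" "Dom C u = A" "Dom C w = R" using uw by (auto simp: hom_def)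
    have qu: "j \<cdot> l = q \<cdot> u" unfolding j(4)
      by (rule pullback_ext[OF P(1), of _ _ A])
        (use t q(1) in \<open>simp_all add: hom_def comp_reassoc[OF q(2)] comp_reassoc[OF q(3)] uw(3,4) c(2,3) comp_reassoc[OF d(3)]\<close>)
    have lsr: "l \<cdot> (s \<cdot> r2) \<in> hom C R J" using j t by (simp add: hom_def)
    have "c \<cdot> (s \<cdot> r2) = q \<cdot> w"
    proof (rule pullback_ext[OF P(1), of _ _ R])
      show "p1 \<cdot> (c \<cdot> (s \<cdot> r2)) = p1 \<cdot> (q \<cdot> w)"
        using t q(1) by (simp add: hom_def comp_reassoc[OF q(2)] comp_reassoc[OF c(2)] comp_reassoc[OF as(1)] uw(7))
      have "p2 \<cdot> (c \<cdot> (s \<cdot> r2)) = s' \<cdot> (g \<cdot> r2)"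
        using t by (simp add: hom_def comp_reassoc[OF c(3)] comp_reassoc[OF assms(7)])
      also have "\<dots> = s' \<cdot> (g \<cdot> r1)" using R(4) by simp
      also have "\<dots> = p2 \<cdot> (q \<cdot> w)"
        using t q(1) by (simp add: hom_def comp_reassoc[OF q(3)] uw(6) comp_reassoc[OF assms(7)])
      finally show "p2 \<cdot> (c \<cdot> (s \<cdot> r2)) = p2 \<cdot> (q \<cdot> w)" .
    qed (use t q(1) in \<open>simp_all add: hom_def\<close>)
    then have qw: "j \<cdot> (l \<cdot> (s \<cdot> r2)) = q \<cdot> w"
      using t j(2,3) by (simp add: hom_def comp_reassoc[OF j(4)])
    obtain n where n: "n \<in> hom C T J" "j \<cdot> n = q"
      by (rule jointly_extremal_factor[OF uw(1) j(1,2), unfolded cd, OF q(1) j(3) lsr qu qw])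
    show "is_iso C j"
      by (rule regular_epi_mono_is_iso[OF qreg j(1,2) _ n(2)]) (use n q in \<open>simp add: hom_def\<close>)
  qed
  note k = kernelD[OF assms(8)] and k' = kernelD[OF assms(9)]
  let ?K = "Dom C k" and ?K' = "Dom C k'"
  have kh: "k \<in> hom C ?K A" "k' \<in> hom C ?K' A'" using k k' ah by (auto simp: hom_def)
  have "g \<cdot> zero_arr C ?K' B = a' \<cdot> k'" "zero_arr C ?K' B \<in> hom C ?K' B"
    using k' assms(5) ah o by (auto simp: hom_def)
  \<comment> \<open>\<open>n\<close> is \<open>(0, k')\<close>; pulling \<open>c\<close> back along
    it leaves the elements of \<open>A\<close> over zero, that is, the kernel of
    \<open>a\<close>.\<close>
  then obtain n where n: "n \<in> hom C ?K' P" "p1 \<cdot> n = zero_arr C ?K' B" "p2 \<cdot> n = k'"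
    using pullback_lift[OF P(1), unfolded dm] kh by metis
  note t = ah assms(4,5) P(2,3) c(1) kh n(1) assms(10)
  have "is_pullback C n c ?K v k"
  proof (rule is_pullbackI[OF n(1) c(1) assms(10) kh(1)])
    show "n \<cdot> v = c \<cdot> k"
      by (rule pullback_ext[OF P(1), of _ _ ?K])
        (use t k o in \<open>simp_all add: hom_def comp_reassoc[OF n(2)] comp_reassoc[OF n(3)] assms(11)
          comp_reassoc[OF c(2)] comp_reassoc[OF c(3)]\<close>)
    fix S x y assume xy: "x \<in> hom C S ?K'" "y \<in> hom C S A" "n \<cdot> x = c \<cdot> y"
    have "a \<cdot> y = p1 \<cdot> (n \<cdot> x)" unfolding xy(3) using t xy by (simp add: hom_def comp_reassoc[OF c(2)])
    also have "\<dots> = zero_arr C S (Cod C a)" using t xy(1) o by (simp add: hom_def comp_reassoc[OF n(2)])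
    finally obtain z where z: "z \<in> hom C S ?K" "k \<cdot> z = y"
      using kernel_lift[OF assms(8), unfolded dm] xy(2) by metis
    have "k' \<cdot> (v \<cdot> z) = p2 \<cdot> (n \<cdot> x)"
      unfolding xy(3) using t xy(1,2) z(1) by (simp add: hom_def comp_reassoc[OF c(3)] comp_reassoc[OF assms(11)] z(2))
    also have "\<dots> = k' \<cdot> x" using t xy(1) by (simp add: hom_def comp_reassoc[OF n(3)])
    finally have "v \<cdot> z = x"
      by (rule mono_cancel[OF k'(5)]) (use t z(1) xy(1) in \<open>auto simp: hom_def\<close>)
    with z show "\<exists>z \<in> hom C S ?K. v \<cdot> z = x \<and> k \<cdot> z = y" by blast
  next
    fix S x y assume "x \<in> hom C S ?K" "y \<in> hom C S ?K" "k \<cdot> x = k \<cdot> y"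
    then show "x = y" using mono_cancel[OF k(5)] by (auto simp: hom_def)
  qed
  then show ?thesis using regular_epi_pullback creg by blast
qed

end

section \<open>Joint kernels of commuting idempotents\<close>

text \<open>The conditions are endomorphisms of \<open>W\<close> rather than retractions onto
  varying summands, so that a single induction serves binary and ternary cosmash products
  alike.\<close>

definition is_joint_kernel :: "('o, 'm) cat \<Rightarrow> 'o \<Rightarrow> 'm set \<Rightarrow> 'm \<Rightarrow> bool" where
  "is_joint_kernel C W E k \<longleftrightarrow> is_mono C k \<and> Cod C k = W \<and>
     (\<forall>e \<in> E. e \<cdot>\<^bsub>C\<^esub> k = zero_arr C (Dom C k) W) \<and>
     (\<forall>T. \<forall>u \<in> hom C T W. (\<forall>e \<in> E. e \<cdot>\<^bsub>C\<^esub> u = zero_arr C T W) \<longrightarrow>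
        (\<exists>h \<in> hom C T (Dom C k). k \<cdot>\<^bsub>C\<^esub> h = u))"

context pointed_category
begin

lemma joint_kernelD:
  assumes "is_joint_kernel C W E k"
  shows "is_mono C k" "k \<in> Arr C" "Cod C k = W" "\<And>e. e \<in> E \<Longrightarrow> e \<cdot> k = zero_arr C (Dom C k) W"
  using assms is_mono_arr by (auto simp: is_joint_kernel_def)

lemma joint_kernel_lift:
  assumes "is_joint_kernel C W E k" "u \<in> hom C T W" "\<And>e. e \<in> E \<Longrightarrow> e \<cdot> u = zero_arr C T W"
  shows "\<exists>h \<in> hom C T (Dom C k). k \<cdot> h = u"
  using assms unfolding is_joint_kernel_def by blast

lemma joint_kernel_empty: "W \<in> Obj C \<Longrightarrow> is_joint_kernel C W {} (Ident C W)"
  using is_monoI[of "Ident C W" W W] by (auto simp: is_joint_kernel_def hom_def)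

text \<open>Because \<open>e\<close> commutes with the other idempotents, it maps their joint kernel
  into itself. The kernel of its restriction \<open>t\<close> is then the joint kernel with
  \<open>e\<close> added.\<close>

lemma joint_kernel_restrict:
  assumes "is_joint_kernel C W E k" "E \<subseteq> hom C W W" "e \<in> hom C W W" "e \<cdot> e = e"
    "\<And>f. f \<in> E \<Longrightarrow> e \<cdot> f = f \<cdot> e"
  obtains t where "t \<in> hom C (Dom C k) (Dom C k)" "k \<cdot> t = e \<cdot> k" "t \<cdot> t = t"
proof -
  note k = joint_kernelD[OF assms(1)]
  let ?K = "Dom C k"
  have W: "W \<in> Obj C" using k by auto
  have "f \<cdot> (e \<cdot> k) = zero_arr C ?K W" if f: "f \<in> E" for f
  proof -
    have fh: "f \<in> hom C W W" using assms(2) f by blast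
    have "f \<cdot> (e \<cdot> k) = e \<cdot> (f \<cdot> k)"
      using fh k(2,3) assms(3) by (simp add: hom_def comp_reassoc[OF assms(5)[OF f]])
    then show ?thesis using k(2,3) k(4)[OF f] assms(3) by (simp add: hom_def)
  qed
  moreover have "e \<cdot> k \<in> hom C ?K W" using k assms(3) by (simp add: hom_def)
  ultimately obtain t where t: "t \<in> hom C ?K ?K" "k \<cdot> t = e \<cdot> k"
    using joint_kernel_lift[OF assms(1)] by blast
  have "k \<cdot> (t \<cdot> t) = k \<cdot> t"
    using t(1) k(2,3) assms(3) by (simp add: hom_def comp_reassoc[OF t(2)] t(2) comp_reassoc[OF assms(4)])
  then have "t \<cdot> t = t" by (rule mono_cancel[OF k(1)]) (use t in \<open>auto simp: hom_def\<close>)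
  with t that show thesis by blast
qed

lemma joint_kernel_insert:
  assumes "is_joint_kernel C W E k" "E \<subseteq> hom C W W" "e \<in> hom C W W"
    "t \<in> hom C (Dom C k) (Dom C k)" "k \<cdot> t = e \<cdot> k" "is_kernel C t j"
  shows "is_joint_kernel C W (insert e E) (k \<cdot> j)"
proof -
  note k = joint_kernelD[OF assms(1)] and j = kernelD[OF assms(6)]
  have W: "W \<in> Obj C" using k by auto
  have d: "Dom C t = Dom C k" "Cod C t = Dom C k" using assms(4) by (auto simp: hom_def)
  have "f \<cdot> (k \<cdot> j) = zero_arr C (Dom C j) W" if "f \<in> insert e E" for f
  proof (cases "f = e")
    case True
    have "e \<cdot> (k \<cdot> j) = k \<cdot> (t \<cdot> j)"
      using k(2,3) j(1-3) d assms(3,4) by (simp add: hom_def comp_reassoc[OF assms(5)[symmetric]])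
    then show ?thesis using True j k(2,3) d by simp
  next
    case False
    then have f: "f \<in> E" using that by simp
    then have "f \<in> hom C W W" using assms(2) by blast
    then show ?thesis using k(2,3) j d W by (simp add: hom_def comp_reassoc[OF k(4)[OF f]])
  qed
  moreover have "\<exists>h \<in> hom C T (Dom C j). (k \<cdot> j) \<cdot> h = u"
    if u: "u \<in> hom C T W" "\<And>f. f \<in> insert e E \<Longrightarrow> f \<cdot> u = zero_arr C T W" for T u
  proof -
    have T: "T \<in> Obj C" using u hom_obj by blast
    obtain x where x: "x \<in> hom C T (Dom C k)" "k \<cdot> x = u"
      using joint_kernel_lift[OF assms(1) u(1)] u(2) by blast
    have "k \<cdot> (t \<cdot> x) = e \<cdot> u"
      using x(1) k(2,3) assms(3,4) by (simp add: hom_def comp_reassoc[OF assms(5)] x(2))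
    then have "k \<cdot> (t \<cdot> x) = k \<cdot> zero_arr C T (Dom C k)" using u(2)[of e] k(2,3) T by simp
    then have "t \<cdot> x = zero_arr C T (Cod C t)" unfolding d
      by (rule mono_cancel[OF k(1)]) (use x assms(4) k T in \<open>auto simp: hom_def\<close>)
    then obtain h where "h \<in> hom C T (Dom C j)" "j \<cdot> h = x"
      using kernel_lift[OF assms(6), unfolded d] x(1) d by metis
    then show ?thesis using k(2) j d x by (intro bexI[of _ h]) (auto simp: hom_def)
  qed
  moreover have "is_mono C (k \<cdot> j)" "Cod C (k \<cdot> j) = W" "Dom C (k \<cdot> j) = Dom C j"
    using is_mono_comp[OF k(1) j(5)] k(2,3) j(2,3) d by simp_all
  ultimately show ?thesis unfolding is_joint_kernel_def by metis
qed

end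

context semi_abelian_category
begin

text \<open>The image factorisation is the splitting: in
  \<open>m \<cdot> q \<cdot> m \<cdot> q = m \<cdot> q\<close> cancel \<open>m\<close> on the left
  and \<open>q\<close> on the right.\<close>

lemma idempotent_splits:
  assumes "t \<in> hom C K K" "t \<cdot> t = t"
  obtains L q m where "q \<in> hom C K L" "m \<in> hom C L K" "m \<cdot> q = t" "q \<cdot> m = Ident C L"
proof -
  obtain L m q where m: "is_regular_epi C q" "is_mono C m" "q \<in> hom C K L" "m \<in> hom C L K" "m \<cdot> q = t"
    using image_factorization[OF assms(1)] by metis
  have L: "L \<in> Obj C" using m hom_obj by blast
  have "m \<cdot> ((q \<cdot> m) \<cdot> q) = m \<cdot> q"
    using m(3,4) assms(1) comp_reassoc[OF m(5), of t] assms(2) by (simp add: hom_def m(5))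
  then have "(q \<cdot> m) \<cdot> q = q"
    by (rule mono_cancel[OF m(2)]) (use m in \<open>auto simp: hom_def\<close>)
  then have "(q \<cdot> m) \<cdot> q = Ident C L \<cdot> q" using m by (simp add: hom_def)
  then have "q \<cdot> m = Ident C L"
    by (rule epi_cancel[OF regular_epi_is_epi[OF m(1)]]) (use m L in \<open>auto simp: hom_def\<close>)
  with m that show thesis by blast
qed

lemma kernel_split_mono_comp:
  assumes "q \<in> hom C K L" "m \<in> hom C L K" "q \<cdot> m = Ident C L" "is_kernel C (m \<cdot> q) j"
  shows "is_kernel C q j"
proof -
  note j = kernelD[OF assms(4)]
  have L: "L \<in> Obj C" "K \<in> Obj C" using assms hom_obj by blast+
  have d: "Cod C j = K" using j assms by (simp add: hom_def)
  have mq: "(m \<cdot> q) \<in> hom C K K" using assms Comp_in_hom by blast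
  have eq: "q \<cdot> ((m \<cdot> q) \<cdot> u) = q \<cdot> u" if "u \<in> hom C T K" for u T
    using that assms(1,2) by (simp add: hom_def comp_reassoc[OF assms(3)])
  show ?thesis
  proof (rule is_kernelI[OF assms(1)])
    show "j \<in> hom C (Dom C j) K" using j d by (simp add: hom_def)
    then show "q \<cdot> j = zero_arr C (Dom C j) L" using eq[of j] j assms(1) mq by (simp add: hom_def)
    show "is_mono C j" by (rule j(5))
    fix T u assume u: "u \<in> hom C T K" "q \<cdot> u = zero_arr C T L"
    have T: "T \<in> Obj C" using u hom_obj by blast
    have "(m \<cdot> q) \<cdot> u = zero_arr C T K" using u T assms(1,2) by (simp add: hom_def)
    then show "\<exists>h \<in> hom C T (Dom C j). j \<cdot> h = u"
      using kernel_lift[OF assms(4)] u mq by (simp add: hom_def) metis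
  qed
qed

text \<open>A splitting \<open>m \<cdot> q\<close> of an idempotent is a point with the same kernel
  as the idempotent. The arrow \<open>v\<close> induces \<open>q' \<cdot> v \<cdot> m\<close>
  between the bases, which reduces the claim to the kernels of points.\<close>

lemma idempotent_kernel_regular_epi:
  assumes "t \<in> hom C K K" "t \<cdot> t = t" "t' \<in> hom C K' K'" "t' \<cdot> t' = t'"
    "is_regular_epi C v" "v \<in> hom C K K'" "t' \<cdot> v = v \<cdot> t" "is_kernel C t j" "is_kernel C t' j'"
    "w \<in> hom C (Dom C j) (Dom C j')" "j' \<cdot> w = v \<cdot> j"
  shows "is_regular_epi C w"
proof -
  obtain L q m where s: "q \<in> hom C K L" "m \<in> hom C L K" "m \<cdot> q = t" "q \<cdot> m = Ident C L"
    using idempotent_splits[OF assms(1,2)] .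
  obtain L' q' m' where s': "q' \<in> hom C K' L'" "m' \<in> hom C L' K'" "m' \<cdot> q' = t'" "q' \<cdot> m' = Ident C L'"
    using idempotent_splits[OF assms(3,4)] .
  note h = s(1,2) s'(1,2) assms(1,3,6)
  have g: "q' \<cdot> (v \<cdot> m) \<in> hom C L L'" using h by (simp add: hom_def)
  have "q' \<cdot> (m' \<cdot> (q' \<cdot> v)) = q' \<cdot> (v \<cdot> (m \<cdot> q))"
    using h by (simp add: hom_def comp_reassoc[OF s'(3)] assms(7) s(3))
  then have a: "q' \<cdot> v = (q' \<cdot> (v \<cdot> m)) \<cdot> q" using h by (simp add: hom_def comp_reassoc[OF s'(4)])
  have "m' \<cdot> (q' \<cdot> (v \<cdot> m)) = v \<cdot> (m \<cdot> (q \<cdot> m))"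
    using h by (simp add: hom_def comp_reassoc[OF s'(3)] comp_reassoc[OF assms(7)] comp_reassoc[OF s(3)] del: s(4))
  then have b: "v \<cdot> m = m' \<cdot> (q' \<cdot> (v \<cdot> m))" using h by (simp add: hom_def s(4))
  have kk: "is_kernel C q j" "is_kernel C q' j'"
    using kernel_split_mono_comp s s' assms(8,9) by metis+
  show ?thesis
    by (rule point_kernel_regular_epi[OF _ _ assms(5,6) g a b kk assms(10,11)])
      (use s s' in \<open>simp_all add: is_point_def\<close>)
qed

text \<open>The list pairs each idempotent of \<open>W\<close> with its counterpart on
  \<open>W'\<close>, so that both joint kernels grow in step. At each stage the new idempotents
  restrict to the joint kernels reached so far, and the regular epimorphism between these
  intertwines the restrictions.\<close>

lemma idempotents_joint_kernel_regular_epi: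
  fixes es :: "('m \<times> 'm) list"
  assumes "is_regular_epi C F" "F \<in> hom C W W'"
    and "\<And>e e'. (e, e') \<in> set es \<Longrightarrow> e \<in> hom C W W \<and> e' \<in> hom C W' W' \<and>
           e \<cdot> e = e \<and> e' \<cdot> e' = e' \<and> e' \<cdot> F = F \<cdot> e"
    and "\<And>e e' f f'. \<lbrakk>(e, e') \<in> set es; (f, f') \<in> set es\<rbrakk> \<Longrightarrow> e \<cdot> f = f \<cdot> e \<and> e' \<cdot> f' = f' \<cdot> e'"
  shows "\<exists>k k' v. is_joint_kernel C W (fst ` set es) k \<and> is_joint_kernel C W' (snd ` set es) k' \<and>
    v \<in> hom C (Dom C k) (Dom C k') \<and> is_regular_epi C v \<and> k' \<cdot> v = F \<cdot> k"
  using assms(3,4)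
proof (induction es)
  case Nil
  have o: "W \<in> Obj C" "W' \<in> Obj C" using assms(2) hom_obj by blast+
  show ?case
    by (intro exI[of _ "Ident C W"] exI[of _ "Ident C W'"] exI[of _ F])
      (use joint_kernel_empty o assms(1,2) in \<open>auto simp: hom_def\<close>)
next
  case (Cons ee es)
  obtain e e' where ee: "ee = (e, e')" by (cases ee)
  let ?E = "fst ` set es" and ?E' = "snd ` set es"
  obtain k k' v where IH: "is_joint_kernel C W ?E k" "is_joint_kernel C W' ?E' k'"
    "v \<in> hom C (Dom C k) (Dom C k')" "is_regular_epi C v" "k' \<cdot> v = F \<cdot> k"
    using Cons.IH Cons.prems by (metis list.set_intros(2))
  have E: "?E \<subseteq> hom C W W" "?E' \<subseteq> hom C W' W'" using Cons.prems(1) by fastforce+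
  have e: "e \<in> hom C W W" "e' \<in> hom C W' W'" "e \<cdot> e = e" "e' \<cdot> e' = e'" "e' \<cdot> F = F \<cdot> e"
    using Cons.prems(1)[of e e'] ee by auto
  have c: "\<And>f. f \<in> ?E \<Longrightarrow> e \<cdot> f = f \<cdot> e" "\<And>f. f \<in> ?E' \<Longrightarrow> e' \<cdot> f = f \<cdot> e'"
  proof -
    fix f assume "f \<in> ?E"
    then obtain f' where "(f, f') \<in> set es" by auto
    then show "e \<cdot> f = f \<cdot> e" using Cons.prems(2)[of e e' f f'] ee list.set_intros by metis
  next
    fix f' assume "f' \<in> ?E'"
    then obtain f where "(f, f') \<in> set es" by auto
    then show "e' \<cdot> f' = f' \<cdot> e'" using Cons.prems(2)[of e e' f f'] ee list.set_intros by metis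
  qed
  obtain t where t: "t \<in> hom C (Dom C k) (Dom C k)" "k \<cdot> t = e \<cdot> k" "t \<cdot> t = t"
    using joint_kernel_restrict[OF IH(1) E(1) e(1,3) c(1)] by metis
  obtain t' where t': "t' \<in> hom C (Dom C k') (Dom C k')" "k' \<cdot> t' = e' \<cdot> k'" "t' \<cdot> t' = t'"
    using joint_kernel_restrict[OF IH(2) E(2) e(2,4) c(2)] by metis
  note k = joint_kernelD[OF IH(1)] and k' = joint_kernelD[OF IH(2)]
  have kh: "k \<in> hom C (Dom C k) W" "k' \<in> hom C (Dom C k') W'" using k k' by (simp_all add: hom_def)
  note h = kh t(1) t'(1) e(1,2) IH(3) assms(2)
  have "k' \<cdot> (t' \<cdot> v) = F \<cdot> (e \<cdot> k)"
    using h by (simp add: hom_def comp_reassoc[OF t'(2)] IH(5) comp_reassoc[OF e(5)])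
  also have "\<dots> = k' \<cdot> (v \<cdot> t)"
    using h by (simp add: hom_def comp_reassoc[OF IH(5)] t(2))
  finally have tv: "t' \<cdot> v = v \<cdot> t"
    by (rule mono_cancel[OF k'(1)]) (use h in \<open>auto simp: hom_def\<close>)
  obtain j j' where j: "is_kernel C t j" "is_kernel C t' j'"
    using kernel_exists[of t] kernel_exists[of t'] t(1) t'(1) unfolding hom_def by blast
  note jd = kernelD[OF j(1)] and jd' = kernelD[OF j(2)]
  have jh: "j \<in> hom C (Dom C j) (Dom C k)" "j' \<in> hom C (Dom C j') (Dom C k')"
    using jd jd' t t' by (simp_all add: hom_def)
  have "t' \<cdot> (v \<cdot> j) = zero_arr C (Dom C j) (Cod C t')"
    using h jh jd by (simp add: hom_def comp_reassoc[OF tv])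
  moreover have "v \<cdot> j \<in> hom C (Dom C j) (Dom C t')" using h jh by (simp add: hom_def)
  ultimately obtain w where w: "w \<in> hom C (Dom C j) (Dom C j')" "j' \<cdot> w = v \<cdot> j"
    using kernel_lift[OF j(2)] by metis
  have wr: "is_regular_epi C w"
    by (rule idempotent_kernel_regular_epi[OF t(1,3) t'(1,3) IH(4,3) tv j w])
  have "(k' \<cdot> j') \<cdot> w = F \<cdot> (k \<cdot> j)"
    using h jh w(1) by (simp add: hom_def w(2) comp_reassoc[OF IH(5)])
  moreover have "w \<in> hom C (Dom C (k \<cdot> j)) (Dom C (k' \<cdot> j'))" using w h jh by (simp add: hom_def)
  moreover have "is_joint_kernel C W (fst ` set (ee # es)) (k \<cdot> j)"
    "is_joint_kernel C W' (snd ` set (ee # es)) (k' \<cdot> j')"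
    using joint_kernel_insert[OF IH(1) E(1) e(1) t(1,2) j(1)] joint_kernel_insert[OF IH(2) E(2) e(2) t'(1,2) j(2)]
    by (simp_all add: ee)
  ultimately show ?case using wr by blast
qed

end

section \<open>Two-nilpotent objects\<close>

context cosmash_category
begin

lemma coprd_map_in [simp]:
  assumes "f \<in> Arr C" "g \<in> Arr C" "Dom C f = X" "Dom C g = Y"
  shows "coprd_map C f g \<cdot> in1 C X Y = in1 C (Cod C f) (Cod C g) \<cdot> f"
    "coprd_map C f g \<cdot> in2 C X Y = in2 C (Cod C f) (Cod C g) \<cdot> g"
  using assms by (auto simp: coprd_map_def)

lemma coprd_map_in_comp [simp]:
  assumes "f \<in> Arr C" "g \<in> Arr C" "Dom C f = X" "Dom C g = Y" "x \<in> Arr C"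
  shows "Cod C x = X \<Longrightarrow> coprd_map C f g \<cdot> (in1 C X Y \<cdot> x) = in1 C (Cod C f) (Cod C g) \<cdot> (f \<cdot> x)"
    "Cod C x = Y \<Longrightarrow> coprd_map C f g \<cdot> (in2 C X Y \<cdot> x) = in2 C (Cod C f) (Cod C g) \<cdot> (g \<cdot> x)"
  using assms by (auto simp: coprd_map_def)

abbreviation coprd3 where "coprd3 X Y Z \<equiv> coprd C (coprd C X Y) Z"
abbreviation ret12 where "ret12 X Y Z \<equiv> copair3 C (in1 C X Y) (in2 C X Y) (zero_arr C Z (coprd C X Y))"
abbreviation ret13 where "ret13 X Y Z \<equiv> copair3 C (in1 C X Z) (zero_arr C Y (coprd C X Z)) (in2 C X Z)"
abbreviation ret23 where "ret23 X Y Z \<equiv> copair3 C (zero_arr C X (coprd C Y Z)) (in1 C Y Z) (in2 C Y Z)"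

text \<open>The condition for a generalised element \<open>u\<close> of the triple sum to lie in the
  ternary cosmash product; arguments phrased with it avoid the chosen kernel.\<close>

abbreviation killed_by_rets where
  "killed_by_rets X Y Z T u \<equiv> u \<in> hom C T (coprd3 X Y Z) \<and>
     ret12 X Y Z \<cdot> u = zero_arr C T (coprd C X Y) \<and>
     ret13 X Y Z \<cdot> u = zero_arr C T (coprd C X Z) \<and>
     ret23 X Y Z \<cdot> u = zero_arr C T (coprd C Y Z)"

lemma cosmash3_arr_kernel:
  assumes "X \<in> Obj C" "Y \<in> Obj C" "Z \<in> Obj C"
  shows "is_kernel C (pair C (pair C (ret12 X Y Z) (ret13 X Y Z)) (ret23 X Y Z)) (cosmash3_arr C X Y Z)"
  unfolding cosmash3_arr_def by (rule ker_is_kernel) (use assms in \<open>simp add: copair3_def\<close>)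

lemma killed_by_rets_iff:
  assumes "X \<in> Obj C" "Y \<in> Obj C" "Z \<in> Obj C" "u \<in> hom C T (coprd3 X Y Z)"
  shows "killed_by_rets X Y Z T u \<longleftrightarrow>
    pair C (pair C (ret12 X Y Z) (ret13 X Y Z)) (ret23 X Y Z) \<cdot> u =
    zero_arr C T (prd C (prd C (coprd C X Y) (coprd C X Z)) (coprd C Y Z))"
proof -
  have h: "ret12 X Y Z \<cdot> u \<in> hom C T (coprd C X Y)" "ret13 X Y Z \<cdot> u \<in> hom C T (coprd C X Z)"
    "ret23 X Y Z \<cdot> u \<in> hom C T (coprd C Y Z)"
    using assms by (simp_all add: copair3_def hom_def)
  then have h': "pair C (ret12 X Y Z \<cdot> u) (ret13 X Y Z \<cdot> u) \<in> hom C T (prd C (coprd C X Y) (coprd C X Z))"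
    by (simp add: hom_def)
  have "pair C (pair C (ret12 X Y Z) (ret13 X Y Z)) (ret23 X Y Z) \<cdot> u =
     pair C (pair C (ret12 X Y Z \<cdot> u) (ret13 X Y Z \<cdot> u)) (ret23 X Y Z \<cdot> u)"
    using assms by (simp add: copair3_def hom_def pair_comp)
  then show ?thesis using pair_eq_zero_iff[OF h(1,2)] pair_eq_zero_iff[OF h' h(3)] assms(4) by simp
qed

lemma cosmash3_arr_killed:
  assumes "X \<in> Obj C" "Y \<in> Obj C" "Z \<in> Obj C"
  shows "killed_by_rets X Y Z (Dom C (cosmash3_arr C X Y Z)) (cosmash3_arr C X Y Z)"
proof -
  note k = kernelD[OF cosmash3_arr_kernel[OF assms]]
  have "cosmash3_arr C X Y Z \<in> hom C (Dom C (cosmash3_arr C X Y Z)) (coprd3 X Y Z)"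
    using k(2,3) assms by (simp add: copair3_def hom_def)
  then show ?thesis using killed_by_rets_iff[OF assms] k(4) assms by (simp add: copair3_def)
qed

lemma cosmash3_lift:
  assumes "X \<in> Obj C" "Y \<in> Obj C" "Z \<in> Obj C" "killed_by_rets X Y Z T u"
  obtains h where "h \<in> hom C T (Dom C (cosmash3_arr C X Y Z))" "cosmash3_arr C X Y Z \<cdot> h = u"
proof -
  have u: "u \<in> hom C T (coprd3 X Y Z)" using assms(4) by blast
  let ?p = "pair C (pair C (ret12 X Y Z) (ret13 X Y Z)) (ret23 X Y Z)"
  have d: "Dom C ?p = coprd3 X Y Z"
    "Cod C ?p = prd C (prd C (coprd C X Y) (coprd C X Z)) (coprd C Y Z)"
    using assms(1-3) by (simp_all add: copair3_def)
  show thesis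
    using kernel_lift[OF cosmash3_arr_kernel[OF assms(1-3)], unfolded d, of u T]
      killed_by_rets_iff[OF assms(1-3) u] assms(4) that by blast
qed

lemma killed_by_rets_coprd_map:
  assumes "killed_by_rets X Y Z T u" "f \<in> hom C X X'" "g \<in> hom C Y Y'" "h \<in> hom C Z Z'"
  shows "killed_by_rets X' Y' Z' T (coprd_map C (coprd_map C f g) h \<cdot> u)"
proof -
  let ?M = "coprd_map C (coprd_map C f g) h"
  have o: "X \<in> Obj C" "Y \<in> Obj C" "Z \<in> Obj C" "X' \<in> Obj C" "Y' \<in> Obj C" "Z' \<in> Obj C" "T \<in> Obj C"
    using assms hom_obj by blast+
  have d: "f \<in> Arr C" "g \<in> Arr C" "h \<in> Arr C" "Dom C f = X" "Dom C g = Y" "Dom C h = Z"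
    "Cod C f = X'" "Cod C g = Y'" "Cod C h = Z'" "u \<in> Arr C" "Dom C u = T" "Cod C u = coprd3 X Y Z"
    using assms by (auto simp: hom_def)
  have "ret12 X' Y' Z' \<cdot> ?M = coprd_map C f g \<cdot> ret12 X Y Z"
    "ret13 X' Y' Z' \<cdot> ?M = coprd_map C f h \<cdot> ret13 X Y Z"
    "ret23 X' Y' Z' \<cdot> ?M = coprd_map C g h \<cdot> ret23 X Y Z"
    using o d by (simp_all add: copair3_def copair_coprd_map comp_copair)
  note e = this[THEN comp_reassoc]
  have "ret12 X' Y' Z' \<cdot> (?M \<cdot> u) = coprd_map C f g \<cdot> (ret12 X Y Z \<cdot> u)"
    "ret13 X' Y' Z' \<cdot> (?M \<cdot> u) = coprd_map C f h \<cdot> (ret13 X Y Z \<cdot> u)"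
    "ret23 X' Y' Z' \<cdot> (?M \<cdot> u) = coprd_map C g h \<cdot> (ret23 X Y Z \<cdot> u)"
    using o d e by (simp_all add: copair3_def)
  moreover have "?M \<cdot> u \<in> hom C T (coprd3 X' Y' Z')" using o d by (simp add: hom_def)
  ultimately show ?thesis using assms(1) o d by simp
qed

end

context semi_abelian_category
begin

abbreviation codiag3 where "codiag3 X \<equiv> copair3 C (Ident C X) (Ident C X) (Ident C X)"

lemma commutator3_image:
  assumes "X \<in> Obj C"
  obtains e where "is_regular_epi C e" "is_mono C (commutator3 C X)"
    "e \<in> hom C (Dom C (cosmash3_arr C X X X)) (Dom C (commutator3 C X))"
    "commutator3 C X \<in> hom C (Dom C (commutator3 C X)) X"
    "commutator3 C X \<cdot> e = codiag3 X \<cdot> cosmash3_arr C X X X"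
proof -
  let ?c = "cosmash3_arr C X X X" and ?f = "codiag3 X \<cdot> cosmash3_arr C X X X"
  have c: "?c \<in> hom C (Dom C ?c) (coprd3 X X X)" using cosmash3_arr_killed[OF assms assms assms] by blast
  then have f: "?f \<in> hom C (Dom C ?c) X" using assms by (simp add: hom_def copair3_def)
  then have df: "Dom C ?f = Dom C ?c" by (simp add: hom_def)
  obtain I m e where "is_regular_epi C e" "is_mono C m" "e \<in> hom C (Dom C ?c) I" "m \<in> hom C I X" "m \<cdot> e = ?f"
    using image_factorization[OF f] by metis
  then have "is_image C ?f m" unfolding is_image_def df by (auto simp: hom_def)
  then have "is_image C ?f (commutator3 C X)" unfolding commutator3_def img_def by (rule someI)
  then obtain e' where e': "is_mono C (commutator3 C X)" "is_regular_epi C e'"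
    "e' \<in> hom C (Dom C ?c) (Dom C (commutator3 C X))" "?f = commutator3 C X \<cdot> e'"
    unfolding is_image_def df by blast
  moreover have "commutator3 C X \<in> hom C (Dom C (commutator3 C X)) X"
  proof -
    have "commutator3 C X \<in> Arr C" using e'(1) by (rule is_mono_arr)
    moreover have "Cod C (commutator3 C X) = Cod C ?f" using e' calculation by (simp add: hom_def)
    ultimately show ?thesis using f by (simp add: hom_def)
  qed
  ultimately show thesis using that by metis
qed

text \<open>The regular epimorphism onto the commutator is zero exactly when the commutator is a
  zero object, and its composite with the monic part is zero exactly when it is.\<close>

lemma two_nilpotent_iff:
  assumes X: "X \<in> Obj C"
  shows "two_nilpotent C X \<longleftrightarrow>
    codiag3 X \<cdot> cosmash3_arr C X X X = zero_arr C (Dom C (cosmash3_arr C X X X)) X"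
proof -
  let ?m = "commutator3 C X"
  obtain e where e: "is_regular_epi C e" "is_mono C ?m"
    "e \<in> hom C (Dom C (cosmash3_arr C X X X)) (Dom C ?m)" "?m \<in> hom C (Dom C ?m) X"
    "?m \<cdot> e = codiag3 X \<cdot> cosmash3_arr C X X X"
    using commutator3_image[OF X] .
  have o: "Dom C ?m \<in> Obj C" "Dom C (cosmash3_arr C X X X) \<in> Obj C" using e(3) hom_obj by blast+
  show ?thesis
  proof
    assume "two_nilpotent C X"
    then have "e = zero_arr C (Dom C (cosmash3_arr C X X X)) (Dom C ?m)"
      using hom_zero_object e(3) by (auto simp: two_nilpotent_def)
    then have "?m \<cdot> e = zero_arr C (Dom C (cosmash3_arr C X X X)) X" using e(4) o by (simp add: hom_def)
    then show "codiag3 X \<cdot> cosmash3_arr C X X X = zero_arr C (Dom C (cosmash3_arr C X X X)) X"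
      using e(5) by simp
  next
    assume z: "codiag3 X \<cdot> cosmash3_arr C X X X = zero_arr C (Dom C (cosmash3_arr C X X X)) X"
    have "?m \<cdot> e = ?m \<cdot> zero_arr C (Dom C (cosmash3_arr C X X X)) (Dom C ?m)"
      unfolding e(5) z using e(4) o by (simp add: hom_def)
    then have "e = zero_arr C (Dom C (cosmash3_arr C X X X)) (Dom C ?m)"
      by (rule mono_cancel[OF e(2)]) (use e o in \<open>auto simp: hom_def\<close>)
    then have "Ident C (Dom C ?m) \<cdot> e = zero_arr C (Dom C ?m) (Dom C ?m) \<cdot> e"
      using e(3) o by (simp add: hom_def)
    then have "Ident C (Dom C ?m) = zero_arr C (Dom C ?m) (Dom C ?m)"
      by (rule epi_cancel[OF regular_epi_is_epi[OF e(1)]]) (use e o in \<open>auto simp: hom_def\<close>)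
    then show "two_nilpotent C X" using is_zero_iff_ident[OF o(1)] X by (simp add: two_nilpotent_def)
  qed
qed

lemma two_nilpotent_obj: "two_nilpotent C X \<Longrightarrow> X \<in> Obj C"
  by (simp add: two_nilpotent_def)

text \<open>The sum of \<open>f\<close>, \<open>g\<close> and \<open>h\<close> carries the ternary
  cosmash product of their sources into that of three copies of \<open>N\<close>, and followed by
  the codiagonal it is \<open>[f, g, h]\<close>. Allowing three different sources is what makes it
  applicable to \<open>A\<close>, \<open>B\<close> and \<open>K\<close>.\<close>

lemma two_nilpotentD:
  assumes "two_nilpotent C N" "killed_by_rets X Y Z T u" "f \<in> hom C X N" "g \<in> hom C Y N" "h \<in> hom C Z N"
  shows "copair3 C f g h \<cdot> u = zero_arr C T N"
proof -
  have N: "N \<in> Obj C" using assms(1) by (rule two_nilpotent_obj)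
  let ?c = "cosmash3_arr C N N N"
  have c: "?c \<in> hom C (Dom C ?c) (coprd3 N N N)" using cosmash3_arr_killed[OF N N N] by blast
  let ?M = "coprd_map C (coprd_map C f g) h"
  have d: "f \<in> Arr C" "g \<in> Arr C" "h \<in> Arr C" "Dom C f = X" "Dom C g = Y" "Dom C h = Z"
    "Cod C f = N" "Cod C g = N" "Cod C h = N" "u \<in> Arr C" "Dom C u = T" "Cod C u = coprd3 X Y Z"
    using assms(2-5) by (auto simp: hom_def)
  obtain l where l: "l \<in> hom C T (Dom C ?c)" "?c \<cdot> l = ?M \<cdot> u"
    using cosmash3_lift[OF N N N killed_by_rets_coprd_map[OF assms(2-5)]] by metis
  have "codiag3 N \<cdot> ?M = copair3 C f g h" using d N by (simp add: copair3_def copair_coprd_map)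
  note e = comp_reassoc[OF this]
  have "copair3 C f g h \<cdot> u = codiag3 N \<cdot> (?c \<cdot> l)"
    unfolding l(2) using d N e[of u] by (simp add: copair3_def)
  also have "\<dots> = (codiag3 N \<cdot> ?c) \<cdot> l" using l(1) c N by (simp add: hom_def copair3_def)
  also have "\<dots> = zero_arr C T N"
    using two_nilpotent_iff[OF N] assms(1) l(1) c N by (simp add: hom_def)
  finally show ?thesis .
qed

lemma two_nilpotentI:
  assumes "X \<in> Obj C"
    and "\<And>T u. killed_by_rets X X X T u \<Longrightarrow> codiag3 X \<cdot> u = zero_arr C T X"
  shows "two_nilpotent C X"
  using assms(2)[OF cosmash3_arr_killed[OF assms(1,1,1)]] two_nilpotent_iff[OF assms(1)] by blast

lemma comp_codiag3:
  assumes "f \<in> hom C X N" "u \<in> hom C T (coprd3 X X X)"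
  shows "f \<cdot> (codiag3 X \<cdot> u) = copair3 C f f f \<cdot> u"
proof -
  have o: "X \<in> Obj C" using assms hom_obj by blast
  have "f \<cdot> codiag3 X = copair3 C f f f" using assms(1) o by (simp add: hom_def copair3_def comp_copair)
  then show ?thesis by (rule comp_reassoc) (use assms o in \<open>auto simp: hom_def copair3_def\<close>)
qed

text \<open>The codiagonal is natural and \<open>m\<close> can be cancelled. Kernels and images
  formed in \<open>C\<close> therefore stay among the two-nilpotent objects.\<close>

lemma two_nilpotent_subobject:
  assumes "two_nilpotent C N" "is_mono C m" "m \<in> hom C X N"
  shows "two_nilpotent C X"
proof (rule two_nilpotentI)
  show X: "X \<in> Obj C" using assms hom_obj by blast
  fix T u assume u: "killed_by_rets X X X T u"
  have uh: "u \<in> hom C T (coprd3 X X X)" using u by blast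
  have "m \<cdot> (codiag3 X \<cdot> u) = m \<cdot> zero_arr C T X"
    using comp_codiag3[OF assms(3) uh] two_nilpotentD[OF assms(1) u assms(3,3,3)] assms(3) hom_obj[OF uh]
    by (simp add: hom_def)
  then show "codiag3 X \<cdot> u = zero_arr C T X"
    by (rule mono_cancel[OF assms(2)]) (use assms(3) uh X hom_obj[OF uh] in \<open>auto simp: hom_def copair3_def\<close>)
qed

lemma two_nilpotent_prd:
  assumes "two_nilpotent C X" "two_nilpotent C Y"
  shows "two_nilpotent C (prd C X Y)"
proof (rule two_nilpotentI)
  let ?P = "prd C X Y"
  have o: "X \<in> Obj C" "Y \<in> Obj C" using assms two_nilpotent_obj by auto
  have p: "pr1 C X Y \<in> hom C ?P X" "pr2 C X Y \<in> hom C ?P Y" using o by (simp_all add: hom_def)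
  show P: "?P \<in> Obj C" using o by simp
  fix T u assume u: "killed_by_rets ?P ?P ?P T u"
  have uh: "u \<in> hom C T (coprd3 ?P ?P ?P)" using u by blast
  show "codiag3 ?P \<cdot> u = zero_arr C T ?P"
    by (rule prd_ext[of _ T X Y])
      (use comp_codiag3[OF p(1) uh] two_nilpotentD[OF assms(1) u p(1) p(1) p(1)]
        comp_codiag3[OF p(2) uh] two_nilpotentD[OF assms(2) u p(2) p(2) p(2)] uh hom_obj[OF uh] o
       in \<open>simp_all add: hom_def copair3_def\<close>)
qed

lemma two_nilpotent_zero:
  assumes "is_zero C Z" shows "two_nilpotent C Z"
proof (rule two_nilpotentI)
  show Z: "Z \<in> Obj C" using assms by (simp add: is_zero_def is_initial_def)
  fix T u assume "killed_by_rets Z Z Z T u"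
  then have "codiag3 Z \<cdot> u \<in> hom C T Z" using Z by (simp add: hom_def copair3_def)
  then show "codiag3 Z \<cdot> u = zero_arr C T Z" using hom_zero_object(1)[OF assms] by blast
qed

text \<open>The ternary cosmash product is the joint kernel of the three commuting idempotents of
  \<open>X + Y + Z\<close> that kill one summand, here numbered by the killed summand.\<close>

abbreviation kill3 where
  "kill3 X Y Z \<equiv> in1 C (coprd C X Y) Z \<cdot> ret12 X Y Z"
abbreviation kill2 where
  "kill2 X Y Z \<equiv> copair C (in1 C (coprd C X Y) Z \<cdot> in1 C X Y) (in2 C (coprd C X Y) Z) \<cdot> ret13 X Y Z"
abbreviation kill1 where
  "kill1 X Y Z \<equiv> copair C (in1 C (coprd C X Y) Z \<cdot> in2 C X Y) (in2 C (coprd C X Y) Z) \<cdot> ret23 X Y Z"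

text \<open>As copairings of injections and zero arrows, the idempotents can be composed summand by
  summand, which is how simp verifies idempotence, commutation and naturality.\<close>

lemma kill_simps:
  assumes "X \<in> Obj C" "Y \<in> Obj C" "Z \<in> Obj C"
  defines "i \<equiv> in1 C (coprd C X Y) Z \<cdot> in1 C X Y" and "j \<equiv> in1 C (coprd C X Y) Z \<cdot> in2 C X Y"
    and "k \<equiv> in2 C (coprd C X Y) Z" and "W \<equiv> coprd3 X Y Z"
  shows "kill3 X Y Z = copair C (copair C i j) (zero_arr C Z W)"
    "kill2 X Y Z = copair C (copair C i (zero_arr C Y W)) k"
    "kill1 X Y Z = copair C (copair C (zero_arr C X W) j) k"
  using assms by (simp_all add: copair3_def comp_copair)

lemma killed_by_rets_iff_kills:
  assumes "X \<in> Obj C" "Y \<in> Obj C" "Z \<in> Obj C" "u \<in> hom C T (coprd3 X Y Z)"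
  shows "killed_by_rets X Y Z T u \<longleftrightarrow>
    (\<forall>e \<in> {kill3 X Y Z, kill2 X Y Z, kill1 X Y Z}. e \<cdot> u = zero_arr C T (coprd3 X Y Z))"
proof
  have T: "T \<in> Obj C" using assms(4) hom_obj by blast
  assume "killed_by_rets X Y Z T u"
  then show "\<forall>e \<in> {kill3 X Y Z, kill2 X Y Z, kill1 X Y Z}. e \<cdot> u = zero_arr C T (coprd3 X Y Z)"
    using assms(1-3) T by (simp add: copair3_def hom_def)
next
  have T: "T \<in> Obj C" using assms(4) hom_obj by blast
  assume k: "\<forall>e \<in> {kill3 X Y Z, kill2 X Y Z, kill1 X Y Z}. e \<cdot> u = zero_arr C T (coprd3 X Y Z)"
  \<comment> \<open>Each idempotent is a retraction followed by its section, so the retraction can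
    be recovered from it.\<close>
  have "ret12 X Y Z \<cdot> kill3 X Y Z = ret12 X Y Z" "ret13 X Y Z \<cdot> kill2 X Y Z = ret13 X Y Z"
    "ret23 X Y Z \<cdot> kill1 X Y Z = ret23 X Y Z"
    unfolding kill_simps[OF assms(1-3)] copair3_def using assms(1-3) by (simp_all add: comp_copair)
  note r = this[THEN comp_reassoc, symmetric]
  have "ret12 X Y Z \<cdot> u = ret12 X Y Z \<cdot> (kill3 X Y Z \<cdot> u)"
    "ret13 X Y Z \<cdot> u = ret13 X Y Z \<cdot> (kill2 X Y Z \<cdot> u)"
    "ret23 X Y Z \<cdot> u = ret23 X Y Z \<cdot> (kill1 X Y Z \<cdot> u)"
    using assms by (intro r; simp add: copair3_def hom_def)+
  then show "killed_by_rets X Y Z T u"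
    using k assms T by (simp add: copair3_def hom_def)
qed

text \<open>The sum of three copies of \<open>q\<close> restricts to a regular epimorphism from the
  ternary cosmash product of \<open>X\<close> onto that of \<open>N\<close>. The codiagonal of
  \<open>N\<close>, composed with it, is \<open>q\<close> after the codiagonal of \<open>X\<close>,
  which vanishes there; cancel the epimorphism.\<close>

lemma two_nilpotent_quotient:
  assumes "is_regular_epi C q" "q \<in> hom C X N"
    and "q \<cdot> (codiag3 X \<cdot> cosmash3_arr C X X X) = zero_arr C (Dom C (cosmash3_arr C X X X)) N"
  shows "two_nilpotent C N"
proof (rule two_nilpotentI)
  have o: "X \<in> Obj C" "N \<in> Obj C" using assms hom_obj by blast+
  then show "N \<in> Obj C" by simp
  let ?F = "coprd_map C (coprd_map C q q) q"
  have qd: "q \<in> Arr C" "Dom C q = X" "Cod C q = N" using assms(2) by (auto simp: hom_def)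
  have F: "is_regular_epi C ?F" "?F \<in> hom C (coprd3 X X X) (coprd3 N N N)"
    using coprd_map_regular_epi assms(1) qd by (simp_all add: hom_def)
  let ?es = "[(kill3 X X X, kill3 N N N), (kill2 X X X, kill2 N N N), (kill1 X X X, kill1 N N N)]"
  have "\<exists>k k' v. is_joint_kernel C (coprd3 X X X) (fst ` set ?es) k \<and>
      is_joint_kernel C (coprd3 N N N) (snd ` set ?es) k' \<and>
      v \<in> hom C (Dom C k) (Dom C k') \<and> is_regular_epi C v \<and> k' \<cdot> v = ?F \<cdot> k"
  proof (rule idempotents_joint_kernel_regular_epi[OF F])
    fix e e' assume "(e, e') \<in> set ?es"
    then show "e \<in> hom C (coprd3 X X X) (coprd3 X X X) \<and> e' \<in> hom C (coprd3 N N N) (coprd3 N N N) \<and>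
           e \<cdot> e = e \<and> e' \<cdot> e' = e' \<and> e' \<cdot> ?F = ?F \<cdot> e"
      unfolding kill_simps[OF o(1,1,1)] kill_simps[OF o(2,2,2)] using o qd
      by (auto simp: hom_def comp_copair copair_coprd_map)
  next
    fix e e' f f' assume "(e, e') \<in> set ?es" "(f, f') \<in> set ?es"
    then show "e \<cdot> f = f \<cdot> e \<and> e' \<cdot> f' = f' \<cdot> e'"
      unfolding kill_simps[OF o(1,1,1)] kill_simps[OF o(2,2,2)] using o
      by (auto simp: comp_copair)
  qed
  then obtain k k' v where k: "is_joint_kernel C (coprd3 X X X) {kill3 X X X, kill2 X X X, kill1 X X X} k"
    "is_joint_kernel C (coprd3 N N N) {kill3 N N N, kill2 N N N, kill1 N N N} k'"
    "v \<in> hom C (Dom C k) (Dom C k')" "is_regular_epi C v" "k' \<cdot> v = ?F \<cdot> k"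
    by (auto simp del: comp_assoc)
  note kd = joint_kernelD[OF k(1)] and kd' = joint_kernelD[OF k(2)]
  have kh: "k \<in> hom C (Dom C k) (coprd3 X X X)" "k' \<in> hom C (Dom C k') (coprd3 N N N)"
    using kd kd' by (simp_all add: hom_def)
  have ko: "Dom C k \<in> Obj C" "Dom C k' \<in> Obj C" using kh hom_obj by blast+
  let ?c = "cosmash3_arr C X X X"
  have c: "?c \<in> hom C (Dom C ?c) (coprd3 X X X)" using cosmash3_arr_killed[OF o(1,1,1)] by blast
  have "killed_by_rets X X X (Dom C k) k"
    using killed_by_rets_iff_kills[OF o(1,1,1) kh(1)] kd(4) by blast
  then obtain h where h: "h \<in> hom C (Dom C k) (Dom C ?c)" "?c \<cdot> h = k"
    using cosmash3_lift[OF o(1,1,1)] by metis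
  have "codiag3 N \<cdot> ?F = q \<cdot> codiag3 X"
    using qd o by (simp add: copair3_def copair_coprd_map comp_copair)
  then have "codiag3 N \<cdot> (?F \<cdot> k) = (q \<cdot> codiag3 X) \<cdot> k"
    by (rule comp_reassoc) (use qd o kh in \<open>auto simp: copair3_def hom_def\<close>)
  also have "\<dots> = q \<cdot> (codiag3 X \<cdot> (?c \<cdot> h))"
    unfolding h(2) using qd o kh by (simp add: copair3_def hom_def)
  also have "\<dots> = (q \<cdot> (codiag3 X \<cdot> ?c)) \<cdot> h"
    using qd o c h(1) by (simp add: copair3_def hom_def)
  also have "\<dots> = zero_arr C (Dom C k) N"
    unfolding assms(3) using h(1) o by (simp add: hom_def)
  finally have "(codiag3 N \<cdot> k') \<cdot> v = zero_arr C (Dom C k') N \<cdot> v"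
    using k(3) kh o ko by (simp add: copair3_def hom_def k(5))
  then have z: "codiag3 N \<cdot> k' = zero_arr C (Dom C k') N"
    by (rule epi_cancel[OF regular_epi_is_epi[OF k(4)]]) (use k(3) kh o ko in \<open>auto simp: copair3_def hom_def\<close>)
  fix T u assume u: "killed_by_rets N N N T u"
  then have uh: "u \<in> hom C T (coprd3 N N N)" by blast
  obtain l where l: "l \<in> hom C T (Dom C k')" "k' \<cdot> l = u"
    using joint_kernel_lift[OF k(2) uh] killed_by_rets_iff_kills[OF o(2,2,2) uh] u by blast
  have "codiag3 N \<cdot> (k' \<cdot> l) = zero_arr C T N"
    using l(1) kh o by (simp add: copair3_def hom_def comp_reassoc[OF z[unfolded copair3_def]])
  then show "codiag3 N \<cdot> u = zero_arr C T N" using l(2) by simp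
qed

section \<open>The two-nilpotent reflection\<close>

lemma nil2_unit_cokernel:
  assumes "X \<in> Obj C"
  shows "is_cokernel C (commutator3 C X) (nil2_unit C X)"
proof -
  obtain e where "commutator3 C X \<in> hom C (Dom C (commutator3 C X)) X"
    using commutator3_image[OF assms] by metis
  then show ?thesis unfolding nil2_unit_def coker_def using cokernel_exists by (metis someI_ex)
qed

lemma nil2_unit_props:
  assumes "X \<in> Obj C"
  shows "nil2_unit C X \<in> hom C X (nil2 C X)" "is_regular_epi C (nil2_unit C X)" "two_nilpotent C (nil2 C X)"
proof -
  let ?m = "commutator3 C X" and ?q = "nil2_unit C X"
  obtain e where e: "is_regular_epi C e" "is_mono C ?m"
    "e \<in> hom C (Dom C (cosmash3_arr C X X X)) (Dom C ?m)" "?m \<in> hom C (Dom C ?m) X"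
    "?m \<cdot> e = codiag3 X \<cdot> cosmash3_arr C X X X"
    using commutator3_image[OF assms] .
  note q = cokernelD[OF nil2_unit_cokernel[OF assms] e(4)]
  show qh: "?q \<in> hom C X (nil2 C X)" using q by (simp add: hom_def nil2_def)
  then have o: "nil2 C X \<in> Obj C" using hom_obj by blast
  show qr: "is_regular_epi C ?q" by (rule q(4))
  have "?q \<cdot> (codiag3 X \<cdot> cosmash3_arr C X X X) = zero_arr C (Dom C (cosmash3_arr C X X X)) (nil2 C X)"
    unfolding e(5)[symmetric] using qh e(3,4) o by (simp add: hom_def comp_reassoc[OF q(3)] nil2_def)
  then show "two_nilpotent C (nil2 C X)" using two_nilpotent_quotient[OF qr qh] by blast
qed

lemma nil2_universal:
  assumes "two_nilpotent C N" "f \<in> hom C X N"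
  shows "\<exists>!h. h \<in> hom C (nil2 C X) N \<and> h \<cdot> nil2_unit C X = f"
proof (rule ex_ex1I)
  have o: "X \<in> Obj C" "N \<in> Obj C" using assms hom_obj by blast+
  let ?m = "commutator3 C X" and ?c = "cosmash3_arr C X X X"
  obtain e where e: "is_regular_epi C e" "is_mono C ?m"
    "e \<in> hom C (Dom C ?c) (Dom C ?m)" "?m \<in> hom C (Dom C ?m) X" "?m \<cdot> e = codiag3 X \<cdot> ?c"
    using commutator3_image[OF o(1)] .
  note q = nil2_unit_props[OF o(1)] and c = cosmash3_arr_killed[OF o(1,1,1)]
  have ch: "?c \<in> hom C (Dom C ?c) (coprd3 X X X)" using c by blast
  have mo: "Dom C ?m \<in> Obj C" using e(4) hom_obj by blast
  have "f \<cdot> (?m \<cdot> e) = zero_arr C (Dom C ?c) N"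
    unfolding e(5) using comp_codiag3[OF assms(2) ch] two_nilpotentD[OF assms(1) c assms(2,2,2)] by simp
  then have "(f \<cdot> ?m) \<cdot> e = zero_arr C (Dom C ?m) N \<cdot> e"
    using assms(2) e(3,4) o by (simp add: hom_def)
  then have "f \<cdot> ?m = zero_arr C (Dom C ?m) N"
    by (rule epi_cancel[OF regular_epi_is_epi[OF e(1)]]) (use assms(2) e(3,4) o mo in \<open>auto simp: hom_def\<close>)
  then show "\<exists>h. h \<in> hom C (nil2 C X) N \<and> h \<cdot> nil2_unit C X = f"
    using cokernel_desc[OF nil2_unit_cokernel[OF o(1)] e(4) assms(2)] unfolding nil2_def by metis
  fix x y assume "x \<in> hom C (nil2 C X) N \<and> x \<cdot> nil2_unit C X = f" "y \<in> hom C (nil2 C X) N \<and> y \<cdot> nil2_unit C X = f"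
  then show "x = y" using epi_cancel[OF regular_epi_is_epi[OF q(2)], of x y] q(1) by (auto simp: hom_def)
qed

lemma nil2_mapI:
  assumes "f \<in> hom C X Y" "h \<in> hom C (nil2 C X) (nil2 C Y)" "h \<cdot> nil2_unit C X = nil2_unit C Y \<cdot> f"
  shows "nil2_map C f = h"
proof -
  have Y: "Y \<in> Obj C" and d: "Dom C f = X" "Cod C f = Y" using assms(1) hom_obj by (auto simp: hom_def)
  note y = nil2_unit_props[OF Y]
  show ?thesis
    unfolding nil2_map_def d
    by (rule the1_equality[OF nil2_universal[OF y(3) Comp_in_hom[OF assms(1) y(1)]]]) (use assms in blast)
qed

lemma nil2_map_props:
  assumes "f \<in> hom C X Y"
  shows "nil2_map C f \<in> hom C (nil2 C X) (nil2 C Y)" "nil2_map C f \<cdot> nil2_unit C X = nil2_unit C Y \<cdot> f"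
proof -
  have Y: "Y \<in> Obj C" using assms hom_obj by blast
  note y = nil2_unit_props[OF Y]
  obtain h where "h \<in> hom C (nil2 C X) (nil2 C Y)" "h \<cdot> nil2_unit C X = nil2_unit C Y \<cdot> f"
    using nil2_universal[OF y(3) Comp_in_hom[OF assms y(1)]] by blast
  then show "nil2_map C f \<in> hom C (nil2 C X) (nil2 C Y)" "nil2_map C f \<cdot> nil2_unit C X = nil2_unit C Y \<cdot> f"
    using nil2_mapI[OF assms] by metis+
qed

lemma nil2_map_ident:
  assumes "X \<in> Obj C" shows "nil2_map C (Ident C X) = Ident C (nil2 C X)"
  using nil2_unit_props[OF assms] two_nilpotent_obj
  by (intro nil2_mapI[of _ X X]) (use assms in \<open>simp_all add: hom_def\<close>)

lemma nil2_map_comp: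
  assumes "f \<in> hom C X Y" "g \<in> hom C Y Z"
  shows "nil2_map C (g \<cdot> f) = nil2_map C g \<cdot> nil2_map C f"
proof (rule nil2_mapI[OF Comp_in_hom[OF assms]])
  have o: "X \<in> Obj C" "Y \<in> Obj C" "Z \<in> Obj C" using assms hom_obj by blast+
  note f = nil2_map_props[OF assms(1)] and g = nil2_map_props[OF assms(2)]
  show "nil2_map C g \<cdot> nil2_map C f \<in> hom C (nil2 C X) (nil2 C Z)" using Comp_in_hom[OF f(1) g(1)] .
  show "(nil2_map C g \<cdot> nil2_map C f) \<cdot> nil2_unit C X = nil2_unit C Z \<cdot> (g \<cdot> f)"
    using f(1) g(1) assms nil2_unit_props(1)[OF o(1)] nil2_unit_props(1)[OF o(2)] nil2_unit_props(1)[OF o(3)]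
    by (simp add: hom_def f(2) comp_reassoc[OF g(2)])
qed

end

section \<open>The subcategory of two-nilpotent objects\<close>

lemma full_subcat_simps [simp]:
  "Obj (full_subcat C P) = {X \<in> Obj C. P X}"
  "Arr (full_subcat C P) = {f \<in> Arr C. P (Dom C f) \<and> P (Cod C f)}"
  "Dom (full_subcat C P) = Dom C" "Cod (full_subcat C P) = Cod C"
  "Ident (full_subcat C P) = Ident C" "Comp (full_subcat C P) = Comp C"
  by (simp_all add: full_subcat_def)

lemma hom_full_subcat:
  "f \<in> hom (full_subcat C P) X Y \<longleftrightarrow> f \<in> hom C X Y \<and> P X \<and> P Y"
  by (auto simp: hom_def)

lemma (in category) full_subcat_category: "category (full_subcat C P)"
  by unfold_locales
    (auto simp: hom_full_subcat Ident_in_hom Comp_Ident Ident_Comp intro: Comp_in_hom Comp_assoc)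

lemma prod_cat_simps [simp]:
  "Obj (prod_cat C D) = Obj C \<times> Obj D" "Arr (prod_cat C D) = Arr C \<times> Arr D"
  "Dom (prod_cat C D) p = (Dom C (fst p), Dom D (snd p))"
  "Cod (prod_cat C D) p = (Cod C (fst p), Cod D (snd p))"
  "Ident (prod_cat C D) x = (Ident C (fst x), Ident D (snd x))"
  "Comp (prod_cat C D) p' p = (fst p' \<cdot>\<^bsub>C\<^esub> fst p, snd p' \<cdot>\<^bsub>D\<^esub> snd p)"
  by (simp_all add: prod_cat_def split_beta)

lemma hom_prod_cat:
  "p \<in> hom (prod_cat C D) X Y \<longleftrightarrow> fst p \<in> hom C (fst X) (fst Y) \<and> snd p \<in> hom D (snd X) (snd Y)"
  by (cases p; cases X; cases Y) (auto simp: hom_def)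

lemma (in category) prod_cat_category:
  assumes "category D"
  shows "category (prod_cat C D)"
proof -
  interpret D: category D by (rule assms)
  show ?thesis
  proof
    fix f g h X Y Z W
    assume "f \<in> hom (prod_cat C D) X Y" "g \<in> hom (prod_cat C D) Y Z" "h \<in> hom (prod_cat C D) Z W"
    then show "(h \<cdot>\<^bsub>prod_cat C D\<^esub> g) \<cdot>\<^bsub>prod_cat C D\<^esub> f = h \<cdot>\<^bsub>prod_cat C D\<^esub> (g \<cdot>\<^bsub>prod_cat C D\<^esub> f)"
      by (simp add: hom_prod_cat) (blast intro: Comp_assoc D.Comp_assoc)
  qed (auto simp: hom_prod_cat Ident_in_hom D.Ident_in_hom Comp_Ident D.Comp_Ident Ident_Comp
        D.Ident_Comp intro: Comp_in_hom D.Comp_in_hom)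
qed

context semi_abelian_category
begin

lemma Nil2_simps [simp]:
  "Obj (Nil2 C) = {X. two_nilpotent C X}"
  "Arr (Nil2 C) = {f \<in> Arr C. two_nilpotent C (Dom C f) \<and> two_nilpotent C (Cod C f)}"
  "Dom (Nil2 C) = Dom C" "Cod (Nil2 C) = Cod C" "Ident (Nil2 C) = Ident C" "Comp (Nil2 C) = Comp C"
  using two_nilpotent_obj by (auto simp: Nil2_def)

lemma hom_Nil2: "f \<in> hom (Nil2 C) X Y \<longleftrightarrow> f \<in> hom C X Y \<and> two_nilpotent C X \<and> two_nilpotent C Y"
  unfolding Nil2_def by (rule hom_full_subcat)

lemma is_zero_Nil2:
  assumes "is_zero C Z" shows "is_zero (Nil2 C) Z"
proof -
  have Z: "two_nilpotent C Z" using assms by (rule two_nilpotent_zero)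
  have "(\<exists>!f. f \<in> hom C Z X) \<and> (\<exists>!f. f \<in> hom C X Z)" if "two_nilpotent C X" for X
    using assms two_nilpotent_obj[OF that] unfolding is_zero_def is_initial_def is_terminal_def by blast
  then show ?thesis using Z by (simp add: is_zero_def is_initial_def is_terminal_def hom_Nil2)
qed

sublocale Nil2: pointed_category "Nil2 C"
proof -
  interpret N: category "Nil2 C" unfolding Nil2_def by (rule full_subcat_category)
  obtain Z where "is_zero C Z" "Z \<in> Obj C" by (rule zero_object)
  then show "pointed_category (Nil2 C)" using is_zero_Nil2 by unfold_locales (auto simp: pointed_def)
qed

lemma zero_arr_Nil2 [simp]:
  assumes "two_nilpotent C X" "two_nilpotent C Y"
  shows "zero_arr (Nil2 C) X Y = zero_arr C X Y"
proof -
  have o: "X \<in> Obj C" "Y \<in> Obj C" using assms two_nilpotent_obj by auto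
  obtain Z where Z: "is_zero C Z" "Z \<in> Obj C" by (rule zero_object)
  have n: "two_nilpotent C Z" using Z(1) by (rule two_nilpotent_zero)
  have "is_zero_arr (Nil2 C) (zero_arr C Z Y \<cdot>\<^bsub>Nil2 C\<^esub> zero_arr C X Z)"
    by (rule Nil2.is_zero_arrI[OF is_zero_Nil2[OF Z(1)], where X = X and Y = Y])
      (use o Z n assms in \<open>auto simp: hom_Nil2 hom_def\<close>)
  then have "is_zero_arr (Nil2 C) (zero_arr C X Y)" using o Z by simp
  moreover have "zero_arr C X Y \<in> hom (Nil2 C) X Y" using o assms by (simp add: hom_Nil2 hom_def)
  ultimately show ?thesis using Nil2.is_zero_arr_iff by metis
qed

lemma Nil2_product:
  assumes "two_nilpotent C X" "two_nilpotent C Y"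
  shows "is_product (Nil2 C) X Y (prd C X Y) (pr1 C X Y) (pr2 C X Y)"
  using chosen_is_product[of X Y] two_nilpotent_obj assms two_nilpotent_prd[OF assms]
  by (simp add: is_product_def hom_Nil2)

text \<open>The reflection of the coproduct in \<open>C\<close>. The choice made by
  \<open>coprd\<close> in \<open>Nil2 C\<close> may be another coproduct, so later arguments use
  only its universal property.\<close>

lemma Nil2_coproduct:
  assumes "two_nilpotent C X" "two_nilpotent C Y"
  defines "q \<equiv> nil2_unit C (coprd C X Y)"
  shows "is_coproduct (Nil2 C) X Y (nil2 C (coprd C X Y)) (q \<cdot> in1 C X Y) (q \<cdot> in2 C X Y)"
proof -
  have o: "X \<in> Obj C" "Y \<in> Obj C" "coprd C X Y \<in> Obj C" using assms two_nilpotent_obj by auto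
  let ?N = "nil2 C (coprd C X Y)"
  have q: "q \<in> hom C (coprd C X Y) ?N" "is_regular_epi C q" "two_nilpotent C ?N"
    unfolding q_def by (rule nil2_unit_props[OF o(3)])+
  have i: "q \<cdot> in1 C X Y \<in> hom C X ?N" "q \<cdot> in2 C X Y \<in> hom C Y ?N" using q o by (simp_all add: hom_def)
  have "\<exists>!h. h \<in> hom C ?N T \<and> h \<cdot> (q \<cdot> in1 C X Y) = f \<and> h \<cdot> (q \<cdot> in2 C X Y) = g"
    if T: "two_nilpotent C T" and fg: "f \<in> hom C X T" "g \<in> hom C Y T" for T f g
  proof (rule ex_ex1I)
    have "copair C f g \<in> hom C (coprd C X Y) T" using fg by (simp add: hom_def)
    then obtain h where h: "h \<in> hom C ?N T" "h \<cdot> q = copair C f g"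
      using nil2_universal[OF T] unfolding q_def by metis
    then have "h \<in> hom C ?N T \<and> h \<cdot> (q \<cdot> in1 C X Y) = f \<and> h \<cdot> (q \<cdot> in2 C X Y) = g"
      using q(1) o fg by (simp add: hom_def comp_reassoc[OF h(2)])
    then show "\<exists>h. h \<in> hom C ?N T \<and> h \<cdot> (q \<cdot> in1 C X Y) = f \<and> h \<cdot> (q \<cdot> in2 C X Y) = g" ..
    fix x y
    assume xy: "x \<in> hom C ?N T \<and> x \<cdot> (q \<cdot> in1 C X Y) = f \<and> x \<cdot> (q \<cdot> in2 C X Y) = g"
      "y \<in> hom C ?N T \<and> y \<cdot> (q \<cdot> in1 C X Y) = f \<and> y \<cdot> (q \<cdot> in2 C X Y) = g"
    have "x \<cdot> q = y \<cdot> q"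
      by (rule coprd_ext[of _ X Y T]) (use xy q o in \<open>simp_all add: hom_def\<close>)
    then show "x = y" using epi_cancel[OF regular_epi_is_epi[OF q(2)], of x y] q(1) xy by (auto simp: hom_def)
  qed
  then show ?thesis using i q(3) assms by (simp add: is_coproduct_def hom_Nil2)
qed

lemma Nil2_kernel:
  assumes "is_kernel C f k" "f \<in> hom (Nil2 C) X Y"
  shows "is_kernel (Nil2 C) f k"
proof -
  have f: "f \<in> hom C X Y" "two_nilpotent C X" "two_nilpotent C Y" using assms(2) by (auto simp: hom_Nil2)
  note k = kernelD[OF assms(1)]
  have kh: "k \<in> hom C (Dom C k) X" using k f by (simp add: hom_def)
  have n: "two_nilpotent C (Dom C k)" by (rule two_nilpotent_subobject[OF f(2) k(5) kh])
  show ?thesis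
  proof (rule Nil2.is_kernelI[OF assms(2)])
    show "k \<in> hom (Nil2 C) (Dom C k) X" using kh n f by (simp add: hom_Nil2)
    then show "is_mono (Nil2 C) k"
      by (rule Nil2.is_monoI) (use mono_cancel[OF k(5)] in \<open>auto simp: hom_Nil2 hom_def\<close>)
    show "f \<cdot>\<^bsub>Nil2 C\<^esub> k = zero_arr (Nil2 C) (Dom C k) Y" using k(4) f n by (simp add: hom_def)
    fix T u assume "u \<in> hom (Nil2 C) T X" "f \<cdot>\<^bsub>Nil2 C\<^esub> u = zero_arr (Nil2 C) T Y"
    then have "u \<in> hom C T X" "two_nilpotent C T" "f \<cdot> u = zero_arr C T Y" using f by (simp_all add: hom_Nil2)
    then show "\<exists>h \<in> hom (Nil2 C) T (Dom C k). k \<cdot>\<^bsub>Nil2 C\<^esub> h = u"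
      using kernel_lift[OF assms(1), of u T] f n by (simp add: hom_Nil2 hom_def) metis
  qed
qed

text \<open>Makes the lemmas on cosmash products, including functoriality, available for
  \<open>Nil2 C\<close>.\<close>

sublocale Nil2: cosmash_category "Nil2 C"
proof
  fix X Y assume "X \<in> Obj (Nil2 C)" "Y \<in> Obj (Nil2 C)"
  then show "\<exists>P p q. is_product (Nil2 C) X Y P p q" "\<exists>S i j. is_coproduct (Nil2 C) X Y S i j"
    using Nil2_product Nil2_coproduct by (simp_all del: ex_simps) blast+
next
  fix f assume f: "f \<in> Arr (Nil2 C)"
  then obtain k where "is_kernel C f k" using kernel_exists by auto
  then have "is_kernel (Nil2 C) f k"
    by (rule Nil2_kernel[of _ _ "Dom C f" "Cod C f"]) (use f in \<open>simp add: hom_Nil2 hom_def\<close>)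
  then show "\<exists>k. is_kernel (Nil2 C) f k" ..
qed

end

section \<open>Abelian objects\<close>

context semi_abelian_category
begin

lemma terminal_is_terminal: "is_terminal C (terminal C)"
  using finitely_complete someI_ex[of "is_terminal C"] by (auto simp: terminal_def finitely_complete_def)

lemma to_terminal_hom: "X \<in> Obj C \<Longrightarrow> to_terminal C X \<in> hom C X (terminal C)"
  using terminal_is_terminal theI'[of "\<lambda>f. f \<in> hom C X (terminal C)"]
  unfolding is_terminal_def to_terminal_def by blast

text \<open>In a protomodular category a unital multiplication is associative and commutative because
  the axes of a product are jointly epic; inverses exist because \<open>(x, y) \<mapsto> (x + y, y)\<close>
  restricts to the identity on the kernels of the second projections.\<close>

lemma unital_multiplication_abelian:
  assumes "K \<in> Obj C" "m \<in> hom C (prd C K K) K"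
    and "m \<cdot> pair C (Ident C K) (zero_arr C K K) = Ident C K"
    and "m \<cdot> pair C (zero_arr C K K) (Ident C K) = Ident C K"
  shows "abelian_object C K"
proof -
  let ?P = "prd C K K" and ?p = "pr1 C K K" and ?q = "pr2 C K K"
  let ?l = "pair C (Ident C K) (zero_arr C K K)" and ?r = "pair C (zero_arr C K K) (Ident C K)"
  have K [simp]: "K \<in> Obj C" by (rule assms(1))
  have m [simp]: "m \<in> Arr C" "Dom C m = ?P" "Cod C m = K" using assms(2) by (auto simp: hom_def)
  have unit [simp]: "m \<cdot> pair C f (zero_arr C T K) = f" "m \<cdot> pair C (zero_arr C T K) f = f"
    if f: "f \<in> Arr C" "Dom C f = T" "Cod C f = K" for f T
  proof -
    have "pair C f (zero_arr C T K) = ?l \<cdot> f" "pair C (zero_arr C T K) f = ?r \<cdot> f"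
      using f by (auto simp: pair_comp)
    then show "m \<cdot> pair C f (zero_arr C T K) = f" "m \<cdot> pair C (zero_arr C T K) f = f"
      using f by (auto simp: comp_reassoc[OF assms(3)] comp_reassoc[OF assms(4)])
  qed
  have pq: "pair C ?p ?q = Ident C ?P"
    by (rule prd_ext[of _ ?P K K]) (simp_all add: hom_def)
  let ?PK = "prd C ?P K"
  let ?x = "?p \<cdot> pr1 C ?P K" and ?y = "?q \<cdot> pr1 C ?P K" and ?z = "pr2 C ?P K"
  have assoc: "m \<cdot> pair C (m \<cdot> pair C ?x ?y) ?z = m \<cdot> pair C ?x (m \<cdot> pair C ?y ?z)"
    by (rule jointly_extremal_ext[OF prd_extremal[of ?P K], where Y = K])
      (simp_all add: hom_def pair_comp pq)
  have comm: "m \<cdot> pair C ?q ?p = m"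
    by (rule jointly_extremal_ext[OF prd_extremal[of K K], where Y = K]) (simp_all add: hom_def pair_comp)
  let ?h = "pair C m ?q"
  obtain Z where Z: "is_zero C Z" "Z \<in> Obj C" by (rule zero_object)
  have q: "?q \<in> hom C ?P K" by (simp add: hom_def)
  have pb: "is_pullback C (zero_arr C Z K) ?q K (zero_arr C K Z) ?l"
    using kernel_is_pullback[OF prd_kernel[of K K] q Z(1)] by simp
  have "is_iso C ?h"
  proof (rule protomodular[OF _ _ _ _ pb pb])
    show "zero_arr C Z K \<in> hom C Z K" using Z by (simp add: hom_def)
    \<comment> \<open>\<open>?h\<close> sends \<open>(0, y)\<close> to \<open>(y, y)\<close>, so the
      target point must carry the diagonal as its section.\<close>
    show "is_point C K ?P ?q ?r" "is_point C K ?P ?q (pair C (Ident C K) (Ident C K))"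
      by (simp_all add: is_point_def hom_def)
    show "is_point_mor C ?P ?q ?r ?P ?q (pair C (Ident C K) (Ident C K)) ?h"
      by (simp add: is_point_mor_def hom_def pair_comp)
    show "?l = ?h \<cdot> ?l" by (simp add: pair_comp)
  qed
  moreover have "?h \<in> hom C ?P ?P" by (simp add: hom_def)
  ultimately obtain g where g: "g \<in> hom C ?P ?P" "?h \<cdot> g = Ident C ?P" using is_isoE by metis
  have ga [simp]: "g \<in> Arr C" "Dom C g = ?P" "Cod C g = ?P" using g by (auto simp: hom_def)
  \<comment> \<open>The inverse \<open>g\<close> of \<open>(x, y) \<mapsto> (x + y, y)\<close> sends
    \<open>(0, y)\<close> to the pair \<open>(x, y)\<close> with \<open>x + y = 0\<close>;
    \<open>i\<close> reads off this \<open>x\<close>.\<close>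
  define i where "i = ?p \<cdot> (g \<cdot> ?r)"
  have i [simp]: "i \<in> Arr C" "Dom C i = K" "Cod C i = K" by (simp_all add: i_def)
  have mg: "m \<cdot> g = ?p" "?q \<cdot> g = ?q"
    using arg_cong[OF g(2), of "\<lambda>t. ?p \<cdot> t"] arg_cong[OF g(2), of "\<lambda>t. ?q \<cdot> t"] by simp_all
  have gr: "g \<cdot> ?r = pair C i (Ident C K)"
    by (rule prd_ext[of _ K K K]) (simp_all add: hom_def i_def comp_reassoc[OF mg(2)])
  have inv: "m \<cdot> pair C i (Ident C K) = zero_arr C K K"
    unfolding gr[symmetric] by (simp add: comp_reassoc[OF mg(1)])
  have "m \<cdot> pair C (Ident C K) i = m \<cdot> (pair C ?q ?p \<cdot> pair C i (Ident C K))" by (simp add: pair_comp)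
  also have "\<dots> = zero_arr C K K" by (subst comp_reassoc[OF comm]) (simp_all add: inv)
  finally have inv': "m \<cdot> pair C (Ident C K) i = zero_arr C K K" .
  have T: "terminal C \<in> Obj C" using terminal_is_terminal by (simp add: is_terminal_def)
  have "zero_arr C (terminal C) K \<cdot> to_terminal C K = zero_arr C K K"
    using to_terminal_hom[of K] by (simp add: hom_def)
  then have "is_internal_abelian_group C K m (zero_arr C (terminal C) K) i"
    unfolding is_internal_abelian_group_def Let_def using T assoc comm inv inv' by (simp add: hom_def)
  then show ?thesis unfolding abelian_object_def by blast
qed

lemma ident_regular_epi: "X \<in> Obj C \<Longrightarrow> is_regular_epi C (Ident C X)"
  by (rule extremal_regular_epi[of _ X X]) (auto intro: split_epi_mono_is_iso simp: hom_def)

text \<open>Its image contains both axes of the product, and these are jointly extremal.\<close>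

lemma coprd_prd_regular_epi:
  assumes "X \<in> Obj C" "Y \<in> Obj C"
  shows "is_regular_epi C (pair C (ret1 X Y) (ret2 X Y))"
proof (rule extremal_regular_epi[of _ "coprd C X Y" "prd C X Y"])
  let ?c = "pair C (ret1 X Y) (ret2 X Y)"
  show "?c \<in> hom C (coprd C X Y) (prd C X Y)" using assms by (simp add: hom_def)
  fix I j l assume j: "is_mono C j" "j \<in> hom C I (prd C X Y)" "l \<in> hom C (coprd C X Y) I" "j \<cdot> l = ?c"
  have "j \<cdot> (l \<cdot> in1 C X Y) = pair C (Ident C X) (zero_arr C X Y)"
    "j \<cdot> (l \<cdot> in2 C X Y) = pair C (zero_arr C Y X) (Ident C Y)"
    using j(2,3) assms by (simp_all add: hom_def comp_reassoc[OF j(4)] pair_comp)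
  moreover have "l \<cdot> in1 C X Y \<in> hom C X I" "l \<cdot> in2 C X Y \<in> hom C Y I"
    using j(3) assms by (simp_all add: hom_def)
  ultimately show "is_iso C j"
    by (intro jointly_extremalD[OF prd_extremal[OF assms] j(1)]) (use j(2) assms in auto)
qed

text \<open>The comparison from the sum to the product is a regular epimorphism with the cosmash
  product as kernel, so the codiagonal descends along it. Restricting the descended arrow to the two
  axes gives the unit laws.\<close>

lemma abelian_object_if_codiagonal_kills:
  assumes "K \<in> Obj C"
    and "copair C (Ident C K) (Ident C K) \<cdot> cosmash_arr C K K = zero_arr C (cosmash C K K) K"
  shows "abelian_object C K"
proof -
  let ?c = "pair C (ret1 K K) (ret2 K K)" and ?d = "copair C (Ident C K) (Ident C K)"
  have c: "?c \<in> hom C (coprd C K K) (prd C K K)" "?d \<in> hom C (coprd C K K) K"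
    using assms(1) by (simp_all add: hom_def)
  obtain m where m: "m \<in> hom C (prd C K K) K" "m \<cdot> ?c = ?d"
    using regular_epi_desc[OF coprd_prd_regular_epi[OF assms(1,1)] c(1) cosmash_arr_kernel[OF assms(1,1)] c(2)]
      assms by auto
  have "m \<cdot> (?c \<cdot> in1 C K K) = Ident C K" "m \<cdot> (?c \<cdot> in2 C K K) = Ident C K"
    using m(1) c assms(1) by (simp_all add: hom_def comp_reassoc[OF m(2)])
  then show ?thesis
    using unital_multiplication_abelian[OF assms(1) m(1)] assms(1) by (simp add: pair_comp)
qed

text \<open>\<open>K\<close> is covered by the cosmash product \<open>D\<close> of \<open>A\<close> and \<open>B\<close> in \<open>C\<close>, and the cosmash product of
  \<open>D\<close> and \<open>K\<close> factors through the ternary one of \<open>A\<close>, \<open>B\<close>, \<open>K\<close>, which vanishes in \<open>N\<close>.\<close>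

lemma two_nilpotent_cosmash_abelian:
  assumes N: "two_nilpotent C N" and ab: "a \<in> hom C A N" "b \<in> hom C B N" "jointly_extremal C a b"
    and r: "r \<in> hom C N A" "s \<in> hom C N B" "r \<cdot> a = Ident C A" "r \<cdot> b = zero_arr C B A"
      "s \<cdot> a = zero_arr C A B" "s \<cdot> b = Ident C B"
    and k: "is_mono C k" "k \<in> hom C K N" "r \<cdot> k = zero_arr C K A" "s \<cdot> k = zero_arr C K B"
    and lift: "\<And>T u. \<lbrakk>u \<in> hom C T N; r \<cdot> u = zero_arr C T A; s \<cdot> u = zero_arr C T B\<rbrakk>
           \<Longrightarrow> \<exists>h \<in> hom C T K. k \<cdot> h = u"
  shows "abelian_object C K"
proof -
  have o: "N \<in> Obj C" "A \<in> Obj C" "B \<in> Obj C" "K \<in> Obj C" using ab k hom_obj by blast+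
  have d: "a \<in> Arr C" "b \<in> Arr C" "Dom C a = A" "Dom C b = B" "Cod C a = N" "Cod C b = N"
    "k \<in> Arr C" "Dom C k = K" "Cod C k = N" using ab k by (auto simp: hom_def)
  let ?n = "copair C a b" and ?c = "cosmash_arr C A B" and ?D = "cosmash C A B"
  have D: "?D \<in> Obj C" using o by simp
  have n: "?n \<in> hom C (coprd C A B) N" using ab by (simp add: hom_def)
  have nreg: "is_regular_epi C ?n"
  proof (rule extremal_regular_epi[OF n])
    fix I j l assume j: "is_mono C j" "j \<in> hom C I N" "l \<in> hom C (coprd C A B) I" "j \<cdot> l = ?n"
    have "j \<cdot> (l \<cdot> in1 C A B) = a" "j \<cdot> (l \<cdot> in2 C A B) = b"
      using j(2,3) o d by (simp_all add: hom_def comp_reassoc[OF j(4)])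
    moreover have "l \<cdot> in1 C A B \<in> hom C A I" "l \<cdot> in2 C A B \<in> hom C B I"
      using j(3) o by (simp_all add: hom_def)
    ultimately show "is_iso C j"
      by (intro jointly_extremalD[OF ab(3) j(1)]) (use j(2) d in auto)
  qed
  have rn: "r \<cdot> ?n = ret1 A B" "s \<cdot> ?n = ret2 A B" using r ab by (simp_all add: hom_def comp_copair)
  have c: "?c \<in> hom C ?D (coprd C A B)" using o by (simp add: hom_def)
  have "r \<cdot> (?n \<cdot> ?c) = zero_arr C ?D A" "s \<cdot> (?n \<cdot> ?c) = zero_arr C ?D B"
    using r(1,2) n o by (simp_all add: hom_def comp_reassoc[OF rn(1)] comp_reassoc[OF rn(2)])
  then obtain e where e: "e \<in> hom C ?D K" "k \<cdot> e = ?n \<cdot> ?c" using lift Comp_in_hom[OF c n] by blast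
  \<comment> \<open>\<open>r\<close> and \<open>s\<close> restrict along \<open>?n\<close> to the
    retractions of \<open>A + B\<close>, so \<open>D\<close> is the preimage of \<open>K\<close>
    under \<open>?n\<close>, and \<open>e\<close> is a regular epimorphism because \<open>?n\<close>
    is.\<close>
  have "is_pullback C k ?n ?D e ?c"
  proof (rule is_pullbackI[OF k(2) n e(1) c e(2)])
    fix T x y assume xy: "x \<in> hom C T K" "y \<in> hom C T (coprd C A B)" "k \<cdot> x = ?n \<cdot> y"
    have "ret1 A B \<cdot> y = r \<cdot> (k \<cdot> x)" "ret2 A B \<cdot> y = s \<cdot> (k \<cdot> x)"
      unfolding xy(3) using xy(2) n r(1,2) by (simp_all add: hom_def comp_reassoc[OF rn(1)] comp_reassoc[OF rn(2)])
    then have "ret1 A B \<cdot> y = zero_arr C T A" "ret2 A B \<cdot> y = zero_arr C T B"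
      using xy(1) r(1,2) d o by (simp_all add: hom_def comp_reassoc[OF k(3)] comp_reassoc[OF k(4)])
    then obtain z where z: "z \<in> hom C T ?D" "?c \<cdot> z = y" using cosmash_lift[OF xy(2) o(2,3)] by metis
    have "k \<cdot> (e \<cdot> z) = k \<cdot> x"
      unfolding xy(3) using z(1) e(1) d n c by (simp add: hom_def comp_reassoc[OF e(2)] z(2))
    then have "e \<cdot> z = x" by (rule mono_cancel[OF k(1)]) (use z e xy d in \<open>auto simp: hom_def\<close>)
    with z show "\<exists>z \<in> hom C T ?D. e \<cdot> z = x \<and> ?c \<cdot> z = y" by blast
  next
    fix T x y assume "x \<in> hom C T ?D" "y \<in> hom C T ?D" "?c \<cdot> x = ?c \<cdot> y"
    then show "x = y" using mono_cancel[OF cosmash_arr_mono[OF o(2,3)], of x y] o by (auto simp: hom_def)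
  qed
  then have ereg: "is_regular_epi C e" using regular_epi_pullback nreg by blast
  have ed: "e \<in> Arr C" "Dom C e = ?D" "Cod C e = K" using e by (auto simp: hom_def)
  let ?F = "coprd_map C e (Ident C K)"
  have F: "is_regular_epi C ?F" "?F \<in> hom C (coprd C ?D K) (coprd C K K)"
    using coprd_map_regular_epi[OF ereg ident_regular_epi[OF o(4)]] ed o by (simp_all add: hom_def)
  \<comment> \<open>The binary cosmash product as the joint kernel of the two idempotents of the sum
    that kill one summand: \<open>j\<close> plays the role of the cosmash product of
    \<open>D\<close> and \<open>K\<close>, \<open>j'\<close> that of \<open>K\<close> with
    itself.\<close>
  let ?es = "[(in1 C ?D K \<cdot> ret1 ?D K, in1 C K K \<cdot> ret1 K K), (in2 C ?D K \<cdot> ret2 ?D K, in2 C K K \<cdot> ret2 K K)]"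
  have "\<exists>j j' v. is_joint_kernel C (coprd C ?D K) (fst ` set ?es) j \<and>
      is_joint_kernel C (coprd C K K) (snd ` set ?es) j' \<and>
      v \<in> hom C (Dom C j) (Dom C j') \<and> is_regular_epi C v \<and> j' \<cdot> v = ?F \<cdot> j"
  proof (rule idempotents_joint_kernel_regular_epi[OF F])
    fix x x' assume "(x, x') \<in> set ?es"
    then show "x \<in> hom C (coprd C ?D K) (coprd C ?D K) \<and> x' \<in> hom C (coprd C K K) (coprd C K K) \<and>
           x \<cdot> x = x \<and> x' \<cdot> x' = x' \<and> x' \<cdot> ?F = ?F \<cdot> x"
      using o ed D by (auto simp: hom_def comp_copair copair_coprd_map)
  next
    fix x x' y y' assume "(x, x') \<in> set ?es" "(y, y') \<in> set ?es"
    then show "x \<cdot> y = y \<cdot> x \<and> x' \<cdot> y' = y' \<cdot> x'"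
      using o ed D by (auto simp: comp_copair)
  qed
  then obtain j j' v where
    j: "is_joint_kernel C (coprd C ?D K) {in1 C ?D K \<cdot> ret1 ?D K, in2 C ?D K \<cdot> ret2 ?D K} j"
      "is_joint_kernel C (coprd C K K) {in1 C K K \<cdot> ret1 K K, in2 C K K \<cdot> ret2 K K} j'"
      "v \<in> hom C (Dom C j) (Dom C j')" "is_regular_epi C v" "j' \<cdot> v = ?F \<cdot> j"
    by (auto simp del: comp_assoc)
  note jd = joint_kernelD[OF j(1)] and jd' = joint_kernelD[OF j(2)]
  have jh: "j \<in> hom C (Dom C j) (coprd C ?D K)" "j' \<in> hom C (Dom C j') (coprd C K K)"
    using jd jd' by (simp_all add: hom_def)
  have jo: "Dom C j \<in> Obj C" "Dom C j' \<in> Obj C" using jh hom_obj by blast+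
  have rj: "ret1 ?D K \<cdot> j = zero_arr C (Dom C j) ?D" "ret2 ?D K \<cdot> j = zero_arr C (Dom C j) K"
  proof -
    have "ret1 ?D K \<cdot> ((in1 C ?D K \<cdot> ret1 ?D K) \<cdot> j) = zero_arr C (Dom C j) ?D"
      "ret2 ?D K \<cdot> ((in2 C ?D K \<cdot> ret2 ?D K) \<cdot> j) = zero_arr C (Dom C j) K"
      using jd(4) o D jo by simp_all
    then show "ret1 ?D K \<cdot> j = zero_arr C (Dom C j) ?D" "ret2 ?D K \<cdot> j = zero_arr C (Dom C j) K"
      using o D jd(2,3) by simp_all
  qed
  let ?M = "coprd_map C ?c (Ident C K)"
  have M: "?M \<in> hom C (coprd C ?D K) (coprd3 A B K)" using o by (simp add: hom_def)
  have "copair C (in1 C A B) (in2 C A B) = Ident C (coprd C A B)"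
    by (rule coprd_ext[of _ A B "coprd C A B"]) (use o in \<open>simp_all add: hom_def\<close>)
  \<comment> \<open>On \<open>A + B\<close>, the retraction \<open>ret13\<close> is
    \<open>ret1 A B\<close> followed by an injection, and \<open>ret23\<close> is
    \<open>ret2 A B\<close> followed by one. Both kill \<open>D\<close>, so along \<open>?M\<close>
    they see only the summand \<open>K\<close>, while \<open>ret12\<close> sees only
    \<open>D\<close>. Since \<open>j\<close> dies in both summands, \<open>?M \<cdot> j\<close> lies
    in the ternary cosmash product.\<close>
  moreover have "(in1 C A K \<cdot> ret1 A B) \<cdot> ?c = zero_arr C ?D (coprd C A K)"
    "(in1 C B K \<cdot> ret2 A B) \<cdot> ?c = zero_arr C ?D (coprd C B K)"
    using o by simp_all
  then have "copair C (in1 C A K) (zero_arr C B (coprd C A K)) \<cdot> ?c = zero_arr C ?D (coprd C A K)"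
    "copair C (zero_arr C A (coprd C B K)) (in1 C B K) \<cdot> ?c = zero_arr C ?D (coprd C B K)"
    using o by (simp_all add: comp_copair del: comp_assoc)
  ultimately have "ret12 A B K \<cdot> ?M = ?c \<cdot> ret1 ?D K" "ret13 A B K \<cdot> ?M = in2 C A K \<cdot> ret2 ?D K"
    "ret23 A B K \<cdot> ?M = in2 C B K \<cdot> ret2 ?D K"
    using o by (simp_all add: copair3_def copair_coprd_map comp_copair)
  note this[THEN comp_reassoc, of j]
  then have "ret12 A B K \<cdot> (?M \<cdot> j) = ?c \<cdot> (ret1 ?D K \<cdot> j)"
    "ret13 A B K \<cdot> (?M \<cdot> j) = in2 C A K \<cdot> (ret2 ?D K \<cdot> j)"
    "ret23 A B K \<cdot> (?M \<cdot> j) = in2 C B K \<cdot> (ret2 ?D K \<cdot> j)"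
    using o D jh by (simp_all add: copair3_def hom_def)
  then have "killed_by_rets A B K (Dom C j) (?M \<cdot> j)"
    using o D jo Comp_in_hom[OF jh(1) M] by (simp add: rj)
  then have z: "copair3 C a b k \<cdot> (?M \<cdot> j) = zero_arr C (Dom C j) N"
    by (rule two_nilpotentD[OF N _ ab(1,2) k(2)])
  \<comment> \<open>Along \<open>?M\<close> the arrow \<open>[a, b, k]\<close> becomes
    \<open>k\<close> after \<open>[e, 1]\<close>, so cancelling \<open>k\<close> gives an equation
    in \<open>K\<close>. As \<open>[e, 1]\<close> is the codiagonal of \<open>K\<close> after
    \<open>?F\<close>, cancelling the epimorphism \<open>v\<close> then moves it to the cosmash
    product of \<open>K\<close> with itself.\<close>
  have "copair3 C a b k \<cdot> ?M = k \<cdot> copair C e (Ident C K)"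
    using o d ed by (simp add: copair3_def copair_coprd_map comp_copair e(2))
  note this[THEN comp_reassoc, of j]
  then have "k \<cdot> (copair C e (Ident C K) \<cdot> j) = k \<cdot> zero_arr C (Dom C j) K"
    using z o d ed jh jo by (simp add: copair3_def hom_def)
  then have ej: "copair C e (Ident C K) \<cdot> j = zero_arr C (Dom C j) K"
    by (rule mono_cancel[OF k(1)]) (use o d ed jh jo in \<open>auto simp: hom_def\<close>)
  let ?d = "copair C (Ident C K) (Ident C K)"
  have "?d \<cdot> ?F = copair C e (Ident C K)" using o ed by (simp add: copair_coprd_map)
  note dF = comp_reassoc[OF this]
  have "(?d \<cdot> j') \<cdot> v = zero_arr C (Dom C j') K \<cdot> v"
    using o jh jo j(3) ed dF[of j] by (simp add: hom_def j(5) ej)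
  then have dj: "?d \<cdot> j' = zero_arr C (Dom C j') K"
    by (rule epi_cancel[OF regular_epi_is_epi[OF j(4)]]) (use o jh jo j(3) in \<open>auto simp: hom_def\<close>)
  have "\<exists>h \<in> hom C (cosmash C K K) (Dom C j'). j' \<cdot> h = cosmash_arr C K K"
    by (rule joint_kernel_lift[OF j(2)]) (use o in \<open>auto simp: hom_def\<close>)
  then obtain h where h: "h \<in> hom C (cosmash C K K) (Dom C j')" "j' \<cdot> h = cosmash_arr C K K" by blast
  have "?d \<cdot> (j' \<cdot> h) = zero_arr C (cosmash C K K) K"
    using h(1) jh o by (simp add: hom_def comp_reassoc[OF dj])
  then show ?thesis using abelian_object_if_codiagonal_kills[OF o(4)] h(2) by simp
qed

section \<open>The bilinear product\<close>

text \<open>Arrows \<open>u\<close> and \<open>v\<close> from an arbitrary object are tested on the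
  image of \<open>(u, v)\<close> in the square of \<open>X\<close>. This image is two-nilpotent, so
  its two projections are compared in \<open>Nil2 C\<close>.\<close>

lemma mono_Nil2:
  assumes "is_mono (Nil2 C) k" "k \<in> hom (Nil2 C) X Y"
  shows "is_mono C k"
proof -
  have k: "k \<in> hom C X Y" "two_nilpotent C X" "two_nilpotent C Y" using assms(2) by (auto simp: hom_Nil2)
  have o: "X \<in> Obj C" using k hom_obj by blast
  show ?thesis
  proof (rule is_monoI[OF k(1)])
    fix T u v assume uv: "u \<in> hom C T X" "v \<in> hom C T X" "k \<cdot> u = k \<cdot> v"
    have "pair C u v \<in> hom C T (prd C X X)" using uv by (simp add: hom_def)
    then obtain I m e where m: "is_regular_epi C e" "is_mono C m" "e \<in> hom C T I"
        "m \<in> hom C I (prd C X X)" "m \<cdot> e = pair C u v"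
      using image_factorization by metis
    have I: "two_nilpotent C I" by (rule two_nilpotent_subobject[OF two_nilpotent_prd[OF k(2,2)] m(2,4)])
    let ?m1 = "pr1 C X X \<cdot> m" and ?m2 = "pr2 C X X \<cdot> m"
    have mh: "?m1 \<in> hom C I X" "?m2 \<in> hom C I X" using m(4) o by (simp_all add: hom_def)
    have me: "?m1 \<cdot> e = u" "?m2 \<cdot> e = v" using m(3,4) o uv(1,2) by (simp_all add: hom_def m(5))
    have "(k \<cdot> ?m1) \<cdot> e = k \<cdot> (?m1 \<cdot> e)" "(k \<cdot> ?m2) \<cdot> e = k \<cdot> (?m2 \<cdot> e)"
      using Comp_assoc[OF m(3) mh(1) k(1)] Comp_assoc[OF m(3) mh(2) k(1)] by auto
    then have "(k \<cdot> ?m1) \<cdot> e = (k \<cdot> ?m2) \<cdot> e" unfolding me using uv(3) by metis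
    then have "k \<cdot> ?m1 = k \<cdot> ?m2"
      by (rule epi_cancel[OF regular_epi_is_epi[OF m(1)]]) (use mh m(3,4) k(1) o in \<open>auto simp: hom_def\<close>)
    then have "?m1 = ?m2"
      using Nil2.mono_cancel[OF assms(1), of ?m1 ?m2] mh I k by (simp add: hom_def)
    then show "u = v" using me by metis
  qed
qed

text \<open>The work lies in carrying the universal properties of \<open>coprd\<close> and
  \<open>cosmash\<close>, known in \<open>Nil2 C\<close> for two-nilpotent objects only, over to
  \<open>C\<close>.\<close>

lemma Nil2_cosmash_abelian:
  assumes n: "two_nilpotent C A" "two_nilpotent C B"
  shows "abelian_object C (cosmash (Nil2 C) A B)"
proof -
  let ?N = "coprd (Nil2 C) A B" and ?a = "in1 (Nil2 C) A B" and ?b = "in2 (Nil2 C) A B"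
  let ?k = "cosmash_arr (Nil2 C) A B" and ?K = "cosmash (Nil2 C) A B"
  let ?r = "Nil2.ret1 A B" and ?s = "Nil2.ret2 A B"
  have nO: "A \<in> Obj (Nil2 C)" "B \<in> Obj (Nil2 C)" using n by simp_all
  have o: "A \<in> Obj C" "B \<in> Obj C" using n two_nilpotent_obj by auto
  have N: "two_nilpotent C ?N" and K: "two_nilpotent C ?K"
    using Nil2.coprd_obj[OF nO] Nil2.cosmash_obj[OF nO] by simp_all
  have abN: "?a \<in> hom (Nil2 C) A ?N" "?b \<in> hom (Nil2 C) B ?N"
    using Nil2.in_simps[OF nO] by (simp_all add: hom_def)
  then have ab: "?a \<in> hom C A ?N" "?b \<in> hom C B ?N" by (simp_all add: hom_Nil2)
  have rN: "?r \<in> hom (Nil2 C) ?N A" "?s \<in> hom (Nil2 C) ?N B"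
    using Nil2.copair_simps[of "Ident (Nil2 C) A" "zero_arr (Nil2 C) B A"]
      Nil2.copair_simps[of "zero_arr (Nil2 C) A B" "Ident (Nil2 C) B"] n o
    by (simp_all add: hom_def)
  then have r: "?r \<in> hom C ?N A" "?s \<in> hom C ?N B" using n by (simp_all add: hom_Nil2)
  have re: "?r \<cdot> ?a = Ident C A" "?r \<cdot> ?b = zero_arr C B A" "?s \<cdot> ?a = zero_arr C A B" "?s \<cdot> ?b = Ident C B"
    using Nil2.copair_in[of "Ident (Nil2 C) A" "zero_arr (Nil2 C) B A" A B]
      Nil2.copair_in[of "zero_arr (Nil2 C) A B" "Ident (Nil2 C) B" A B] n o
    by simp_all
  have kN: "?k \<in> hom (Nil2 C) ?K ?N" using Nil2.cosmash_arr_simps[OF nO] by (simp add: hom_def)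
  then have k: "?k \<in> hom C ?K ?N" by (simp add: hom_Nil2)
  have km: "is_mono C ?k" by (rule mono_Nil2[OF Nil2.cosmash_arr_mono[OF nO] kN])
  have kr: "?r \<cdot> ?k = zero_arr C ?K A" "?s \<cdot> ?k = zero_arr C ?K B"
    using Nil2.ret_cosmash_arr[OF nO] n K by simp_all
  have je: "jointly_extremal C ?a ?b"
    unfolding jointly_extremal_def
  proof (intro conjI allI impI)
    \<comment> \<open>The subobject is itself two-nilpotent, so the two factorisations induce an
      arrow from the coproduct of \<open>Nil2 C\<close> into it; this arrow is a section of
      \<open>j\<close>.\<close>
    fix j assume j: "is_mono C j \<and> Cod C j = Cod C ?a \<and>
      (\<exists>u \<in> hom C (Dom C ?a) (Dom C j). j \<cdot> u = ?a) \<and> (\<exists>v \<in> hom C (Dom C ?b) (Dom C j). j \<cdot> v = ?b)"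
    let ?J = "Dom C j"
    have jh: "is_mono C j" "j \<in> hom C ?J ?N" using j ab is_mono_arr by (auto simp: hom_def)
    have J: "two_nilpotent C ?J" by (rule two_nilpotent_subobject[OF N jh])
    obtain u v where uv: "u \<in> hom C A ?J" "j \<cdot> u = ?a" "v \<in> hom C B ?J" "j \<cdot> v = ?b"
      using j ab by (auto simp: hom_def)
    let ?h = "copair (Nil2 C) u v"
    have "u \<in> Arr (Nil2 C)" "v \<in> Arr (Nil2 C)" "Cod C u = Cod C v" "Dom C u = A" "Dom C v = B" "Cod C v = ?J"
      using uv n J by (auto simp: hom_def)
    then have h: "?h \<in> hom (Nil2 C) ?N ?J" "?h \<cdot> ?a = u" "?h \<cdot> ?b = v"
      using Nil2.copair_simps[of u v] Nil2.copair_in[of u v A B] by (simp_all add: hom_def)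
    then have hC: "?h \<in> hom C ?N ?J" by (simp add: hom_Nil2)
    have "j \<cdot> ?h = Ident C ?N"
    proof (rule Nil2.coprd_ext[of _ A B ?N])
      show "j \<cdot> ?h \<in> hom (Nil2 C) ?N ?N" "Ident C ?N \<in> hom (Nil2 C) ?N ?N"
        using jh hC N two_nilpotent_obj[OF N] Comp_in_hom by (auto simp: hom_Nil2 Ident_in_hom)
      show "(j \<cdot> ?h) \<cdot>\<^bsub>Nil2 C\<^esub> ?a = Ident C ?N \<cdot>\<^bsub>Nil2 C\<^esub> ?a" "(j \<cdot> ?h) \<cdot>\<^bsub>Nil2 C\<^esub> ?b = Ident C ?N \<cdot>\<^bsub>Nil2 C\<^esub> ?b"
        using jh(2) hC ab uv h(2,3) by (simp_all add: hom_def)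
    qed (use nO in auto)
    then show "is_iso C j" using split_epi_mono_is_iso[OF jh hC] by blast
  qed (use ab in \<open>auto simp: hom_def\<close>)
  show ?thesis
  proof (rule two_nilpotent_cosmash_abelian[OF N ab je r re km k kr])
    \<comment> \<open>The test object \<open>T\<close> need not be two-nilpotent, but the image of
      \<open>u\<close> is. The retractions kill the image because they kill \<open>u\<close> and
      \<open>e\<close> is epic, so the image lifts to \<open>?K\<close>, and \<open>u\<close> with
      it.\<close>
    fix T u assume u: "u \<in> hom C T ?N" "?r \<cdot> u = zero_arr C T A" "?s \<cdot> u = zero_arr C T B"
    obtain I m e where m: "is_regular_epi C e" "is_mono C m" "e \<in> hom C T I" "m \<in> hom C I ?N" "m \<cdot> e = u"
      using image_factorization[OF u(1)] by metis
    have I: "two_nilpotent C I" by (rule two_nilpotent_subobject[OF N m(2,4)])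
    have IO: "I \<in> Obj C" using I by (rule two_nilpotent_obj)
    have kill: "x \<cdot> m = zero_arr C I X" if x: "x \<in> hom C ?N X" "x \<cdot> u = zero_arr C T X" for x X
    proof -
      have "X \<in> Obj C" using x hom_obj by blast
      then have "(x \<cdot> m) \<cdot> e = zero_arr C I X \<cdot> e" using x m(3,4) by (simp add: hom_def m(5))
      then show ?thesis
        by (rule epi_cancel[OF regular_epi_is_epi[OF m(1)]])
          (use x m(3,4) IO \<open>X \<in> Obj C\<close> in \<open>auto simp: hom_def\<close>)
    qed
    have mN: "m \<in> hom (Nil2 C) I ?N" using m I N by (simp add: hom_Nil2)
    have mr: "?r \<cdot>\<^bsub>Nil2 C\<^esub> m = zero_arr (Nil2 C) I A" "?s \<cdot>\<^bsub>Nil2 C\<^esub> m = zero_arr (Nil2 C) I B"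
      using kill[OF r(1) u(2)] kill[OF r(2) u(3)] I n by simp_all
    obtain h where h: "h \<in> hom (Nil2 C) I ?K" "?k \<cdot> h = m"
      using Nil2.cosmash_lift[OF mN nO mr] by auto
    then have "?k \<cdot> (h \<cdot> e) = u" "h \<cdot> e \<in> hom C T ?K"
      using m(3,5) k comp_reassoc[OF h(2), of e] by (auto simp: hom_Nil2 hom_def)
    then show "\<exists>h \<in> hom C T ?K. ?k \<cdot> h = u" by blast
  qed
qed

lemma bilinear_product_abelian:
  "\<lbrakk>X \<in> Obj C; Y \<in> Obj C\<rbrakk> \<Longrightarrow> abelian_object C (bilinear_product C X Y)"
  unfolding bilinear_product_def by (intro Nil2_cosmash_abelian nil2_unit_props)

lemma nil2_map_Nil2: "f \<in> hom C X Y \<Longrightarrow> nil2_map C f \<in> hom (Nil2 C) (nil2 C X) (nil2 C Y)"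
  using nil2_map_props(1) nil2_unit_props(3) hom_obj by (metis hom_Nil2)

lemma bilinear_product_map_hom:
  assumes "f \<in> hom C X X'" "g \<in> hom C Y Y'"
  shows "bilinear_product_map C f g \<in> hom C (bilinear_product C X Y) (bilinear_product C X' Y')"
proof -
  note h = nil2_map_Nil2[OF assms(1)] nil2_map_Nil2[OF assms(2)]
  then have "nil2_map C f \<in> Arr (Nil2 C)" "nil2_map C g \<in> Arr (Nil2 C)"
    "Dom C (nil2_map C f) = nil2 C X" "Cod C (nil2_map C f) = nil2 C X'"
    "Dom C (nil2_map C g) = nil2 C Y" "Cod C (nil2_map C g) = nil2 C Y'"
    by (auto simp: hom_def)
  then show ?thesis
    using Nil2.cosmash_map_props[of "nil2_map C f" "nil2_map C g"]
    by (simp add: bilinear_product_map_def bilinear_product_def hom_Nil2)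
qed

lemma bilinear_product_functor:
  "is_functor (prod_cat C C) (Ab C)
    (\<lambda>(X, Y). bilinear_product C X Y) (\<lambda>(f, g). bilinear_product_map C f g)"
proof (intro is_functor.intro is_functor_axioms.intro)
  show "category (prod_cat C C)" by (rule prod_cat_category) unfold_locales
  show "category (Ab C)" unfolding Ab_def by (rule full_subcat_category)
  have obj: "bilinear_product C X Y \<in> Obj C" if "X \<in> Obj C" "Y \<in> Obj C" for X Y
    using bilinear_product_abelian[OF that] by (auto simp: abelian_object_def is_internal_abelian_group_def)
  show "(case X of (X, Y) \<Rightarrow> bilinear_product C X Y) \<in> Obj (Ab C)" if "X \<in> Obj (prod_cat C C)" for X
    using that obj bilinear_product_abelian by (auto simp: Ab_def)
  fix f X Y
  assume f: "f \<in> hom (prod_cat C C) X Y"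
  then have f': "fst f \<in> hom C (fst X) (fst Y)" "snd f \<in> hom C (snd X) (snd Y)" by (simp_all add: hom_prod_cat)
  then show "(case f of (f, g) \<Rightarrow> bilinear_product_map C f g)
      \<in> hom (Ab C) (case X of (X, Y) \<Rightarrow> bilinear_product C X Y) (case Y of (X, Y) \<Rightarrow> bilinear_product C X Y)"
    using bilinear_product_map_hom[OF f'] bilinear_product_abelian hom_obj[OF f'(1)] hom_obj[OF f'(2)]
    by (simp add: Ab_def hom_full_subcat split_beta)
  fix g Z
  assume "g \<in> hom (prod_cat C C) Y Z"
  then have g': "fst g \<in> hom C (fst Y) (fst Z)" "snd g \<in> hom C (snd Y) (snd Z)" by (simp_all add: hom_prod_cat)
  show "(case g \<cdot>\<^bsub>prod_cat C C\<^esub> f of (f, g) \<Rightarrow> bilinear_product_map C f g) =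
      (case g of (f, g) \<Rightarrow> bilinear_product_map C f g) \<cdot>\<^bsub>Ab C\<^esub>
      (case f of (f, g) \<Rightarrow> bilinear_product_map C f g)"
    using Nil2.cosmash_map_comp[OF nil2_map_Nil2[OF f'(1)] nil2_map_Nil2[OF g'(1)]
        nil2_map_Nil2[OF f'(2)] nil2_map_Nil2[OF g'(2)]]
    by (simp add: Ab_def split_beta bilinear_product_map_def nil2_map_comp[OF f'(1) g'(1)]
        nil2_map_comp[OF f'(2) g'(2)])
next
  fix X :: "'o \<times> 'o" assume "X \<in> Obj (prod_cat C C)"
  then have X: "fst X \<in> Obj C" "snd X \<in> Obj C" by (cases X; simp)+
  then have "cosmash_map (Nil2 C) (Ident (Nil2 C) (nil2 C (fst X))) (Ident (Nil2 C) (nil2 C (snd X)))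
      = Ident (Nil2 C) (cosmash (Nil2 C) (nil2 C (fst X)) (nil2 C (snd X)))"
    by (intro Nil2.cosmash_map_ident) (simp_all add: nil2_unit_props(3))
  then show "(case Ident (prod_cat C C) X of (f, g) \<Rightarrow> bilinear_product_map C f g) =
      Ident (Ab C) (case X of (X, Y) \<Rightarrow> bilinear_product C X Y)"
    using X by (simp add: Ab_def split_beta bilinear_product_map_def bilinear_product_def nil2_map_ident)
qed

end

theorem proposition2p11:
  fixes C :: "('o, 'm) cat"
  assumes "semi_abelian_category C"
  shows "(\<forall>X \<in> Obj C. \<forall>Y \<in> Obj C. abelian_object C (bilinear_product C X Y)) \<and>
    is_functor (prod_cat C C) (Ab C)
      (\<lambda>(X, Y). bilinear_product C X Y) (\<lambda>(f, g). bilinear_product_map C f g)"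
proof (intro conjI ballI)
  interpret semi_abelian_category C by (rule assms)
  show "abelian_object C (bilinear_product C X Y)" if "X \<in> Obj C" "Y \<in> Obj C" for X Y
    using that by (rule bilinear_product_abelian)
  show "is_functor (prod_cat C C) (Ab C)
      (\<lambda>(X, Y). bilinear_product C X Y) (\<lambda>(f, g). bilinear_product_map C f g)"
    by (rule bilinear_product_functor)
qed

end
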